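(* Let $k$ be a field of arbitrary characteristic and $n\ge 1$ an integer. Then the commuting exponential maps conjecture $CE(n)$ over $k$ holds if and only if the weak Abhyankar–Sathaye conjecture $WAS(n)$ over $k$ holds.
   Context: $k^{[m]}$ denotes the polynomial ring in $m$ variables over $k$ (similarly over other rings). An element $f$ of $B=k[X_1,\dots,X_n]=k^{[n]}$ is a coordinate of $B$ if $B=k[f,f_2,\dots,f_n]$ for some $f_2,\dots,f_n\in B$. An exponential map $\delta\in \mathrm{EXP}(B)$ on an integral domain $B$ containing $k$ is a family $\{D_m\}_{m\ge 0}$ of $k$-linear endomorphisms of $B$ such that: (1) $D_0=\mathrm{id}$; (2) for every $b\in B$ there is $m>0$ with $D_i(b)=0$ for all $i\ge m$; (3) $D_m(xy)=\sum_{i=0}^m D_i(x)D_{m-i}(y)$ for all $x,y\in B$, $m\ge 0$; (4) $D_j\circ D_i=\binom{i+j}{j}D_{i+j}$ for all $i,j\ge 0$. Its ring of invariants is $B^\delta=\{b\in B: D_i(b)=0 \text{ for all } i\ge 1\}$, and $\delta$ is non-trivial if $B^\delta\ne B$. Two exponential maps $\{D_m\}$, $\{E_m\}$ commute if $D_iE_j=E_jD_i$ for all $i,j\ge 1$. A set $\{\delta_1,\dots,\delta_m\}$ of non-trivial exponential maps of $B$ is irredundant pairwise commuting if the $\delta_i$ pairwise commute and $\bigcap_{j\ne i}B^{\delta_j}\nsubseteq B^{\delta_i}$ for all $1\le i\le m$ (an empty intersection is $B$). $CE(n)$: if $B=k[X_1,\dots,X_n]=k^{[n]}$ and $\delta_1,\dots,\delta_{n-1}\in\mathrm{EXP}(B)$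 is a set of irredundant pairwise commuting exponential maps, then $\bigcap_{j=1}^{n-1}B^{\delta_j}=k[f]$ for some coordinate $f$ of $B$. $WAS(n)$: if $f\in k[X_1,\dots,X_n]$ satisfies $k(f)[X_1,\dots,X_n]=k(f)^{[n-1]}$ (that is, the localization of $k[X_1,\dots,X_n]$ at $k[f]\setminus\{0\}$ is a polynomial ring in $n-1$ variables over $k(f)$), then $f$ is a coordinate of $k[X_1,\dots,X_n]$. *)

theory Defs
  imports
    "HOL-Library.Poly_Mapping"
    "HOL-Computational_Algebra.Fraction_Field"
begin

section \<open>Polynomial rings as subrings of an ambient type\<close>

text \<open>
  Polynomials in the variables X_0, X_1, X_2, \<dots> (finitely many in each polynomial).
  A monomial is its finitely supported exponent vector.
\<close>

type_synonym 'a mpoly = "(nat \<Rightarrow>\<^sub>0 nat) \<Rightarrow>\<^sub>0 'a"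

text \<open>\<open>polys A n\<close> is A[X_0, \<dots>, X_(n-1)], for a subring A of the coefficient type.\<close>

definition polys :: "'a::zero set \<Rightarrow> nat \<Rightarrow> 'a mpoly set" where
  "polys A n = {p. \<forall>m \<in> Poly_Mapping.keys p.
      Poly_Mapping.lookup p m \<in> A \<and> Poly_Mapping.keys m \<subseteq> {..<n}}"

definition eval_mpoly :: "(nat \<Rightarrow> 'a) \<Rightarrow> 'a mpoly \<Rightarrow> 'a::comm_ring_1" where
  "eval_mpoly y p = (\<Sum>m \<in> Poly_Mapping.keys p.
      Poly_Mapping.lookup p m * (\<Prod>i \<in> Poly_Mapping.keys m. y i ^ Poly_Mapping.lookup m i))"

text \<open>\<open>adjoin A [y_1, \<dots>, y_m]\<close> is A[y_1, \<dots>, y_m], the ring of polynomial expressions.\<close>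

definition adjoin :: "'a::comm_ring_1 set \<Rightarrow> 'a list \<Rightarrow> 'a set" where
  "adjoin A ys = eval_mpoly ((!) ys) ` polys A (length ys)"

definition alg_independent :: "'a::comm_ring_1 set \<Rightarrow> 'a list \<Rightarrow> bool" where
  "alg_independent A ys \<longleftrightarrow> inj_on (eval_mpoly ((!) ys)) (polys A (length ys))"

text \<open>\<open>is_polynomial_ring A R m\<close> is R = \<open>A\<^bsup>[m]\<^esup>\<close>.\<close>

definition is_polynomial_ring :: "'a::comm_ring_1 set \<Rightarrow> 'a set \<Rightarrow> nat \<Rightarrow> bool" where
  "is_polynomial_ring A R m \<longleftrightarrow>
     (\<exists>ys. length ys = m \<and> alg_independent A ys \<and> R = adjoin A ys)"

text \<open>The copy of k inside the polynomial type, and B = k[X_0, \<dots>, X_(n-1)].\<close>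

definition base_field :: "'k::field mpoly set" where
  "base_field = range (Poly_Mapping.single 0)"

definition poly_ring :: "nat \<Rightarrow> 'k::field mpoly set" where
  "poly_ring n = polys UNIV n"

definition is_coordinate :: "nat \<Rightarrow> 'k::field mpoly \<Rightarrow> bool" where
  "is_coordinate n f \<longleftrightarrow> f \<in> poly_ring n \<and>
     (\<exists>fs. length (f # fs) = n \<and> set fs \<subseteq> poly_ring n \<and>
           poly_ring n = adjoin base_field (f # fs))"

section \<open>Exponential maps\<close>

text \<open>
  Here B is a subring of the ambient domain and K a subfield contained in B.  The D m are total
  functions on the ambient type, but only their restrictions to B matter.
\<close>

definition is_exp_map :: "'a::idom set \<Rightarrow> 'a set \<Rightarrow> (nat \<Rightarrow> 'a \<Rightarrow> 'a) \<Rightarrow> bool" where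
  "is_exp_map K B D \<longleftrightarrow>
     (\<forall>m. \<forall>x\<in>B. D m x \<in> B) \<and>
     (\<forall>m. \<forall>x\<in>B. \<forall>y\<in>B. D m (x + y) = D m x + D m y) \<and>
     (\<forall>m. \<forall>c\<in>K. \<forall>x\<in>B. D m (c * x) = c * D m x) \<and>
     (\<forall>x\<in>B. D 0 x = x) \<and>
     (\<forall>x\<in>B. \<exists>m>0. \<forall>i\<ge>m. D i x = 0) \<and>
     (\<forall>m. \<forall>x\<in>B. \<forall>y\<in>B. D m (x * y) = (\<Sum>i=0..m. D i x * D (m - i) y)) \<and>
     (\<forall>i j. \<forall>x\<in>B. D j (D i x) = of_nat ((i + j) choose j) * D (i + j) x)"

definition invariants :: "'a::idom set \<Rightarrow> (nat \<Rightarrow> 'a \<Rightarrow> 'a) \<Rightarrow> 'a set" where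
  "invariants B D = {b \<in> B. \<forall>i\<ge>1. D i b = 0}"

definition nontrivial_exp_map :: "'a::idom set \<Rightarrow> (nat \<Rightarrow> 'a \<Rightarrow> 'a) \<Rightarrow> bool" where
  "nontrivial_exp_map B D \<longleftrightarrow> invariants B D \<noteq> B"

definition exp_maps_commute ::
    "'a::idom set \<Rightarrow> (nat \<Rightarrow> 'a \<Rightarrow> 'a) \<Rightarrow> (nat \<Rightarrow> 'a \<Rightarrow> 'a) \<Rightarrow> bool" where
  "exp_maps_commute B D E \<longleftrightarrow> (\<forall>i\<ge>1. \<forall>j\<ge>1. \<forall>x\<in>B. D i (E j x) = E j (D i x))"

text \<open>
  \<open>common_invariants B \<delta> J\<close> is the intersection over j in J of the rings of invariants; the
  explicit factor B makes the empty intersection equal to B.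
\<close>

definition common_invariants ::
    "'a::idom set \<Rightarrow> (nat \<Rightarrow> nat \<Rightarrow> 'a \<Rightarrow> 'a) \<Rightarrow> nat set \<Rightarrow> 'a set" where
  "common_invariants B \<delta> J = B \<inter> (\<Inter>j\<in>J. invariants B (\<delta> j))"

text \<open>
  The family \<open>\<delta> 0, \<dots>, \<delta> (m - 1)\<close>.  Irredundancy forces its members to be distinct on B, so
  indexed families are the same as sets with m elements here.
\<close>

definition irredundant_commuting ::
    "'a::idom set \<Rightarrow> 'a set \<Rightarrow> nat \<Rightarrow> (nat \<Rightarrow> nat \<Rightarrow> 'a \<Rightarrow> 'a) \<Rightarrow> bool" where
  "irredundant_commuting K B m \<delta> \<longleftrightarrow>
     (\<forall>i<m. is_exp_map K B (\<delta> i) \<and> nontrivial_exp_map B (\<delta> i)) \<and>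
     (\<forall>i<m. \<forall>j<m. i \<noteq> j \<longrightarrow> exp_maps_commute B (\<delta> i) (\<delta> j)) \<and>
     (\<forall>i<m. \<not> common_invariants B \<delta> ({..<m} - {i}) \<subseteq> invariants B (\<delta> i))"

section \<open>The two conjectures\<close>

definition CE :: "'k::field itself \<Rightarrow> nat \<Rightarrow> bool" where
  "CE _ n \<longleftrightarrow>
     (\<forall>\<delta> :: nat \<Rightarrow> nat \<Rightarrow> 'k mpoly \<Rightarrow> 'k mpoly.
        irredundant_commuting base_field (poly_ring n) (n - 1) \<delta> \<longrightarrow>
        (\<exists>f. is_coordinate n f \<and>
             common_invariants (poly_ring n) \<delta> {..<n - 1} = adjoin base_field [f]))"

text \<open>The localization of a subring R at the nonzero elements of a subring S.\<close>

definition localize :: "'a::idom set \<Rightarrow> 'a set \<Rightarrow> 'a fract set" where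
  "localize R S = {Fract r s | r s. r \<in> R \<and> s \<in> S - {0}}"

text \<open>
  With S = k[f], \<open>localize S S\<close> is k(f) and \<open>localize (poly_ring n) S\<close> is
  k(f)[X_0, \<dots>, X_(n-1)].
\<close>

definition WAS :: "'k::field itself \<Rightarrow> nat \<Rightarrow> bool" where
  "WAS _ n \<longleftrightarrow>
     (\<forall>f :: 'k mpoly. f \<in> poly_ring n \<longrightarrow>
        is_polynomial_ring
          (localize (adjoin base_field [f]) (adjoin base_field [f]))
          (localize (poly_ring n) (adjoin base_field [f]))
          (n - 1) \<longrightarrow>
        is_coordinate n f)"

end

theory Submission
  imports Defs "HOL-Library.FuncSet" "HOL-Computational_Algebra.Polynomial_Factorial"
begin

text \<open>
  Write \<open>B = k[X\<^sub>0, \<dots>, X\<^sub>n\<^sub>-\<^sub>1]\<close>.  A commuting family of \<open>n - 1\<close> exponential maps and an element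
  \<open>f\<close> over which \<open>B\<close> is generically a polynomial ring are two descriptions of the same
  situation, linked by \<open>A = k[f]\<close>, where \<open>A\<close> is the ring of common invariants.

  From \<open>WAS\<close> to \<open>CE\<close>.  For one exponential map on a domain, an element \<open>x\<close> of least positive
  degree in \<open>T\<close> with leading coefficient \<open>c\<close> is a slice: after inverting \<open>c\<close> the domain becomes the
  polynomial ring in \<open>x\<close> over the invariants (\<open>slice_generates\<close>, \<open>slice_transcendental\<close>).  In
  characteristic \<open>p\<close> slices chosen independently for the several maps need not generate, so the
  invariants are imposed one map at a time.  Along this chain the leading coefficients can be moved
  into \<open>A\<close> by applying top operators of the remaining maps (\<open>exists_slice\<close>).  Hence \<open>B\<close> becomes a
  polynomial ring in \<open>n - 1\<close> variables over \<open>Frac A\<close> once \<open>A - {0}\<close> is inverted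
  (\<open>polynomial_structure\<close>), and counting monomials shows that \<open>A\<close> has transcendence degree 1 over
  \<open>k\<close> (\<open>alg_dependent_of_more_generators\<close>).

  It remains to see that \<open>A\<close> is generated by one element.  A Kronecker substitution embeds \<open>A\<close> into
  \<open>k[t]\<close>, also when \<open>k\<close> is finite (\<open>kronecker_nonconstant\<close>, \<open>A_embeds\<close>).  Moreover \<open>A\<close> is
  completely integrally closed, because \<open>B\<close> is (leading monomials,
  \<open>poly_ring_completely_integrally_closed\<close>) and \<open>A\<close> is closed under division in \<open>B\<close>.  A polynomial
  form of Lueroth's theorem then gives \<open>A = k[g]\<close> (\<open>subring_of_univariate_polys\<close>), and \<open>WAS\<close> makes
  \<open>g\<close> a coordinate.

  From \<open>CE\<close> to \<open>WAS\<close>.  If \<open>B\<close> is a polynomial ring in \<open>Y\<^sub>0, \<dots>, Y\<^sub>n\<^sub>-\<^sub>2\<close> over \<open>k(f)\<close> after inverting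
  \<open>k[f] - {0}\<close>, the translations \<open>Y\<^sub>i \<mapsto> Y\<^sub>i + s T\<close>, that is the Hasse derivatives scaled by powers of
  \<open>s\<close>, preserve \<open>B\<close> for a suitable \<open>s\<close> in \<open>k[f]\<close> (\<open>E_stable\<close>).  They form an irredundant commuting
  family with common invariants \<open>B \<inter> k(f)\<close>.  By \<open>CE\<close> this ring is \<open>k[g]\<close> with \<open>g\<close> a coordinate;
  then \<open>f\<close> is a polynomial in \<open>g\<close> and \<open>g\<close> is a rational function of \<open>f\<close>, which forces \<open>f\<close> to be
  linear in \<open>g\<close>.
\<close>

section \<open>Subrings and multivariate evaluation\<close>

abbreviation "keys \<equiv> Poly_Mapping.keys"
abbreviation "lookup \<equiv> Poly_Mapping.lookup"
abbreviation "single \<equiv> Poly_Mapping.single"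

definition is_subring :: "'a::comm_ring_1 set \<Rightarrow> bool" where
  "is_subring S \<longleftrightarrow> 1 \<in> S \<and> (\<forall>x\<in>S. \<forall>y\<in>S. x - y \<in> S \<and> x * y \<in> S)"

lemma is_subringI:
  assumes "1 \<in> S" "\<And>x y. x \<in> S \<Longrightarrow> y \<in> S \<Longrightarrow> x + y \<in> S"
    "\<And>x. x \<in> S \<Longrightarrow> - x \<in> S" "\<And>x y. x \<in> S \<Longrightarrow> y \<in> S \<Longrightarrow> x * y \<in> S"
  shows "is_subring S"
proof -
  have "x - y \<in> S" if "x \<in> S" "y \<in> S" for x y
    using assms(2)[OF that(1) assms(3)[OF that(2)]] by simp
  then show ?thesis using assms by (auto simp: is_subring_def)
qed

context
  fixes S :: "'a::comm_ring_1 set"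
  assumes S: "is_subring S"
begin

lemma subring_1: "1 \<in> S"
  and subring_diff: "x \<in> S \<Longrightarrow> y \<in> S \<Longrightarrow> x - y \<in> S"
  and subring_mult: "x \<in> S \<Longrightarrow> y \<in> S \<Longrightarrow> x * y \<in> S"
  using S by (auto simp: is_subring_def)

lemma subring_0: "0 \<in> S"
  using subring_diff[OF subring_1 subring_1] by simp

lemma subring_uminus: "x \<in> S \<Longrightarrow> - x \<in> S"
  using subring_diff[OF subring_0] by fastforce

lemma subring_add: "x \<in> S \<Longrightarrow> y \<in> S \<Longrightarrow> x + y \<in> S"
  using subring_diff[OF _ subring_uminus, of x y] by simp

lemma subring_power: "x \<in> S \<Longrightarrow> x ^ m \<in> S"
  by (induction m) (auto intro: subring_1 subring_mult)

lemma subring_sum: "(\<And>i. i \<in> I \<Longrightarrow> g i \<in> S) \<Longrightarrow> sum g I \<in> S"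
  by (induction I rule: infinite_finite_induct) (auto intro: subring_0 subring_add)

lemma subring_prod: "(\<And>i. i \<in> I \<Longrightarrow> g i \<in> S) \<Longrightarrow> prod g I \<in> S"
  by (induction I rule: infinite_finite_induct) (auto intro: subring_1 subring_mult)

lemma subring_of_nat: "of_nat m \<in> S"
  by (induction m) (auto intro: subring_0 subring_1 subring_add)

end

lemma mpoly_eq_sum_single: "p = (\<Sum>e\<in>keys p. single e (lookup p e))"
proof (rule poly_mapping_eqI)
  fix k
  have "lookup (\<Sum>e\<in>keys p. single e (lookup p e)) k
      = (\<Sum>e\<in>keys p. if e = k then lookup p e else 0)"
    by (simp add: lookup_sum lookup_single when_def)
  also have "\<dots> = lookup p k"
    by (auto simp: in_keys_iff)
  finally show "lookup p k = lookup (\<Sum>e\<in>keys p. single e (lookup p e)) k" by simp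
qed

lemma mpoly_induct [case_names single add]:
  fixes p :: "'a \<Rightarrow>\<^sub>0 'b::comm_monoid_add"
  assumes "\<And>e c. P (single e c)" "\<And>p q. P p \<Longrightarrow> P q \<Longrightarrow> P (p + q)"
  shows "P p"
proof -
  have "P 0" using assms(1)[of undefined 0] by simp
  then have "P (\<Sum>e\<in>I. single e (lookup p e))" for I
    by (induction I rule: infinite_finite_induct) (auto intro: assms)
  then show ?thesis using mpoly_eq_sum_single[of p] by metis
qed

definition monom_val :: "(nat \<Rightarrow> 'a::comm_ring_1) \<Rightarrow> (nat \<Rightarrow>\<^sub>0 nat) \<Rightarrow> 'a" where
  "monom_val y e = (\<Prod>i\<in>keys e. y i ^ lookup e i)"

lemma monom_val_superset:
  assumes "finite I" "keys e \<subseteq> I"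
  shows "monom_val y e = (\<Prod>i\<in>I. y i ^ lookup e i)"
  unfolding monom_val_def
  by (rule prod.mono_neutral_left) (use assms in \<open>auto simp: in_keys_iff\<close>)

lemma monom_val_0 [simp]: "monom_val y 0 = 1"
  by (simp add: monom_val_def)

lemma monom_val_single [simp]: "monom_val y (single i m) = y i ^ m"
  by (simp add: monom_val_def)

lemma monom_val_add: "monom_val y (d + e) = monom_val y d * monom_val y e"
proof -
  let ?I = "keys d \<union> keys e"
  have "monom_val y (d + e) = (\<Prod>i\<in>?I. y i ^ lookup (d + e) i)"
    by (rule monom_val_superset) (use keys_add[of d e] in auto)
  also have "\<dots> = (\<Prod>i\<in>?I. y i ^ lookup d i) * (\<Prod>i\<in>?I. y i ^ lookup e i)"
    by (simp add: lookup_add power_add prod.distrib)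
  also have "\<dots> = monom_val y d * monom_val y e"
    by (simp add: monom_val_superset[of ?I])
  finally show ?thesis .
qed

lemma monom_val_cong: "(\<And>i. i \<in> keys e \<Longrightarrow> y i = z i) \<Longrightarrow> monom_val y e = monom_val z e"
  unfolding monom_val_def by (rule prod.cong) auto

locale ring_map =
  fixes h :: "'a::comm_ring_1 \<Rightarrow> 'b::comm_ring_1"
  assumes h_0: "h 0 = 0" and h_1: "h 1 = 1"
    and h_add: "h (a + b) = h a + h b" and h_mult: "h (a * b) = h a * h b"
begin

text \<open>
  Coefficients are transported along \<open>h\<close>; with \<open>h\<close> the identity this is \<^const>\<open>eval_mpoly\<close>.
\<close>

definition hom_eval :: "(nat \<Rightarrow> 'b) \<Rightarrow> 'a mpoly \<Rightarrow> 'b" where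
  "hom_eval y p = (\<Sum>e\<in>keys p. h (lookup p e) * monom_val y e)"

lemma hom_eval_superset:
  assumes "finite I" "keys p \<subseteq> I"
  shows "hom_eval y p = (\<Sum>e\<in>I. h (lookup p e) * monom_val y e)"
  unfolding hom_eval_def
  by (rule sum.mono_neutral_left) (use assms in \<open>auto simp: in_keys_iff h_0\<close>)

lemma hom_eval_single [simp]: "hom_eval y (single e c) = h c * monom_val y e"
  by (simp add: hom_eval_def h_0)

lemma hom_eval_0 [simp]: "hom_eval y 0 = 0"
  by (simp add: hom_eval_def h_0)

lemma hom_eval_add: "hom_eval y (p + q) = hom_eval y p + hom_eval y q"
proof -
  let ?I = "keys p \<union> keys q"
  have "hom_eval y (p + q) = (\<Sum>e\<in>?I. h (lookup (p + q) e) * monom_val y e)"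
    by (rule hom_eval_superset) (use keys_add[of p q] in auto)
  also have "\<dots> = (\<Sum>e\<in>?I. h (lookup p e) * monom_val y e) + (\<Sum>e\<in>?I. h (lookup q e) * monom_val y e)"
    by (simp add: lookup_add h_add sum.distrib distrib_right)
  also have "\<dots> = hom_eval y p + hom_eval y q"
    by (simp add: hom_eval_superset[of ?I])
  finally show ?thesis .
qed

lemma hom_eval_mult: "hom_eval y (p * q) = hom_eval y p * hom_eval y q"
proof (induction p rule: mpoly_induct)
  case (single d c)
  show ?case
    by (induction q rule: mpoly_induct)
      (simp_all add: mult_single h_mult monom_val_add distrib_left distrib_right hom_eval_add mult_ac)
qed (simp_all add: distrib_right hom_eval_add)

lemma hom_eval_1 [simp]: "hom_eval y 1 = 1"
  by (simp add: h_1 flip: single_one)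

lemma hom_eval_uminus: "hom_eval y (- p) = - hom_eval y p"
  using hom_eval_add[of y p "- p"] by (simp add: eq_neg_iff_add_eq_0 add.commute)

lemma hom_eval_diff: "hom_eval y (p - q) = hom_eval y p - hom_eval y q"
  using hom_eval_add[of y p "- q"] by (simp add: hom_eval_uminus)

lemma hom_eval_sum: "hom_eval y (sum g I) = (\<Sum>i\<in>I. hom_eval y (g i))"
  by (induction I rule: infinite_finite_induct) (simp_all add: hom_eval_add)

lemma hom_eval_power: "hom_eval y (p ^ m) = hom_eval y p ^ m"
  by (induction m) (simp_all add: hom_eval_mult)

end

interpretation id_map: ring_map "\<lambda>x. x" by unfold_locales auto

lemma eval_mpoly_eq: "eval_mpoly = id_map.hom_eval"
  by (intro ext) (simp add: eval_mpoly_def id_map.hom_eval_def monom_val_def)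

lemmas eval_mpoly_simps [simp] =
  id_map.hom_eval_single[folded eval_mpoly_eq] id_map.hom_eval_0[folded eval_mpoly_eq]
  id_map.hom_eval_1[folded eval_mpoly_eq]
lemmas eval_mpoly_add = id_map.hom_eval_add[folded eval_mpoly_eq]
lemmas eval_mpoly_mult = id_map.hom_eval_mult[folded eval_mpoly_eq]
lemmas eval_mpoly_uminus = id_map.hom_eval_uminus[folded eval_mpoly_eq]
lemmas eval_mpoly_diff = id_map.hom_eval_diff[folded eval_mpoly_eq]
lemmas eval_mpoly_sum = id_map.hom_eval_sum[folded eval_mpoly_eq]
lemmas eval_mpoly_monom_val = id_map.hom_eval_def[folded eval_mpoly_eq]

definition var :: "nat \<Rightarrow> 'a::zero_neq_one mpoly" where
  "var i = single (single i 1) 1"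

lemma eval_mpoly_var [simp]: "eval_mpoly y (var i) = y i"
  by (simp add: var_def)

lemma polysI: "(\<And>e. e \<in> keys p \<Longrightarrow> lookup p e \<in> A \<and> keys e \<subseteq> {..<n}) \<Longrightarrow> p \<in> polys A n"
  by (simp add: polys_def)

lemma polysD: "p \<in> polys A n \<Longrightarrow> e \<in> keys p \<Longrightarrow> lookup p e \<in> A \<and> keys e \<subseteq> {..<n}"
  by (simp add: polys_def)

lemma polys_single: "c \<in> A \<Longrightarrow> keys e \<subseteq> {..<n} \<Longrightarrow> single e c \<in> polys A n"
  by (auto simp: polys_def)

lemma polys_mono: "A \<subseteq> A' \<Longrightarrow> n \<le> n' \<Longrightarrow> polys A n \<subseteq> polys A' n'"
  by (fastforce simp: polys_def)

lemma lookup_polys: "0 \<in> A \<Longrightarrow> p \<in> polys A n \<Longrightarrow> lookup p e \<in> A"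
  by (cases "e \<in> keys p") (auto simp: polys_def in_keys_iff)

lemma polys_subring:
  assumes A: "is_subring A"
  shows "is_subring (polys A n)"
proof -
  have add: "p + q \<in> polys A n" if "p \<in> polys A n" "q \<in> polys A n" for p q :: "'a mpoly"
  proof (rule polysI)
    fix e assume "e \<in> keys (p + q)"
    then have "e \<in> keys p \<or> e \<in> keys q" using keys_add[of p q] by auto
    then show "lookup (p + q) e \<in> A \<and> keys e \<subseteq> {..<n}"
      using polysD[OF that(1)] polysD[OF that(2)] lookup_polys[OF subring_0[OF A] that(1)]
        lookup_polys[OF subring_0[OF A] that(2)] subring_add[OF A]
      by (metis lookup_add)
  qed
  have sum: "sum g I \<in> polys A n" if "\<And>i. i \<in> I \<Longrightarrow> g i \<in> polys A n"
    for g :: "(nat \<Rightarrow>\<^sub>0 nat) \<Rightarrow> 'a mpoly" and I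
    using that
    by (induction I rule: infinite_finite_induct) (auto intro: add, auto simp: polys_def)
  have mult: "p * q \<in> polys A n" if p: "p \<in> polys A n" and q: "q \<in> polys A n" for p q :: "'a mpoly"
  proof -
    have "p * q = (\<Sum>d\<in>keys p. \<Sum>e\<in>keys q. single (d + e) (lookup p d * lookup q e))"
      by (subst mpoly_eq_sum_single[of p], subst mpoly_eq_sum_single[of q])
        (simp add: sum_product mult_single)
    also have "\<dots> \<in> polys A n"
    proof (intro sum polys_single subring_mult[OF A])
      fix d e assume "d \<in> keys p" "e \<in> keys q"
      then show "lookup p d \<in> A" "lookup q e \<in> A" "keys (d + e) \<subseteq> {..<n}"
        using polysD[OF p] polysD[OF q] keys_add[of d e] by blast+
    qed
    finally show ?thesis .
  qed
  show ?thesis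
  proof (rule is_subringI)
    show "1 \<in> polys A n"
      using polys_single[of 1 A 0 n] subring_1[OF A] by (simp flip: single_one)
    show "- p \<in> polys A n" if "p \<in> polys A n" for p
      using that by (auto simp: polys_def in_keys_iff intro: subring_uminus[OF A])
  qed (auto intro: add mult)
qed

lemma polys_var: "is_subring A \<Longrightarrow> i < n \<Longrightarrow> var i \<in> polys A n"
  unfolding var_def by (rule polys_single) (simp_all add: subring_1)

lemma monom_val_subring:
  assumes "is_subring T" "\<And>i. i \<in> keys e \<Longrightarrow> y i \<in> T"
  shows "monom_val y e \<in> T"
  unfolding monom_val_def by (intro subring_prod subring_power assms)

lemma adjoin_subring:
  assumes "is_subring A"
  shows "is_subring (adjoin A ys)"
proof -
  note [intro] = subring_1[OF polys_subring[OF assms]] subring_add[OF polys_subring[OF assms]]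
    subring_mult[OF polys_subring[OF assms]] subring_uminus[OF polys_subring[OF assms]]
  show ?thesis
  proof (rule is_subringI)
    show "1 \<in> adjoin A ys"
      unfolding adjoin_def by (rule image_eqI[of _ _ 1]) auto
    show "x + y \<in> adjoin A ys" "x * y \<in> adjoin A ys" if "x \<in> adjoin A ys" "y \<in> adjoin A ys" for x y
      using that unfolding adjoin_def by (auto simp flip: eval_mpoly_add eval_mpoly_mult)
    show "- x \<in> adjoin A ys" if "x \<in> adjoin A ys" for x
      using that unfolding adjoin_def by (auto simp flip: eval_mpoly_uminus)
  qed
qed

lemma adjoin_base: "a \<in> A \<Longrightarrow> a \<in> adjoin A ys"
  unfolding adjoin_def by (rule image_eqI[of _ _ "single 0 a"]) (auto intro: polys_single)

lemma adjoin_gen: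
  assumes "is_subring A" "i < length ys"
  shows "ys ! i \<in> adjoin A ys"
  unfolding adjoin_def
  by (rule image_eqI[of _ _ "var i"]) (use assms in \<open>auto intro: polys_var\<close>)

lemma adjoin_gens: "is_subring A \<Longrightarrow> set ys \<subseteq> adjoin A ys"
  by (auto simp: in_set_conv_nth intro: adjoin_gen)

lemma eval_mpoly_subring:
  assumes "is_subring T" "\<And>i. i < n \<Longrightarrow> y i \<in> T" "p \<in> polys T n"
  shows "eval_mpoly y p \<in> T"
  unfolding eval_mpoly_monom_val
  by (intro subring_sum subring_mult monom_val_subring assms) (use polysD[OF assms(3)] in auto)

lemma adjoin_least:
  assumes "is_subring T" "A \<subseteq> T" "set ys \<subseteq> T"
  shows "adjoin A ys \<subseteq> T"
proof
  fix x assume "x \<in> adjoin A ys"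
  then obtain p where "p \<in> polys T (length ys)" "x = eval_mpoly ((!) ys) p"
    using polys_mono[OF assms(2) order.refl] by (auto simp: adjoin_def)
  moreover have "ys ! i \<in> T" if "i < length ys" for i using that assms(3) nth_mem by blast
  ultimately show "x \<in> T" using eval_mpoly_subring[OF assms(1), of "length ys" "(!) ys" p] by simp
qed

lemma adjoin_subset_iff:
  assumes "is_subring A"
  shows "adjoin A ys \<subseteq> adjoin A zs \<longleftrightarrow> set ys \<subseteq> adjoin A zs"
proof
  assume "adjoin A ys \<subseteq> adjoin A zs"
  then show "set ys \<subseteq> adjoin A zs" using adjoin_gens[OF assms, of ys] by (rule subset_trans[rotated])
next
  assume "set ys \<subseteq> adjoin A zs"
  then show "adjoin A ys \<subseteq> adjoin A zs"
    by (intro adjoin_least[OF adjoin_subring[OF assms]] subsetI) (auto intro: adjoin_base)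
qed

lemma eval_mpoly_cong:
  assumes "p \<in> polys A n" "\<And>i. i < n \<Longrightarrow> y i = z i"
  shows "eval_mpoly y p = eval_mpoly z p"
  unfolding eval_mpoly_monom_val
  by (intro sum.cong refl arg_cong2[of _ _ _ _ "(*)"] monom_val_cong)
    (use assms polysD[OF assms(1)] in auto)

lemma alg_independent_iff:
  assumes "is_subring A"
  shows "alg_independent A ys \<longleftrightarrow>
    (\<forall>p\<in>polys A (length ys). eval_mpoly ((!) ys) p = 0 \<longrightarrow> p = 0)"
proof -
  note R = polys_subring[OF assms, of "length ys"]
  show ?thesis
  proof
    assume *: "alg_independent A ys"
    show "\<forall>p\<in>polys A (length ys). eval_mpoly ((!) ys) p = 0 \<longrightarrow> p = 0"
      using inj_onD[OF *[unfolded alg_independent_def], of _ 0] subring_0[OF R] by simp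
  next
    assume *: "\<forall>p\<in>polys A (length ys). eval_mpoly ((!) ys) p = 0 \<longrightarrow> p = 0"
    show "alg_independent A ys"
      unfolding alg_independent_def
    proof (rule inj_onI)
      fix p q assume "p \<in> polys A (length ys)" "q \<in> polys A (length ys)"
        "eval_mpoly ((!) ys) p = eval_mpoly ((!) ys) q"
      then have "p - q = 0"
        using *[rule_format, of "p - q"] subring_diff[OF R, of p q] by (simp add: eval_mpoly_diff)
      then show "p = q" by simp
    qed
  qed
qed

subsection \<open>Polynomial rings over a field\<close>

lemma poly_ring_subring: "is_subring (poly_ring n)"
  unfolding poly_ring_def by (rule polys_subring) (simp add: is_subring_def)

interpretation const_map: ring_map "single 0 :: 'k::comm_ring_1 \<Rightarrow> 'k mpoly"
  by unfold_locales (auto simp: single_add mult_single)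

lemma base_field_subring: "is_subring (base_field :: 'k::field mpoly set)"
  unfolding base_field_def
proof (rule is_subringI)
  show "(1::'k mpoly) \<in> range (single 0)" by (metis single_one rangeI)
qed (auto simp flip: single_add single_uminus simp: mult_single)

lemma base_field_subset: "base_field \<subseteq> poly_ring n"
  by (auto simp: base_field_def poly_ring_def intro: polys_single)

definition vars :: "nat \<Rightarrow> 'k::field mpoly list" where
  "vars n = map var [0..<n]"

lemma length_vars [simp]: "length (vars n) = n"
  by (simp add: vars_def)

lemma nth_vars [simp]: "i < n \<Longrightarrow> vars n ! i = var i"
  by (simp add: vars_def)

lemma vars_subset: "set (vars n) \<subseteq> (poly_ring n :: 'k::field mpoly set)"
  using polys_var[of "UNIV :: 'k set"] by (auto simp: vars_def poly_ring_def is_subring_def)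

lemma monom_val_vars:
  assumes "\<And>i. i \<in> keys e \<Longrightarrow> y i = (var i :: 'k::comm_ring_1 mpoly)"
  shows "monom_val y e = single e 1"
proof -
  have pow: "(var i :: 'k mpoly) ^ m = single (single i m) 1" for i m
    by (induction m) (simp_all add: var_def mult_single single_add[symmetric])
  have "monom_val y e = (\<Prod>i\<in>keys e. single (single i (lookup e i)) 1)"
    unfolding monom_val_def by (rule prod.cong) (simp_all add: assms pow)
  also have "\<dots> = single (\<Sum>i\<in>keys e. single i (lookup e i)) 1"
  proof -
    have "(\<Prod>i\<in>I. single (single i (lookup e i)) (1::'k)) = single (\<Sum>i\<in>I. single i (lookup e i)) 1"
      if "finite I" for I
      using that by (induction I) (simp_all add: mult_single)
    then show ?thesis by simp
  qed
  also have "(\<Sum>i\<in>keys e. single i (lookup e i)) = e"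
    by (rule mpoly_eq_sum_single[symmetric])
  finally show ?thesis .
qed

text \<open>
  Used below to check a property that is stable under ring operations on scalars and variables only.
\<close>

lemma poly_ring_least:
  assumes T: "is_subring T" and "base_field \<subseteq> T" "set (vars n) \<subseteq> T"
  shows "poly_ring n \<subseteq> T"
proof
  fix p :: "'a mpoly" assume p: "p \<in> poly_ring n"
  have "single e (lookup p e) \<in> T" if "e \<in> keys p" for e
  proof -
    have e: "keys e \<subseteq> {..<n}" using p that by (auto simp: poly_ring_def polys_def)
    have vars: "vars n ! i \<in> T" if "i \<in> keys e" for i
      using that e assms(3) by (metis length_vars lessThan_iff nth_mem subsetD)
    have "single e (lookup p e) = single 0 (lookup p e) * monom_val ((!) (vars n)) e"
      by (subst monom_val_vars) (use e in \<open>auto simp: mult_single\<close>)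
    also have "\<dots> \<in> T"
      by (intro subring_mult[OF T] monom_val_subring[OF T])
        (use assms vars in \<open>auto simp: base_field_def\<close>)
    finally show ?thesis .
  qed
  then show "p \<in> T"
    by (subst mpoly_eq_sum_single) (rule subring_sum[OF T])
qed

lemma poly_ring_eq_adjoin_vars: "poly_ring n = adjoin base_field (vars n)"
  by (intro antisym poly_ring_least adjoin_least adjoin_subring adjoin_gens poly_ring_subring
      base_field_subring base_field_subset vars_subset) (auto intro: adjoin_base)

lemma map_poly_single_add:
  "map_poly (single 0) (p + q) = map_poly (single 0) p + map_poly (single 0) q"
  by (simp add: poly_eq_iff coeff_map_poly single_add)

text \<open>
  The value \<open>p(f)\<close>; as \<open>p\<close> varies, these are the elements of \<open>k[f]\<close>.
\<close>

definition upoly :: "'k::field poly \<Rightarrow> 'k mpoly \<Rightarrow> 'k mpoly" where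
  "upoly p f = poly (map_poly (single 0) p) f"

lemma upoly_0 [simp]: "upoly 0 f = 0"
  and upoly_pCons [simp]: "upoly (pCons a p) f = single 0 a + f * upoly p f"
  by (simp_all add: upoly_def map_poly_pCons)

lemma upoly_1 [simp]: "upoly 1 f = 1"
  by (simp add: one_pCons)

lemma upoly_add: "upoly (p + q) f = upoly p f + upoly q f"
  by (simp add: upoly_def map_poly_single_add)

lemma upoly_smult: "upoly (smult c p) f = single 0 c * upoly p f"
  by (induction p) (simp_all add: mult_single algebra_simps)

lemma upoly_mult: "upoly (p * q) f = upoly p f * upoly q f"
  by (induction p) (simp_all add: upoly_add upoly_smult algebra_simps)

lemma upoly_uminus: "upoly (- p) f = - upoly p f"
  using upoly_add[of p "- p" f] by (simp add: eq_neg_iff_add_eq_0 add.commute)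

lemma upoly_subring:
  assumes "is_subring T" "base_field \<subseteq> T" "f \<in> T"
  shows "upoly p f \<in> T"
  by (induction p)
    (use assms in \<open>auto simp: base_field_def intro!: subring_0 subring_add subring_mult\<close>)

lemma adjoin_one: "adjoin base_field [f] = range (\<lambda>p. upoly p f)"
proof (rule antisym)
  show "adjoin base_field [f] \<subseteq> range (\<lambda>p. upoly p f)"
  proof (rule adjoin_least)
    show "is_subring (range (\<lambda>p. upoly p f))"
    proof (rule is_subringI)
      show "1 \<in> range (\<lambda>p. upoly p f)" by (metis upoly_1 rangeI)
    qed (auto simp flip: upoly_add upoly_mult upoly_uminus)
    show "base_field \<subseteq> range (\<lambda>p. upoly p f)"
    proof
      fix x :: "'a mpoly" assume "x \<in> base_field"
      then obtain c where "x = upoly [:c:] f" by (auto simp: base_field_def)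
      then show "x \<in> range (\<lambda>p. upoly p f)" by blast
    qed
    have "f = upoly [:0, 1:] f" by simp
    then show "set [f] \<subseteq> range (\<lambda>p. upoly p f)" by (metis empty_set insert_subset list.simps(15) rangeI empty_subsetI)
  qed
  show "range (\<lambda>p. upoly p f) \<subseteq> adjoin base_field [f]"
    using adjoin_gens[OF base_field_subring, of "[f]"]
    by (auto intro!: upoly_subring adjoin_subring base_field_subring intro: adjoin_base)
qed

section \<open>Exponential maps and slices\<close>

text \<open>
  Stated for a subring of the ambient domain, so that a map can be restricted to the invariants of
  other maps.
\<close>

locale exp_map =
  fixes R :: "'a::idom set" and D :: "nat \<Rightarrow> 'a \<Rightarrow> 'a"
  assumes R: "is_subring R"
    and D_closed: "x \<in> R \<Longrightarrow> D m x \<in> R"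
    and D_add: "x \<in> R \<Longrightarrow> y \<in> R \<Longrightarrow> D m (x + y) = D m x + D m y"
    and D_0: "x \<in> R \<Longrightarrow> D 0 x = x"
    and D_fin: "x \<in> R \<Longrightarrow> \<exists>m>0. \<forall>i\<ge>m. D i x = 0"
    and D_mult: "x \<in> R \<Longrightarrow> y \<in> R \<Longrightarrow> D m (x * y) = (\<Sum>i=0..m. D i x * D (m - i) y)"
    and D_comp: "x \<in> R \<Longrightarrow> D j (D i x) = of_nat ((i + j) choose j) * D (i + j) x"
begin

abbreviation "fixed \<equiv> invariants R D"

lemma fixedD: "c \<in> fixed \<Longrightarrow> c \<in> R" "c \<in> fixed \<Longrightarrow> i \<ge> 1 \<Longrightarrow> D i c = 0"
  by (auto simp: invariants_def)

lemma D_zero [simp]: "D m 0 = 0"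
proof -
  have "D m 0 = D m 0 + D m 0"
    using D_add[OF subring_0[OF R] subring_0[OF R], of m] by (simp only: add_0_left)
  then show ?thesis by (rule add_cancel_right_right[THEN iffD1])
qed

lemma D_uminus: "x \<in> R \<Longrightarrow> D m (- x) = - D m x"
  using D_add[of x "- x" m] subring_uminus[OF R, of x] by (simp add: eq_neg_iff_add_eq_0 add.commute)

lemma D_diff: "x \<in> R \<Longrightarrow> y \<in> R \<Longrightarrow> D m (x - y) = D m x - D m y"
  using D_add[of x "- y" m] subring_uminus[OF R, of y] by (simp add: D_uminus)

lemma D_sum: "(\<And>i. i \<in> I \<Longrightarrow> g i \<in> R) \<Longrightarrow> D m (sum g I) = (\<Sum>i\<in>I. D m (g i))"
  by (induction I rule: infinite_finite_induct) (auto simp: D_add subring_sum[OF R])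

text \<open>
  The map \<open>x \<mapsto> \<Sum> D\<^sub>i(x) T\<^sup>i\<close> is a ring homomorphism into \<open>R[T]\<close>, so degrees in \<open>T\<close> add and leading
  coefficients multiply.
\<close>

lemma D_mult_top:
  assumes x: "x \<in> R" "\<And>i. i > a \<Longrightarrow> D i x = 0" and y: "y \<in> R" "\<And>i. i > b \<Longrightarrow> D i y = 0"
  shows "\<And>i. i > a + b \<Longrightarrow> D i (x * y) = 0" and "D (a + b) (x * y) = D a x * D b y"
proof -
  show "D i (x * y) = 0" if "i > a + b" for i
  proof -
    have "D j x * D (i - j) y = 0" for j
      by (cases "j > a") (use x y that in auto)
    then show ?thesis unfolding D_mult[OF x(1) y(1)] by (intro sum.neutral) blast
  qed
  have "D (a + b) (x * y) = (\<Sum>j\<in>{0..a+b}. D j x * D (a + b - j) y)"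
    by (simp add: D_mult x y)
  also have "\<dots> = (\<Sum>j\<in>{a}. D j x * D (a + b - j) y)"
  proof (rule sum.mono_neutral_right)
    show "\<forall>j\<in>{0..a + b} - {a}. D j x * D (a + b - j) y = 0"
    proof
      fix j assume "j \<in> {0..a + b} - {a}"
      then show "D j x * D (a + b - j) y = 0"
        by (cases "j > a") (use x y in auto)
    qed
  qed auto
  finally show "D (a + b) (x * y) = D a x * D b y" by simp
qed

lemma D_one: "i \<ge> 1 \<Longrightarrow> D i 1 = 0"
proof (induction i rule: less_induct)
  case (less i)
  have "D i (1 * 1) = (\<Sum>j\<in>{0..i}. D j 1 * D (i - j) 1)"
    using D_mult[of 1 1] subring_1[OF R] by blast
  also have "\<dots> = (\<Sum>j\<in>{0, i}. D j 1 * D (i - j) 1)"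
    by (rule sum.mono_neutral_right) (use less in auto)
  also have "\<dots> = D i 1 + D i 1"
    using less.prems D_0[OF subring_1[OF R]] by simp
  finally have "D i 1 = D i 1 + D i 1" by (simp only: mult_1)
  then show ?case by (rule add_cancel_right_right[THEN iffD1])
qed

lemma D_fixed_mult:
  assumes "c \<in> fixed" "x \<in> R"
  shows "D m (c * x) = c * D m x"
proof -
  have "D m (c * x) = (\<Sum>j\<in>{0..m}. D j c * D (m - j) x)"
    using assms D_mult fixedD by blast
  also have "\<dots> = (\<Sum>j\<in>{0}. D j c * D (m - j) x)"
    by (rule sum.mono_neutral_right) (use assms fixedD in auto)
  also have "\<dots> = c * D m x" using assms by (simp add: D_0 fixedD)
  finally show ?thesis .
qed

lemma fixedI: "x \<in> R \<Longrightarrow> (\<And>i. i \<ge> 1 \<Longrightarrow> D i x = 0) \<Longrightarrow> x \<in> fixed"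
  by (simp add: invariants_def)

lemma fixed_subring: "is_subring fixed"
proof (rule is_subringI)
  show "1 \<in> fixed" by (intro fixedI subring_1[OF R] D_one)
  fix x assume x: "x \<in> fixed"
  show "- x \<in> fixed"
    by (rule fixedI) (simp_all add: D_uminus fixedD[OF x] subring_uminus[OF R])
  fix y assume y: "y \<in> fixed"
  show "x + y \<in> fixed"
    by (rule fixedI) (simp_all add: D_add fixedD[OF x] fixedD[OF y] subring_add[OF R])
  show "x * y \<in> fixed"
    by (rule fixedI) (simp_all add: D_fixed_mult[OF x] fixedD[OF x] fixedD[OF y] subring_mult[OF R])
qed

lemma fixed_divide:
  assumes "c \<in> fixed" "c \<noteq> 0" "x \<in> R" "c * x \<in> fixed"
  shows "x \<in> fixed"
  using assms D_fixed_mult[of c x] fixedD(2)[of "c * x"] by (auto simp: invariants_def)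

lemma D_top_fixed:
  assumes "x \<in> R" "\<And>i. i > d \<Longrightarrow> D i x = 0"
  shows "D d x \<in> fixed"
  using assms by (auto simp: invariants_def D_closed D_comp)

lemma D_power_top:
  assumes "x \<in> R" "\<And>i. i > d \<Longrightarrow> D i x = 0"
  shows "(\<forall>i > q * d. D i (x ^ q) = 0) \<and> D (q * d) (x ^ q) = D d x ^ q"
proof (induction q)
  case 0
  show ?case by (simp add: D_one D_0 subring_1[OF R])
next
  case (Suc q)
  then show ?case
    using D_mult_top[of x d "x ^ q" "q * d"] assms subring_power[OF R] by simp
qed

lemma obtain_top:
  assumes "x \<in> R" "x \<noteq> 0"
  obtains e where "D e x \<noteq> 0" "\<And>i. i > e \<Longrightarrow> D i x = 0"
proof -
  obtain m where m: "\<forall>i\<ge>m. D i x = 0" using D_fin[OF assms(1)] by blast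
  define e where "e = (GREATEST i. D i x \<noteq> 0)"
  have ex: "D 0 x \<noteq> 0" using assms by (simp add: D_0)
  have bound: "i \<le> m" if "D i x \<noteq> 0" for i using that m by (meson nle_le)
  show ?thesis
  proof
    show "D e x \<noteq> 0" unfolding e_def by (rule GreatestI_nat[of _ 0]) (use ex bound in auto)
    show "D i x = 0" if "i > e" for i
      using that bound Greatest_le_nat[of "\<lambda>i. D i x \<noteq> 0" i m] unfolding e_def by fastforce
  qed
qed

end

text \<open>
  If the inner binomial coefficients of \<open>d\<close> vanish, then \<open>(1 + X)\<^sup>d = 1 + X\<^sup>d\<close>, so the coefficient of
  \<open>X\<^sup>r\<close> in \<open>(1 + X)\<^sup>q\<^sup>d\<^sup>+\<^sup>r\<close> is that of \<open>(1 + X)\<^sup>r\<close>.  This treats all characteristics at once: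
  \<open>d = 1\<close> in characteristic 0 and \<open>d\<close> a power of \<open>p\<close> in characteristic \<open>p\<close>.
\<close>

lemma binomial_remainder_eq_1:
  fixes d r q :: nat
  assumes vanish: "\<And>i. 0 < i \<Longrightarrow> i < d \<Longrightarrow> of_nat (d choose i) = (0::'a::comm_ring_1)" and "r < d"
  shows "of_nat ((q * d + r) choose r) = (1::'a)"
proof (induction q)
  case (Suc q)
  have "(Suc q * d + r) choose r = (\<Sum>k\<le>r. (d choose k) * ((q * d + r) choose (r - k)))"
    using vandermonde[of d "q * d + r" r] by (simp add: add.assoc)
  then have "of_nat ((Suc q * d + r) choose r)
      = (\<Sum>k\<le>r. of_nat ((d choose k) * ((q * d + r) choose (r - k))) :: 'a)"
    by (simp only: of_nat_sum)
  also have "\<dots> = (\<Sum>k\<in>{0}. of_nat ((d choose k) * ((q * d + r) choose (r - k))))"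
    by (rule sum.mono_neutral_right) (use vanish \<open>r < d\<close> in auto)
  finally show ?case using Suc by simp
qed simp

context exp_map
begin

text \<open>
  An element of least positive degree \<open>d\<close> in \<open>T\<close>; minimality is expressed by: every element of
  degree less than \<open>d\<close> is invariant.
\<close>

definition slice :: "'a \<Rightarrow> nat \<Rightarrow> bool" where
  "slice x d \<longleftrightarrow> x \<in> R \<and> d \<ge> 1 \<and> D d x \<noteq> 0 \<and> (\<forall>i>d. D i x = 0) \<and>
     (\<forall>y\<in>R. (\<forall>i\<ge>d. D i y = 0) \<longrightarrow> y \<in> fixed)"

text \<open>
  The element \<open>D\<^sub>d\<^sub>-\<^sub>i(x)\<close> has degree less than \<open>d\<close>, hence is invariant, while its image under \<open>D\<^sub>i\<close> is
  the binomial coefficient times \<open>D\<^sub>d(x) \<noteq> 0\<close>.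
\<close>

lemma slice_choose_vanish:
  assumes s: "slice x d" and i: "0 < i" "i < d"
  shows "of_nat (d choose i) = (0::'a)"
proof -
  have x: "x \<in> R" and top: "D d x \<noteq> 0" "\<And>l. l > d \<Longrightarrow> D l x = 0"
    and small: "\<And>y. y \<in> R \<Longrightarrow> (\<forall>l\<ge>d. D l y = 0) \<Longrightarrow> y \<in> fixed"
    using s by (auto simp: slice_def)
  let ?y = "D (d - i) x"
  have "\<forall>l\<ge>d. D l ?y = 0" using i by (auto simp: D_comp x top)
  then have "?y \<in> fixed" using small x D_closed by blast
  then have "D i ?y = 0" using fixedD i by simp
  then show ?thesis using i top by (simp add: D_comp x)
qed

text \<open>
  By induction on the degree of \<open>b\<close>.  That degree is a multiple \<open>q d\<close> of \<open>d\<close>, and subtracting an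
  invariant multiple of \<open>x\<^sup>q\<close> from \<open>c\<^sup>q b\<close>, where \<open>c = D\<^sub>d(x)\<close>, lowers it.
\<close>

lemma slice_generates:
  assumes s: "slice x d" and G: "is_subring G" "fixed \<subseteq> G" "x \<in> G" and b: "b \<in> R"
  shows "\<exists>N. D d x ^ N * b \<in> G"
proof -
  have x: "x \<in> R" and d: "d \<ge> 1" and top: "D d x \<noteq> 0" "\<And>l. l > d \<Longrightarrow> D l x = 0"
    and small: "\<And>y. y \<in> R \<Longrightarrow> (\<forall>l\<ge>d. D l y = 0) \<Longrightarrow> y \<in> fixed"
    using s by (auto simp: slice_def)
  define c where "c = D d x"
  have c: "c \<in> fixed" unfolding c_def using D_top_fixed x top by blast
  obtain m where m: "\<forall>i\<ge>m. D i b = 0" using D_fin b by blast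
  have "\<exists>N. c ^ N * b \<in> G"
    using b m
  proof (induction m arbitrary: b)
    case 0
    then have "b = 0" using D_0[of b] by force
    then show ?case using subring_0[OF G(1)] by auto
  next
    case (Suc m)
    note b = \<open>b \<in> R\<close>
    show ?case
    proof (cases "D m b = 0")
      case True
      then have "\<forall>i\<ge>m. D i b = 0" using Suc.prems by (metis le_antisym not_less_eq_eq)
      then show ?thesis using Suc.IH b by blast
    next
      case False
      define a where "a = D m b"
      have above: "\<And>i. i > m \<Longrightarrow> D i b = 0" using Suc.prems by simp
      have a: "a \<in> fixed" unfolding a_def using D_top_fixed b above by blast
      define q r where "q = m div d" and "r = m mod d"
      have m_eq: "m = q * d + r" and "r < d" using d by (auto simp: q_def r_def)
      \<comment> \<open>The binomial coefficient below is 1, so a nonzero remainder would produce an element of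
        positive degree \<open>r < d\<close>.\<close>
      have "r = 0"
      proof (rule ccontr)
        assume "r \<noteq> 0"
        let ?y = "D (q * d) b"
        have "D r ?y = a"
          using binomial_remainder_eq_1[OF slice_choose_vanish[OF s] \<open>r < d\<close>, of q]
          by (simp add: D_comp b m_eq a_def)
        moreover have "\<forall>l\<ge>d. D l ?y = 0"
          using \<open>r < d\<close> above by (auto simp: D_comp b m_eq)
        then have "?y \<in> fixed" using small b D_closed by blast
        then have "D r ?y = 0" using fixedD \<open>r \<noteq> 0\<close> by simp
        ultimately show False using False a_def by simp
      qed
      have pow: "\<And>i. i > m \<Longrightarrow> D i (x ^ q) = 0" "D m (x ^ q) = c ^ q"
        using D_power_top[of x d q, OF x top(2)] m_eq \<open>r = 0\<close> by (auto simp: c_def)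
      have cq: "c ^ q \<in> fixed" and xq: "x ^ q \<in> R"
        using c x by (auto intro: subring_power fixed_subring R)
      define b' where "b' = c ^ q * b - a * x ^ q"
      have b': "b' \<in> R"
        unfolding b'_def by (intro subring_diff subring_mult R xq b fixedD(1)[OF cq] fixedD(1)[OF a])
      have "D i b' = c ^ q * D i b - a * D i (x ^ q)" for i
        unfolding b'_def using fixedD(1) cq a xq b
        by (subst D_diff) (auto simp: D_fixed_mult intro: subring_mult[OF R])
      then have "\<forall>i\<ge>m. D i b' = 0"
        using pow above by (auto simp: a_def le_less)
      then obtain N where "c ^ N * b' \<in> G" using Suc.IH[OF b'] by blast
      moreover have "c ^ N * (a * x ^ q) \<in> G"
        using G a c by (auto intro!: subring_mult subring_power)
      ultimately have "c ^ N * b' + c ^ N * (a * x ^ q) \<in> G"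
        using subring_add[OF G(1)] by blast
      then have "c ^ (N + q) * b \<in> G"
        by (simp add: b'_def power_add algebra_simps)
      then show ?thesis by blast
    qed
  qed
  then show ?thesis by (simp add: c_def)
qed

text \<open>
  The degree in \<open>T\<close> of a polynomial in \<open>x\<close> with invariant coefficients is \<open>d\<close> times its degree in \<open>x\<close>,
  so its top operator exposes the leading coefficient.
\<close>

lemma slice_transcendental:
  assumes s: "slice x d" and p: "\<And>i. coeff p i \<in> fixed" and "poly p x = 0"
  shows "p = 0"
proof (rule ccontr)
  assume "p \<noteq> 0"
  have x: "x \<in> R" and d: "d \<ge> 1" and top: "D d x \<noteq> 0" "\<And>l. l > d \<Longrightarrow> D l x = 0"
    using s by (auto simp: slice_def)
  let ?n = "degree p"
  have xq: "x ^ q \<in> R" for q using x by (rule subring_power[OF R])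
  have "D (?n * d) (poly p x) = (\<Sum>i\<le>?n. coeff p i * D (?n * d) (x ^ i))"
    unfolding poly_altdef
    by (subst D_sum) (auto simp: D_fixed_mult p xq intro: subring_mult[OF R fixedD(1)[OF p] xq])
  also have "\<dots> = (\<Sum>i\<in>{?n}. coeff p i * D (?n * d) (x ^ i))"
  proof (rule sum.mono_neutral_right)
    show "\<forall>i\<in>{..?n} - {?n}. coeff p i * D (?n * d) (x ^ i) = 0"
      using D_power_top[of x d, OF x top(2)] d by auto
  qed auto
  also have "\<dots> = lead_coeff p * D d x ^ ?n"
    using D_power_top[of x d, OF x top(2)] by simp
  finally show False using \<open>p \<noteq> 0\<close> top \<open>poly p x = 0\<close> by simp
qed

end

lemma lookup_minus_nat: "lookup (d - e) i = lookup d i - lookup (e :: nat \<Rightarrow>\<^sub>0 nat) i"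
  by (simp add: minus_poly_mapping.rep_eq)

text \<open>
  A relation between \<open>ys\<close> and \<open>x\<close> is sorted by powers of \<open>x\<close>.  Its coefficients are values of
  polynomials at \<open>ys\<close> and lie in \<open>W\<close>, so they vanish, and then so do the polynomials.
\<close>

lemma alg_independent_append:
  fixes W :: "'a::idom set"
  assumes W: "is_subring W" and C: "is_subring C" "C \<subseteq> W" and ys: "set ys \<subseteq> W" "alg_independent C ys"
    and x: "\<And>p. (\<And>i. coeff p i \<in> W) \<Longrightarrow> poly p x = 0 \<Longrightarrow> p = 0"
  shows "alg_independent C (ys @ [x])"
  unfolding alg_independent_iff[OF C(1)]
proof (intro ballI impI)
  fix P assume P: "P \<in> polys C (length (ys @ [x]))" and 0: "eval_mpoly ((!) (ys @ [x])) P = 0"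
  define n where "n = length ys"
  \<comment> \<open>The last variable has index \<open>n\<close>; \<open>rest\<close> removes it from a monomial and \<open>part l\<close> collects
    the terms in which it has exponent \<open>l\<close>.\<close>
  define rest where "rest e = e - single n (lookup e n)" for e :: "nat \<Rightarrow>\<^sub>0 nat"
  have split: "e = rest e + single n (lookup e n)" for e
    by (rule poly_mapping_eqI) (simp add: rest_def lookup_add lookup_minus_nat lookup_single when_def)
  have rest_keys: "keys (rest e) \<subseteq> {..<n}" if "e \<in> keys P" for e
  proof
    fix i assume i: "i \<in> keys (rest e)"
    then have "i \<noteq> n" "i \<in> keys e"
      by (auto simp: rest_def in_keys_iff lookup_minus_nat lookup_single when_def split: if_splits)
    then show "i \<in> {..<n}" using polysD[OF P that] by (auto simp: n_def)
  qed
  define part where "part l = (\<Sum>e | e \<in> keys P \<and> lookup e n = l. single (rest e) (lookup P e))" for l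
  have part: "part l \<in> polys C n" for l
    unfolding part_def
    by (intro subring_sum polys_subring C polys_single rest_keys)
      (use polysD[OF P] in auto)
  define p where "p = (\<Sum>e\<in>keys P. monom (lookup P e * monom_val ((!) ys) (rest e)) (lookup e n))"
  have coeff_p: "coeff p l = eval_mpoly ((!) ys) (part l)" for l
    unfolding p_def part_def eval_mpoly_sum coeff_sum
    by (simp add: sum.If_cases Collect_conj_eq[symmetric] if_distrib cong: if_cong)
       (rule sum.cong, auto)
  have "monom_val ((!) (ys @ [x])) e = monom_val ((!) ys) (rest e) * x ^ lookup e n" if "e \<in> keys P" for e
  proof -
    have "monom_val ((!) (ys @ [x])) e
        = monom_val ((!) (ys @ [x])) (rest e) * x ^ lookup e n"
      by (subst split[of e]) (simp only: monom_val_add, simp add: n_def)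
    moreover have "monom_val ((!) (ys @ [x])) (rest e) = monom_val ((!) ys) (rest e)"
      by (rule monom_val_cong) (use rest_keys[OF that] in \<open>auto simp: n_def nth_append\<close>)
    ultimately show ?thesis by simp
  qed
  then have "poly p x = eval_mpoly ((!) (ys @ [x])) P"
    by (simp add: p_def eval_mpoly_monom_val poly_sum poly_monom mult.assoc)
  moreover have "coeff p i \<in> W" for i
    unfolding coeff_p
    by (rule eval_mpoly_subring[OF W, of n])
      (use ys part polys_mono[OF C(2) order.refl, of n] in \<open>auto simp: n_def\<close>)
  ultimately have "p = 0" using x 0 by simp
  then have part0: "part l = 0" for l
    using coeff_p[of l] part[of l] ys(2) by (simp add: alg_independent_iff[OF C(1)] n_def)
  have "lookup P e = 0" for e
  proof (rule ccontr)
    assume "lookup P e \<noteq> 0"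
    then have e: "e \<in> keys P" by (simp add: in_keys_iff)
    let ?I = "{e' \<in> keys P. lookup e' n = lookup e n}"
    have "lookup (part (lookup e n)) (rest e)
        = (\<Sum>e'\<in>?I. if rest e' = rest e then lookup P e' else 0)"
      by (simp add: part_def lookup_sum lookup_single when_def)
    also have "\<dots> = (\<Sum>e'\<in>?I. if e' = e then lookup P e' else 0)"
      by (rule sum.cong) (use split in \<open>auto, metis+\<close>)
    also have "\<dots> = lookup P e" using e by simp
    finally show False using part0 \<open>lookup P e \<noteq> 0\<close> by simp
  qed
  then show "P = 0" by (intro poly_mapping_eqI) simp
qed

section \<open>Commuting families of exponential maps\<close>

lemma is_exp_map_imp_exp_map: "is_subring B \<Longrightarrow> is_exp_map K B D \<Longrightarrow> exp_map B D"
  by unfold_locales (simp_all add: is_exp_map_def)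

locale commuting_family =
  fixes B :: "'a::idom set" and m :: nat and \<delta> :: "nat \<Rightarrow> nat \<Rightarrow> 'a \<Rightarrow> 'a"
  assumes exp: "i < m \<Longrightarrow> exp_map B (\<delta> i)"
    and comm: "i < m \<Longrightarrow> j < m \<Longrightarrow> i \<noteq> j \<Longrightarrow> exp_maps_commute B (\<delta> i) (\<delta> j)"
    and irredundant:
      "i < m \<Longrightarrow> \<not> common_invariants B \<delta> ({..<m} - {i}) \<subseteq> invariants B (\<delta> i)"
    and B: "is_subring B"
begin

lemma commute:
  assumes "i < m" "j < m" "i \<noteq> j" "x \<in> B"
  shows "\<delta> i a (\<delta> j b x) = \<delta> j b (\<delta> i a x)"
proof -
  interpret I: exp_map B "\<delta> i" using exp assms by blast
  interpret J: exp_map B "\<delta> j" using exp assms by blast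
  show ?thesis
  proof (cases "a = 0 \<or> b = 0")
    case True
    then show ?thesis using assms by (auto simp: I.D_0 J.D_0 I.D_closed J.D_closed)
  next
    case False
    then show ?thesis using comm[OF assms(1-3)] assms(4) by (simp add: exp_maps_commute_def)
  qed
qed

lemma common_invariantsI:
  assumes "x \<in> B" "\<And>i a. i \<in> J \<Longrightarrow> a \<ge> 1 \<Longrightarrow> \<delta> i a x = 0"
  shows "x \<in> common_invariants B \<delta> J"
  using assms by (auto simp: common_invariants_def invariants_def)

lemma common_invariantsD:
  assumes "x \<in> common_invariants B \<delta> J"
  shows "x \<in> B" and "i \<in> J \<Longrightarrow> a \<ge> 1 \<Longrightarrow> \<delta> i a x = 0"
  using assms by (auto simp: common_invariants_def invariants_def)

lemma common_invariants_subring: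
  assumes "J \<subseteq> {..<m}"
  shows "is_subring (common_invariants B \<delta> J)"
proof -
  have "is_subring (invariants B (\<delta> i))" if "i \<in> J" for i
    using exp_map.fixed_subring exp that assms by blast
  then show ?thesis using B by (auto simp: common_invariants_def is_subring_def)
qed

text \<open>
  Commuting maps act on each other's invariants; this is what allows restricting to the chain of
  subrings \<open>W j\<close> below.
\<close>

lemma common_invariants_stable:
  assumes J: "J \<subseteq> {..<m}" and i: "i < m" and x: "x \<in> common_invariants B \<delta> J"
  shows "\<delta> i a x \<in> common_invariants B \<delta> J"
proof (rule common_invariantsI)
  interpret I: exp_map B "\<delta> i" using exp i by blast
  show "\<delta> i a x \<in> B" using common_invariantsD(1)[OF x] by (rule I.D_closed)
  fix j b assume j: "j \<in> J" and b: "b \<ge> (1::nat)"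
  then have jm: "j < m" using J by auto
  interpret J: exp_map B "\<delta> j" using exp jm by blast
  have 0: "\<delta> j c x = 0" if "c \<ge> 1" for c using common_invariantsD(2)[OF x j that] .
  show "\<delta> j b (\<delta> i a x) = 0"
  proof (cases "i = j")
    case True
    then show ?thesis using 0 b common_invariantsD(1)[OF x] by (simp add: J.D_comp)
  next
    case False
    then show ?thesis
      using commute[OF i jm False common_invariantsD(1)[OF x], of a b] 0[OF b] by simp
  qed
qed

lemma exp_map_common_invariants:
  assumes J: "J \<subseteq> {..<m}" and i: "i < m"
  shows "exp_map (common_invariants B \<delta> J) (\<delta> i)"
proof -
  interpret I: exp_map B "\<delta> i" using exp i by blast
  show ?thesis
  proof
    show "is_subring (common_invariants B \<delta> J)" using J by (rule common_invariants_subring)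
    show "\<delta> i a x \<in> common_invariants B \<delta> J" if "x \<in> common_invariants B \<delta> J" for a x
      using that common_invariants_stable J i by blast
  qed (auto dest!: common_invariantsD(1) simp: I.D_add I.D_0 I.D_fin I.D_mult I.D_comp)
qed

text \<open>
  The maps with index at least \<open>j\<close> impose invariance, so the chain grows from the common invariants
  \<open>W 0\<close> to \<open>W m = B\<close>, and \<open>W j\<close> is the ring of invariants of \<open>\<delta> j\<close> acting on \<open>W (Suc j)\<close>.
\<close>

abbreviation W :: "nat \<Rightarrow> 'a set" where "W j \<equiv> common_invariants B \<delta> {j..<m}"

lemma W_top: "W m = B" by (simp add: common_invariants_def)

lemma W_step:
  assumes "j < m"
  shows "W j = invariants (W (Suc j)) (\<delta> j)"
proof -
  have "{j..<m} = insert j {Suc j..<m}" using assms by auto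
  then show ?thesis by (simp add: common_invariants_def invariants_def) blast
qed

lemma W_0_subset: "W 0 \<subseteq> W j"
  by (auto simp: common_invariants_def)

text \<open>
  Irredundancy makes \<open>\<delta> j\<close> nontrivial on \<open>W (Suc j)\<close>, which provides some slice.  Its leading
  coefficient is only invariant under the maps with index at least \<open>j\<close>, whereas denominators from
  \<open>W 0\<close> are needed; the operators of the maps with smaller index repair this, as they commute with
  \<open>\<delta> j\<close> and so never raise the degree.
\<close>

lemma exists_slice:
  assumes j: "j < m"
  shows "\<exists>x d. exp_map.slice (W (Suc j)) (\<delta> j) x d \<and> \<delta> j d x \<in> W 0"
proof -
  have sub: "{Suc j..<m} \<subseteq> {..<m}" by auto
  interpret E: exp_map "W (Suc j)" "\<delta> j"
    using exp_map_common_invariants sub j .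
  define P where "P d \<longleftrightarrow> (\<exists>y\<in>W (Suc j). y \<notin> E.fixed \<and> (\<forall>i>d. \<delta> j i y = 0))" for d
  obtain z where z: "z \<in> common_invariants B \<delta> ({..<m} - {j})" "z \<notin> invariants B (\<delta> j)"
    using irredundant[OF j] by blast
  have zW: "z \<in> W (Suc j)" using z(1) by (auto simp: common_invariants_def)
  have znf: "z \<notin> E.fixed" using z by (auto simp: common_invariants_def invariants_def)
  obtain d0 where "\<forall>i\<ge>d0. \<delta> j i z = 0" using E.D_fin[OF zW] by blast
  then have "P d0" unfolding P_def using zW znf by auto
  define d where "d = (LEAST d. P d)"
  have "P d" unfolding d_def using \<open>P d0\<close> by (rule LeastI)
  have least: "\<not> P d'" if "d' < d" for d' using that not_less_Least unfolding d_def by blast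
  obtain y where y: "y \<in> W (Suc j)" "y \<notin> E.fixed" "\<And>i. i > d \<Longrightarrow> \<delta> j i y = 0"
    using \<open>P d\<close> unfolding P_def by blast
  have d: "d \<ge> 1" using y by (intro leI notI) (auto simp: invariants_def)
  have small: "w \<in> E.fixed" if "w \<in> W (Suc j)" "\<forall>i\<ge>d. \<delta> j i w = 0" for w
    using least[of "d - 1"] that d unfolding P_def by (metis Suc_diff_1 Suc_leI diff_less zero_less_one order_less_le_trans)
  \<comment> \<open>Otherwise \<open>y\<close> would have degree less than \<open>d\<close>.\<close>
  have y_top: "\<delta> j d y \<noteq> 0"
  proof
    assume "\<delta> j d y = 0"
    then have "\<forall>i\<ge>d. \<delta> j i y = 0" using y(3) by (auto simp: le_less)
    then show False using small y by blast
  qed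
  \<comment> \<open>Applying the top operator of \<open>\<delta> t\<close> to the leading coefficient makes it invariant under
    \<open>\<delta> t\<close>, and the same operator applied to the element itself keeps everything else.\<close>
  have "\<exists>x\<in>W (Suc j). \<delta> j d x \<noteq> 0 \<and> (\<forall>i>d. \<delta> j i x = 0) \<and> (\<forall>i<t. \<delta> j d x \<in> invariants B (\<delta> i))"
    if "t \<le> j" for t
    using that
  proof (induction t)
    case 0
    then show ?case using y y_top by auto
  next
    case (Suc t)
    then obtain x where x: "x \<in> W (Suc j)" "\<delta> j d x \<noteq> 0" "\<And>i. i > d \<Longrightarrow> \<delta> j i x = 0"
      and inv: "\<And>i. i < t \<Longrightarrow> \<delta> j d x \<in> invariants B (\<delta> i)" by (metis Suc_leD)
    have t: "t < m" "t \<noteq> j" using Suc.prems j by auto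
    interpret T: exp_map B "\<delta> t" using exp t by blast
    have xB: "x \<in> B" using common_invariantsD(1)[OF x(1)] .
    have cB: "\<delta> j d x \<in> B" using E.D_closed[OF x(1)] by (rule common_invariantsD(1))
    obtain e where e: "\<delta> t e (\<delta> j d x) \<noteq> 0" "\<And>i. i > e \<Longrightarrow> \<delta> t i (\<delta> j d x) = 0"
      using T.obtain_top[OF cB x(2)] by blast
    define x' where "x' = \<delta> t e x"
    have swap: "\<delta> j i x' = \<delta> t e (\<delta> j i x)" for i
      unfolding x'_def using commute[OF j t(1) t(2)[symmetric] xB] .
    have "\<delta> j d x' \<in> invariants B (\<delta> i)" if "i < Suc t" for i
    proof (cases "i = t")
      case True
      then show ?thesis unfolding swap using T.D_top_fixed[OF cB e(2)] by simp
    next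
      case False
      then have i: "i < t" "i < m" using that t by auto
      have "\<delta> i a (\<delta> t e (\<delta> j d x)) = 0" if "a \<ge> 1" for a
        using commute[OF i(2) t(1) False cB, of a e] inv[OF i(1)] that
        by (simp add: invariants_def)
      then show ?thesis unfolding swap using T.D_closed[OF cB] by (simp add: invariants_def)
    qed
    moreover have "x' \<in> W (Suc j)"
      unfolding x'_def using common_invariants_stable[OF sub t(1) x(1)] .
    ultimately show ?case using e(1) x(3) by (intro bexI[of _ x']) (auto simp: swap)
  qed
  then obtain x where x: "x \<in> W (Suc j)" "\<delta> j d x \<noteq> 0" "\<And>i. i > d \<Longrightarrow> \<delta> j i x = 0"
    and inv: "\<And>i. i < j \<Longrightarrow> \<delta> j d x \<in> invariants B (\<delta> i)" by blast
  have "\<delta> j d x \<in> invariants (W (Suc j)) (\<delta> j)"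
    using E.D_top_fixed x by blast
  then have "\<delta> j d x \<in> W j" using W_step[OF j] by simp
  then have "\<delta> j d x \<in> W 0"
    using inv by (auto simp: common_invariants_def)
  moreover have "E.slice x d"
    unfolding E.slice_def using x d small by blast
  ultimately show ?thesis by blast
qed

text \<open>
  One slice is added for each map.  Independence is stated over any subring \<open>C\<close> of \<open>W 0\<close> and together
  with elements \<open>zs\<close> of \<open>W 0\<close>: for \<open>C = W 0\<close> it gives the polynomial ring, and for \<open>C = k\<close> it bounds
  the transcendence degree of \<open>W 0\<close>.
\<close>

lemma polynomial_structure_step:
  "j \<le> m \<Longrightarrow> \<exists>xs. length xs = j \<and> set xs \<subseteq> W j \<and>
    (\<forall>b\<in>W j. \<exists>c\<in>W 0 - {0}. c * b \<in> adjoin (W 0) xs) \<and>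
    (\<forall>C zs. is_subring C \<longrightarrow> C \<subseteq> W 0 \<longrightarrow> set zs \<subseteq> W 0 \<longrightarrow> alg_independent C zs \<longrightarrow>
      alg_independent C (zs @ xs))"
proof (induction j)
  case 0
  have "1 \<in> W 0 - {0}" using subring_1[OF common_invariants_subring[of "{0..<m}"]]
    by (auto simp: atLeast0LessThan)
  then show ?case
    by (intro exI[of _ "[]"]) (auto intro!: bexI[of _ 1] adjoin_base)
next
  case (Suc j)
  then have j: "j < m" by simp
  let ?A = "W 0"
  have A: "is_subring ?A" by (rule common_invariants_subring) auto
  have sub: "{Suc j..<m} \<subseteq> {..<m}" "{j..<m} \<subseteq> {..<m}" by auto
  interpret E: exp_map "W (Suc j)" "\<delta> j" using exp_map_common_invariants sub(1) j .
  obtain xs where xs: "length xs = j" "set xs \<subseteq> W j"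
    and gen: "\<And>b. b \<in> W j \<Longrightarrow> \<exists>c\<in>?A - {0}. c * b \<in> adjoin ?A xs"
    and indep: "\<And>C zs. is_subring C \<Longrightarrow> C \<subseteq> ?A \<Longrightarrow> set zs \<subseteq> ?A \<Longrightarrow> alg_independent C zs \<Longrightarrow>
      alg_independent C (zs @ xs)"
    using Suc.IH j by (metis less_imp_le_nat)
  obtain x d where x: "E.slice x d" "\<delta> j d x \<in> ?A" using exists_slice[OF j] by blast
  have top: "\<delta> j d x \<noteq> 0" and xW: "x \<in> W (Suc j)" using x(1) by (auto simp: E.slice_def)
  have WW: "W j \<subseteq> W (Suc j)" by (auto simp: common_invariants_def)
  let ?T = "adjoin ?A (xs @ [x])"
  have T: "is_subring ?T" using A by (rule adjoin_subring)
  have xs_T: "adjoin ?A xs \<subseteq> ?T" "x \<in> ?T"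
    using adjoin_gens[OF A, of "xs @ [x]"] by (auto simp: adjoin_subset_iff[OF A])
  \<comment> \<open>The part of the localization of \<open>?T\<close> at \<open>?A - {0}\<close> that lies in the ambient ring.\<close>
  define G where "G = {z. \<exists>s\<in>?A - {0}. s * z \<in> ?T}"
  have A_T: "a \<in> ?A \<Longrightarrow> a \<in> ?T" for a by (rule adjoin_base)
  have G: "is_subring G"
  proof (rule is_subringI)
    show "1 \<in> G" unfolding G_def using subring_1[OF A] subring_1[OF T] by (auto intro!: bexI[of _ 1])
    fix u assume "u \<in> G"
    then obtain s where s: "s \<in> ?A" "s \<noteq> 0" "s * u \<in> ?T" unfolding G_def by blast
    show "- u \<in> G" unfolding G_def using s subring_uminus[OF T s(3)] by auto
    fix v assume "v \<in> G"
    then obtain t where t: "t \<in> ?A" "t \<noteq> 0" "t * v \<in> ?T" unfolding G_def by blast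
    have st: "s * t \<in> ?A - {0}" using s t subring_mult[OF A] by auto
    have "t * (s * u) + s * (t * v) \<in> ?T"
      by (intro subring_add[OF T] subring_mult[OF T] A_T s t)
    then have "(s * t) * (u + v) \<in> ?T" by (simp add: algebra_simps)
    then show "u + v \<in> G" unfolding G_def using st by blast
    have "(s * u) * (t * v) \<in> ?T" by (intro subring_mult[OF T] s t)
    then have "(s * t) * (u * v) \<in> ?T" by (simp add: algebra_simps)
    then show "u * v \<in> G" unfolding G_def using st by blast
  qed
  have "W j \<subseteq> G" unfolding G_def using gen xs_T(1) by blast
  then have fixed_G: "E.fixed \<subseteq> G" using W_step[OF j] by simp
  have "x \<in> G" unfolding G_def using xs_T(2) subring_1[OF A] by (auto intro!: bexI[of _ 1])
  have gen': "\<exists>c\<in>?A - {0}. c * b \<in> ?T" if b: "b \<in> W (Suc j)" for b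
  proof -
    obtain N where "\<delta> j d x ^ N * b \<in> G"
      using E.slice_generates[OF x(1) G fixed_G \<open>x \<in> G\<close> b] by blast
    then obtain s where s: "s \<in> ?A - {0}" "s * (\<delta> j d x ^ N * b) \<in> ?T" unfolding G_def by blast
    then have "s * \<delta> j d x ^ N \<in> ?A - {0}"
      using x top subring_mult[OF A] subring_power[OF A] by auto
    then show ?thesis using s(2) by (metis mult.assoc)
  qed
  have indep': "alg_independent C (zs @ (xs @ [x]))"
    if C: "is_subring C" "C \<subseteq> ?A" and zs: "set zs \<subseteq> ?A" "alg_independent C zs" for C zs
  proof -
    have "alg_independent C ((zs @ xs) @ [x])"
    proof (rule alg_independent_append)
      show "is_subring (W j)" using sub(2) by (rule common_invariants_subring)
      show "C \<subseteq> W j" "set (zs @ xs) \<subseteq> W j" using C zs xs W_0_subset[of j] by auto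
      show "alg_independent C (zs @ xs)" using indep C zs by blast
      show "p = 0" if "\<And>i. coeff p i \<in> W j" "poly p x = 0" for p
        using E.slice_transcendental[OF x(1), of p] that W_step[OF j] by simp
    qed (use C in auto)
    then show ?thesis by simp
  qed
  show ?case
    using xs WW xW gen' indep' by (intro exI[of _ "xs @ [x]"]) auto
qed

theorem polynomial_structure:
  obtains xs where "length xs = m" "set xs \<subseteq> B"
    "\<And>b. b \<in> B \<Longrightarrow> \<exists>c\<in>W 0 - {0}. c * b \<in> adjoin (W 0) xs"
    "\<And>C zs. is_subring C \<Longrightarrow> C \<subseteq> W 0 \<Longrightarrow> set zs \<subseteq> W 0 \<Longrightarrow> alg_independent C zs \<Longrightarrow>
      alg_independent C (zs @ xs)"
  using polynomial_structure_step[OF order.refl] unfolding W_top by metis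

end

section \<open>Counting monomials\<close>

definition monoms :: "nat \<Rightarrow> nat \<Rightarrow> (nat \<Rightarrow>\<^sub>0 nat) set" where
  "monoms n M = {e. keys e \<subseteq> {..<n} \<and> (\<forall>i. lookup e i \<le> M)}"

lemma monoms_mono: "M \<le> M' \<Longrightarrow> monoms n M \<subseteq> monoms n M'"
  by (auto simp: monoms_def intro: order_trans)

lemma finite_subset_monoms:
  assumes "finite F" "\<And>e. e \<in> F \<Longrightarrow> keys e \<subseteq> {..<n}"
  shows "\<exists>M. F \<subseteq> monoms n M"
proof
  let ?M = "\<Sum>e\<in>F. \<Sum>i<n. lookup e i"
  show "F \<subseteq> monoms n ?M"
  proof
    fix e assume e: "e \<in> F"
    have "lookup e i \<le> ?M" for i
    proof (cases "i < n")
      case True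
      then have "lookup e i \<le> (\<Sum>i<n. lookup e i)" by (intro member_le_sum) auto
      also have "\<dots> \<le> ?M" using e assms(1) by (intro member_le_sum) auto
      finally show ?thesis .
    next
      case False
      then have "lookup e i = 0" using assms(2)[OF e] by (auto simp: in_keys_iff)
      then show ?thesis by simp
    qed
    then show "e \<in> monoms n ?M" using assms(2)[OF e] by (simp add: monoms_def)
  qed
qed

lemma bij_betw_monoms: "bij_betw (\<lambda>e. restrict (lookup e) {..<n}) (monoms n M) ({..<n} \<rightarrow>\<^sub>E {..M})"
  unfolding bij_betw_def
proof
  show "inj_on (\<lambda>e. restrict (lookup e) {..<n}) (monoms n M)"
  proof (rule inj_onI, rule poly_mapping_eqI)
    fix d e i assume "d \<in> monoms n M" "e \<in> monoms n M"
      and *: "restrict (lookup d) {..<n} = restrict (lookup e) {..<n}"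
    then have "i \<notin> keys d \<and> i \<notin> keys e" if "\<not> i < n" using that by (auto simp: monoms_def)
    then show "lookup d i = lookup e i"
      using fun_cong[OF *, of i] by (cases "i < n") (auto simp: in_keys_iff)
  qed
  show "(\<lambda>e. restrict (lookup e) {..<n}) ` monoms n M = {..<n} \<rightarrow>\<^sub>E {..M}"
  proof (intro equalityI subsetI)
    fix f :: "nat \<Rightarrow> nat" assume f: "f \<in> {..<n} \<rightarrow>\<^sub>E {..M}"
    define e where "e = Abs_poly_mapping (\<lambda>i. if i < n then f i else 0)"
    have "finite {i. (if i < n then f i else 0) \<noteq> 0}"
      by (rule finite_subset[of _ "{..<n}"]) auto
    then have e: "lookup e i = (if i < n then f i else 0)" for i unfolding e_def by simp
    have "f i \<le> M" if "i < n" for i using PiE_mem[OF f, of i] that by simp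
    then have "e \<in> monoms n M" by (auto simp: monoms_def in_keys_iff e split: if_splits)
    moreover have "f = restrict (lookup e) {..<n}"
      using PiE_arb[OF f] by (auto simp: e restrict_def fun_eq_iff)
    ultimately show "f \<in> (\<lambda>e. restrict (lookup e) {..<n}) ` monoms n M" by blast
  qed (auto simp: monoms_def restrict_def split: if_splits)
qed

lemma finite_monoms: "finite (monoms n M)"
  using bij_betw_finite[OF bij_betw_monoms, of n M] by (simp add: finite_PiE)

lemma card_monoms: "card (monoms n M) = Suc M ^ n"
  using bij_betw_same_card[OF bij_betw_monoms, of n M] by (simp add: card_PiE)

interpretation mpoly_vs: vector_space "\<lambda>(c::'k::field) (x::'k mpoly). single 0 c * x"
  by unfold_locales (simp_all add: algebra_simps single_add mult_single)

text \<open>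
  The filtration of \<open>k[ys]\<close> by the exponents that are needed.  It is multiplicative, and its pieces
  have dimension at most \<open>(M + 1)\<^sup>n\<close>, where \<open>n\<close> is the number of generators.
\<close>

definition bounded_span :: "'k::field mpoly list \<Rightarrow> nat \<Rightarrow> 'k mpoly set" where
  "bounded_span ys M = mpoly_vs.span (monom_val ((!) ys) ` monoms (length ys) M)"

lemma bounded_span_mono: "M \<le> M' \<Longrightarrow> bounded_span ys M \<subseteq> bounded_span ys M'"
  unfolding bounded_span_def by (intro mpoly_vs.span_mono image_mono monoms_mono)

lemma bounded_span_1: "1 \<in> bounded_span ys M"
  unfolding bounded_span_def
  by (intro mpoly_vs.span_base image_eqI[of _ _ 0]) (auto simp: monoms_def)

lemma bounded_span_mult:
  assumes x: "x \<in> bounded_span ys M" and y: "y \<in> bounded_span ys M'"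
  shows "x * y \<in> bounded_span ys (M + M')"
proof -
  have sub: "mpoly_vs.subspace {x. x * z \<in> bounded_span ys K}" for z :: "'a mpoly" and K
    unfolding mpoly_vs.subspace_def bounded_span_def
    by (auto simp: distrib_right mult.assoc intro: mpoly_vs.span_zero mpoly_vs.span_add mpoly_vs.span_scale)
  have 1: "monom_val ((!) ys) d * monom_val ((!) ys) e \<in> bounded_span ys (M + M')"
    if "d \<in> monoms (length ys) M" "e \<in> monoms (length ys) M'" for d e
    unfolding bounded_span_def
    by (intro mpoly_vs.span_base image_eqI[of _ _ "d + e"])
      (use that keys_add[of d e] in \<open>auto simp: monom_val_add monoms_def lookup_add intro!: add_mono\<close>)
  have 2: "y * monom_val ((!) ys) d \<in> bounded_span ys (M + M')"
    if "d \<in> monoms (length ys) M" for d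
    using mpoly_vs.span_induct[OF y[unfolded bounded_span_def] sub[of "monom_val ((!) ys) d" "M + M'"]]
      1[OF that] by (auto simp: mult.commute)
  show ?thesis
  proof -
    have "monom_val ((!) ys) d * y \<in> bounded_span ys (M + M')" if "d \<in> monoms (length ys) M" for d
      using 2[OF that] by (simp add: mult.commute)
    then show ?thesis
      using mpoly_vs.span_induct[OF x[unfolded bounded_span_def] sub[of y "M + M'"]] by blast
  qed
qed

lemma bounded_span_power: "x \<in> bounded_span ys M \<Longrightarrow> x ^ q \<in> bounded_span ys (q * M)"
  by (induction q) (auto intro: bounded_span_1 bounded_span_mult)

lemma bounded_span_prod:
  assumes "finite I" "\<And>i. i \<in> I \<Longrightarrow> g i \<in> bounded_span ys M"
  shows "prod g I \<in> bounded_span ys (card I * M)"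
  using assms by (induction I) (auto intro: bounded_span_1 bounded_span_mult)

lemma adjoin_bounded_span:
  assumes "x \<in> adjoin base_field ys"
  shows "\<exists>M. x \<in> bounded_span ys M"
proof -
  obtain p where p: "p \<in> polys base_field (length ys)" "x = eval_mpoly ((!) ys) p"
    using assms by (auto simp: adjoin_def)
  obtain M where M: "keys p \<subseteq> monoms (length ys) M"
    using finite_subset_monoms[of "keys p" "length ys"] polysD[OF p(1)] by auto
  have "lookup p e * monom_val ((!) ys) e \<in> bounded_span ys M" if e: "e \<in> keys p" for e
  proof -
    obtain c where "lookup p e = single 0 c" using polysD[OF p(1) e] by (auto simp: base_field_def)
    then show ?thesis
      unfolding bounded_span_def using M e
      by (auto intro!: mpoly_vs.span_scale intro: mpoly_vs.span_base)
  qed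
  then have "x \<in> bounded_span ys M"
    unfolding p(2) eval_mpoly_monom_val bounded_span_def by (intro mpoly_vs.span_sum) auto
  then show ?thesis ..
qed

lemma independent_monoms:
  fixes zs :: "'k::field mpoly list"
  assumes "alg_independent base_field zs"
  shows "inj_on (monom_val ((!) zs)) (monoms (length zs) d)"
    and "mpoly_vs.independent (monom_val ((!) zs) ` monoms (length zs) d)"
proof -
  let ?v = "monom_val ((!) zs)" and ?E = "monoms (length zs) d"
  have keys: "e \<in> ?E \<Longrightarrow> keys e \<subseteq> {..<length zs}" for e by (simp add: monoms_def)
  have one: "(1 :: 'k mpoly) \<in> base_field" using subring_1[OF base_field_subring] .
  show inj: "inj_on ?v ?E"
  proof (rule inj_onI)
    fix e e' assume e: "e \<in> ?E" "e' \<in> ?E" "?v e = ?v e'"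
    have "single e (1 :: 'k mpoly) = single e' 1"
      using inj_onD[OF assms[unfolded alg_independent_def], of "single e 1" "single e' 1"]
        e keys one by (simp add: polys_single)
    then have "lookup (single e (1 :: 'k mpoly)) e' \<noteq> 0" by simp
    then show "e = e'" by (simp add: lookup_single when_def split: if_splits)
  qed
  show "mpoly_vs.independent (?v ` ?E)"
  proof (rule mpoly_vs.independent_if_scalars_zero)
    show "finite (?v ` ?E)" using finite_monoms by blast
    fix u x assume 0: "(\<Sum>x\<in>?v ` ?E. single 0 (u x) * x) = 0" and "x \<in> ?v ` ?E"
    then obtain e where e: "e \<in> ?E" "x = ?v e" by blast
    define P :: "'k mpoly mpoly" where "P = (\<Sum>e\<in>?E. single e (single 0 (u (?v e))))"
    have "P \<in> polys base_field (length zs)"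
      unfolding P_def
      by (intro subring_sum polys_subring base_field_subring polys_single)
        (auto simp: base_field_def keys)
    moreover have "eval_mpoly ((!) zs) P = 0"
      using 0 by (simp add: P_def eval_mpoly_sum sum.reindex[OF inj])
    ultimately have "P = 0" using assms by (simp add: alg_independent_iff[OF base_field_subring])
    then have "lookup P e = 0" by simp
    then have "single 0 (u (?v e)) = (0 :: 'k mpoly)"
      using e finite_monoms by (simp add: P_def lookup_sum lookup_single when_def)
    then show "u x = 0" using e by (metis lookup_single_eq lookup_zero)
  qed
qed

text \<open>
  If \<open>n + 1\<close> elements of \<open>k[y\<^sub>1, \<dots>, y\<^sub>n]\<close> were independent, their \<open>(d + 1)\<^sup>n\<^sup>+\<^sup>1\<close> monomials with exponents
  at most \<open>d\<close> would be linearly independent, but they lie in a space whose dimension grows only like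
  \<open>d\<^sup>n\<close>.
\<close>

lemma alg_dependent_of_more_generators:
  fixes ys zs :: "'k::field mpoly list"
  assumes len: "length zs = Suc (length ys)" and sub: "set zs \<subseteq> adjoin base_field ys"
  shows "\<not> alg_independent base_field zs"
proof
  assume indep: "alg_independent base_field zs"
  define n where "n = length ys"
  have "\<exists>E. \<forall>i<Suc n. zs ! i \<in> bounded_span ys E"
  proof -
    have "\<forall>i<Suc n. \<exists>E. zs ! i \<in> bounded_span ys E"
      using adjoin_bounded_span sub len by (metis n_def nth_mem subsetD)
    then obtain E where E: "\<And>i. i < Suc n \<Longrightarrow> zs ! i \<in> bounded_span ys (E i)" by metis
    have "zs ! i \<in> bounded_span ys (\<Sum>i<Suc n. E i)" if "i < Suc n" for i
      using E[OF that] bounded_span_mono[of "E i" "\<Sum>i<Suc n. E i" ys] that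
        member_le_sum[of i "{..<Suc n}" E] by auto
    then show ?thesis by blast
  qed
  then obtain E where E: "\<And>i. i < Suc n \<Longrightarrow> zs ! i \<in> bounded_span ys E" by blast
  \<comment> \<open>With \<open>d = q\<^sup>n\<close> the dimension bound \<open>(q d)\<^sup>n\<close> equals \<open>d\<^sup>n\<^sup>+\<^sup>1\<close>, just below the number of monomials.\<close>
  define q where "q = Suc (Suc n * E)"
  define d where "d = q ^ n"
  have d: "d \<ge> 1" by (simp add: d_def q_def)
  define L where "L = Suc n * (d * E)"
  have "monom_val ((!) zs) e \<in> bounded_span ys L" if e: "e \<in> monoms (Suc n) d" for e
  proof -
    have "zs ! i ^ lookup e i \<in> bounded_span ys (d * E)" if "i < Suc n" for i
    proof -
      have "lookup e i * E \<le> d * E" using e by (auto simp: monoms_def)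
      then show ?thesis using bounded_span_power[OF E[OF that], of "lookup e i"] bounded_span_mono by blast
    qed
    then have "(\<Prod>i<Suc n. zs ! i ^ lookup e i) \<in> bounded_span ys (card {..<Suc n} * (d * E))"
      by (intro bounded_span_prod) auto
    moreover have "monom_val ((!) zs) e = (\<Prod>i<Suc n. zs ! i ^ lookup e i)"
      using e by (intro monom_val_superset) (auto simp: monoms_def)
    ultimately show ?thesis unfolding L_def by simp
  qed
  then have "monom_val ((!) zs) ` monoms (Suc n) d
      \<subseteq> mpoly_vs.span (monom_val ((!) ys) ` monoms n L)"
    by (auto simp: bounded_span_def n_def)
  then have "card (monom_val ((!) zs) ` monoms (Suc n) d) \<le> card (monom_val ((!) ys) ` monoms n L)"
    using independent_monoms(2)[OF indep, of d] mpoly_vs.independent_span_bound finite_monoms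
      len[folded n_def] by (metis finite_imageI)
  also have "\<dots> \<le> Suc L ^ n"
    using card_image_le[OF finite_monoms] card_monoms by metis
  also have "Suc L \<le> q * d" using d by (simp add: L_def q_def algebra_simps)
  then have "Suc L ^ n \<le> (q * d) ^ n" by (rule power_mono) simp
  also have "\<dots> = d * d ^ n" by (simp add: power_mult_distrib d_def)
  also have "\<dots> = d ^ Suc n" by simp
  also have "\<dots> < Suc d ^ Suc n" by (rule power_strict_mono) auto
  finally show False
    using card_image[OF independent_monoms(1)[OF indep]] card_monoms len[folded n_def] by simp
qed

section \<open>Kronecker substitution\<close>

interpretation coeff_map: ring_map "\<lambda>c::'k::comm_ring_1. [:c:]"
  by unfold_locales (auto simp: one_pCons)

lemma digits_unique:
  fixes f g :: "nat \<Rightarrow> nat"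
  assumes "\<And>i. i < n \<Longrightarrow> f i < N" "\<And>i. i < n \<Longrightarrow> g i < N"
    and "(\<Sum>i<n. f i * N ^ i) = (\<Sum>i<n. g i * N ^ i)" and "i < n"
  shows "f i = g i"
  using assms
proof (induction n arbitrary: f g i)
  case (Suc n)
  have shift: "(\<Sum>i<Suc n. h i * N ^ i) = h 0 + N * (\<Sum>i<n. h (Suc i) * N ^ i)" for h :: "nat \<Rightarrow> nat"
    by (simp only: sum.lessThan_Suc_shift) (simp add: sum_distrib_left mult_ac)
  have eq: "f 0 + N * (\<Sum>i<n. f (Suc i) * N ^ i) = g 0 + N * (\<Sum>i<n. g (Suc i) * N ^ i)"
    using Suc.prems(3) unfolding shift .
  have lt: "f 0 < N" "g 0 < N" using Suc.prems by auto
  have 0: "f 0 = g 0" using arg_cong[OF eq, of "\<lambda>x. x mod N"] lt by simp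
  then have "(\<Sum>i<n. f (Suc i) * N ^ i) = (\<Sum>i<n. g (Suc i) * N ^ i)" using eq lt by simp
  then have "f (Suc i) = g (Suc i)" if "i < n" for i
    using Suc.IH[of "\<lambda>i. f (Suc i)" "\<lambda>i. g (Suc i)" i] Suc.prems(1,2) that by simp
  then show ?case using 0 Suc.prems(4) by (cases i) auto
qed simp

text \<open>
  Substituting \<open>t\<close> raised to the power \<open>N\<^sup>i\<close> for \<open>X\<^sub>i\<close>, with \<open>N\<close> larger than all exponents in \<open>f\<close>, sends
  the monomials of \<open>f\<close> to distinct powers of \<open>t\<close>, so nothing cancels.  In contrast to restriction to
  a line, this works over finite fields.
\<close>

lemma kronecker_nonconstant:
  fixes f :: "'k::field mpoly"
  assumes f: "f \<in> poly_ring n" "f \<notin> base_field"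
  shows "\<exists>y. degree (coeff_map.hom_eval y f) > 0"
proof -
  have keys: "keys e \<subseteq> {..<n}" if "e \<in> keys f" for e
    using f(1) that by (auto simp: poly_ring_def polys_def)
  then obtain M where M: "keys f \<subseteq> monoms n M" using finite_subset_monoms[of "keys f" n] by auto
  define N where "N = Suc M"
  define wt where "wt e = (\<Sum>i<n. lookup e i * N ^ i)" for e
  define y where "y i = monom (1::'k) (N ^ i)" for i
  have mv: "monom_val y e = monom 1 (wt e)" if "e \<in> keys f" for e
  proof -
    have "(\<Prod>i\<in>I. y i ^ lookup e i) = monom 1 (\<Sum>i\<in>I. lookup e i * N ^ i)" if "finite I" for I
      using that by (induction I) (simp_all add: y_def monom_power mult_monom mult.commute)
    then show ?thesis
      unfolding wt_def by (subst monom_val_superset[of "{..<n}"]) (use keys[OF that] in auto)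
  qed
  have "\<exists>e\<in>keys f. e \<noteq> 0"
  proof (rule ccontr)
    assume "\<not> (\<exists>e\<in>keys f. e \<noteq> 0)"
    then have "f = single 0 (lookup f 0)"
      by (intro poly_mapping_eqI) (auto simp: lookup_single when_def in_keys_iff)
    then show False using f(2) unfolding base_field_def by blast
  qed
  then obtain e where e: "e \<in> keys f" "e \<noteq> 0" by blast
  have inj: "d = e" if "d \<in> keys f" "wt d = wt e" for d
  proof (rule poly_mapping_eqI)
    fix i
    have bd: "lookup d i < N" "lookup e i < N" for i
      using M that(1) e(1) by (auto simp: monoms_def N_def less_Suc_eq_le)
    show "lookup d i = lookup e i"
    proof (cases "i < n")
      case True
      then show ?thesis using digits_unique[of n "lookup d" N "lookup e" i] bd that(2) by (simp add: wt_def)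
    next
      case False
      then have "i \<notin> keys d" "i \<notin> keys e" using keys that(1) e(1) by blast+
      then show ?thesis by (simp add: in_keys_iff)
    qed
  qed
  have "coeff (coeff_map.hom_eval y f) (wt e) = (\<Sum>d\<in>keys f. if d = e then lookup f d else 0)"
    unfolding coeff_map.hom_eval_def coeff_sum
    by (rule sum.cong) (use mv inj in \<open>auto simp: smult_monom\<close>)
  also have "\<dots> = lookup f e" using e by simp
  finally have "coeff (coeff_map.hom_eval y f) (wt e) \<noteq> 0" using e by (simp add: in_keys_iff)
  then have "wt e \<le> degree (coeff_map.hom_eval y f)" by (rule le_degree)
  moreover have "wt e > 0"
  proof -
    have "wt 0 = 0" by (simp add: wt_def)
    obtain i where i: "lookup e i \<noteq> 0" using e(2) by (metis lookup_zero poly_mapping_eqI)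
    then have "i < n" using keys[OF e(1)] by (meson in_keys_iff lessThan_iff subsetD)
    then have "lookup e i * N ^ i \<le> wt e" unfolding wt_def by (intro member_le_sum) auto
    then show ?thesis using i by (simp add: N_def) (metis gr0I le_zero_eq mult_eq_0_iff nat.simps(3) power_not_zero)
  qed
  ultimately show ?thesis by (intro exI[of _ y]) simp
qed

section \<open>Leading monomials and integral closure\<close>

text \<open>Leading monomials are taken with respect to the lexicographic order.\<close>

definition lead_monom :: "'k::field mpoly \<Rightarrow> (nat \<Rightarrow>\<^sub>0 nat)" where
  "lead_monom p = Max (keys p)"

lemma lead_monom_in_keys: "p \<noteq> 0 \<Longrightarrow> lead_monom p \<in> keys p"
  unfolding lead_monom_def by (rule Max_in) (auto simp: keys_eq_empty)

lemma keys_le_lead_monom: "e \<in> keys p \<Longrightarrow> e \<le> lead_monom p"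
  unfolding lead_monom_def by (rule Max_ge) auto

lemma keys_mult_le_lead_monom: "e \<in> keys (p * q) \<Longrightarrow> e \<le> lead_monom p + lead_monom q"
  using keys_mult[of p q] by (auto dest!: subsetD intro!: add_mono keys_le_lead_monom)

lemma lookup_mult_lead_monom:
  assumes "p \<noteq> 0" "q \<noteq> 0"
  shows "lookup (p * q) (lead_monom p + lead_monom q) = lookup p (lead_monom p) * lookup q (lead_monom q)"
proof -
  define p' where "p' = p - single (lead_monom p) (lookup p (lead_monom p))"
  define q' where "q' = q - single (lead_monom q) (lookup q (lead_monom q))"
  have p': "e < lead_monom p" if "e \<in> keys p'" for e
  proof -
    have "e \<noteq> lead_monom p" "e \<in> keys p"
      using that by (auto simp: p'_def in_keys_iff lookup_minus lookup_single when_def split: if_splits)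
    then show ?thesis using keys_le_lead_monom[of e p] by simp
  qed
  have q': "e < lead_monom q" if "e \<in> keys q'" for e
  proof -
    have "e \<noteq> lead_monom q" "e \<in> keys q"
      using that by (auto simp: q'_def in_keys_iff lookup_minus lookup_single when_def split: if_splits)
    then show ?thesis using keys_le_lead_monom[of e q] by simp
  qed
  have "lead_monom p + lead_monom q \<notin> keys (p' * q)"
  proof
    assume "lead_monom p + lead_monom q \<in> keys (p' * q)"
    then obtain a b where "a \<in> keys p'" "b \<in> keys q" "lead_monom p + lead_monom q = a + b"
      using keys_mult[of p' q] by blast
    then show False using add_less_le_mono[OF p'[of a] keys_le_lead_monom[of b q]] by simp
  qed
  moreover have "lead_monom p + lead_monom q \<notin> keys (single (lead_monom p) (lookup p (lead_monom p)) * q')"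
  proof
    assume "lead_monom p + lead_monom q \<in> keys (single (lead_monom p) (lookup p (lead_monom p)) * q')"
    then obtain b where "b \<in> keys q'" "lead_monom p + lead_monom q = lead_monom p + b"
      using keys_mult[of "single (lead_monom p) (lookup p (lead_monom p))" q'] by (auto split: if_splits)
    then show False using q'[of b] by simp
  qed
  moreover have "p * q = p' * q + single (lead_monom p) (lookup p (lead_monom p)) * q'
      + single (lead_monom p + lead_monom q) (lookup p (lead_monom p) * lookup q (lead_monom q))"
    by (simp add: p'_def q'_def algebra_simps mult_single)
  ultimately show ?thesis by (simp add: lookup_add in_keys_iff)
qed

lemma lead_monom_mult:
  assumes "p \<noteq> 0" "q \<noteq> 0"
  shows "lead_monom (p * q) = lead_monom p + lead_monom q"
proof (rule antisym)
  show "lead_monom (p * q) \<le> lead_monom p + lead_monom q"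
    using assms by (intro keys_mult_le_lead_monom lead_monom_in_keys) simp
  have "lookup (p * q) (lead_monom p + lead_monom q) \<noteq> 0"
    using lead_monom_in_keys[OF assms(1)] lead_monom_in_keys[OF assms(2)]
    by (simp add: lookup_mult_lead_monom[OF assms] in_keys_iff)
  then show "lead_monom p + lead_monom q \<le> lead_monom (p * q)" by (intro keys_le_lead_monom) (simp add: in_keys_iff)
qed

lemma lookup_lead_monom_power: "p \<noteq> 0 \<Longrightarrow> lookup (lead_monom (p ^ m)) i = m * lookup (lead_monom p) i"
proof (induction m)
  case 0
  show ?case by (simp add: lead_monom_def)
next
  case (Suc m)
  then show ?case by (simp add: lead_monom_mult lookup_add)
qed

text \<open>
  The lexicographic order is a well-order only for a bounded number of variables.
\<close>

lemma wf_lex_monoms: "wf {(d, e :: nat \<Rightarrow>\<^sub>0 nat). d < e \<and> keys d \<subseteq> {..<n} \<and> keys e \<subseteq> {..<n}}"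
proof (rule wf_subset)
  show "wf (inv_image (lex less_than) (\<lambda>e :: nat \<Rightarrow>\<^sub>0 nat. map (lookup e) [0..<n]))"
    by (intro wf_inv_image wf_lex wf_less_than)
  show "{(d, e :: nat \<Rightarrow>\<^sub>0 nat). d < e \<and> keys d \<subseteq> {..<n} \<and> keys e \<subseteq> {..<n}}
      \<subseteq> inv_image (lex less_than) (\<lambda>e. map (lookup e) [0..<n])"
  proof clarify
    fix d e :: "nat \<Rightarrow>\<^sub>0 nat" assume "d < e" and keys: "keys d \<subseteq> {..<n}" "keys e \<subseteq> {..<n}"
    then obtain k where k: "lookup d k < lookup e k" "\<And>j. j < k \<Longrightarrow> lookup d j = lookup e j"
      by (auto simp: less_poly_mapping.rep_eq elim: less_funE)
    have "k \<in> keys e" using k(1) by (simp add: in_keys_iff)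
    then have "k < n" using keys(2) by auto
    then have "[0..<n] = [0..<k] @ k # [Suc k..<n]"
      using upt_add_eq_append[of 0 k "n - k"] upt_conv_Cons[of k n] by simp
    moreover have "map (lookup d) [0..<k] = map (lookup e) [0..<k]" using k(2) by simp
    ultimately show "(d, e) \<in> inv_image (lex less_than) (\<lambda>e. map (lookup e) [0..<n])"
      using k(1) unfolding inv_image_def lex_conv by force
  qed
qed

text \<open>
  Divide \<open>a\<close> by \<open>b\<close> with respect to leading monomials.  The hypothesis passes to each remainder, and
  comparing exponents in \<open>c a\<^sup>m = q b\<^sup>m\<close> for large \<open>m\<close> shows that the leading monomial of \<open>b\<close> divides
  that of the remainder, so the division can only end with remainder 0.
\<close>

lemma poly_ring_completely_integrally_closed:
  fixes a b c :: "'k::field mpoly"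
  assumes b: "b \<in> poly_ring n" "b \<noteq> 0" and c: "c \<noteq> 0"
  shows "a \<in> poly_ring n \<Longrightarrow> \<forall>m. \<exists>q\<in>poly_ring n. c * a ^ m = q * b ^ m \<Longrightarrow> \<exists>q\<in>poly_ring n. a = q * b"
proof (induction a rule: wf_induct_rule[OF wf_inv_image[OF wf_lex_monoms[of n], of lead_monom]])
  case (1 a)
  note B = poly_ring_subring[where ?'a = 'k, of n]
  have keys: "keys e \<subseteq> {..<n}" if "e \<in> keys p" "p \<in> poly_ring n" for e and p :: "'k mpoly"
    using that by (auto simp: poly_ring_def polys_def)
  show ?case
  proof (cases "a = 0")
    case True
    then show ?thesis using subring_0[OF B] by (intro bexI[of _ 0]) auto
  next
    case False
    note a = \<open>a \<in> poly_ring n\<close> False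
    have le: "lookup (lead_monom b) i \<le> lookup (lead_monom a) i" for i
    proof (rule ccontr)
      assume "\<not> ?thesis"
      then have lt: "Suc (lookup (lead_monom a) i) \<le> lookup (lead_monom b) i" by simp
      \<comment> \<open>A power that outweighs the exponent of \<open>c\<close>.\<close>
      define m where "m = Suc (lookup (lead_monom c) i)"
      obtain q where q: "c * a ^ m = q * b ^ m" using "1.prems"(2) by blast
      then have "q \<noteq> 0" using a c by auto
      then have "lead_monom c + lead_monom (a ^ m) = lead_monom q + lead_monom (b ^ m)"
        using arg_cong[OF q, of lead_monom] a b c by (simp add: lead_monom_mult)
      then have "lookup (lead_monom c) i + m * lookup (lead_monom a) i = lookup (lead_monom q) i + m * lookup (lead_monom b) i"
        using a b by (metis lookup_add lookup_lead_monom_power)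
      moreover have "m * Suc (lookup (lead_monom a) i) \<le> m * lookup (lead_monom b) i" using lt by (rule mult_le_mono2)
      ultimately show False by (simp add: m_def)
    qed
    define s where "s = lead_monom a - lead_monom b"
    have s: "s + lead_monom b = lead_monom a"
      by (rule poly_mapping_eqI) (simp add: s_def lookup_add lookup_minus_nat le)
    define w where "w = single s (lookup a (lead_monom a) / lookup b (lead_monom b))"
    have lc: "lookup a (lead_monom a) \<noteq> 0" "lookup b (lead_monom b) \<noteq> 0"
      using lead_monom_in_keys a b by (auto simp: in_keys_iff)
    have w0: "w \<noteq> 0" "lead_monom w = s" using lc by (auto simp: w_def lead_monom_def dest: arg_cong[of _ _ "\<lambda>p. lookup p s"])
    have "keys s \<subseteq> keys (lead_monom a)" by (auto simp: s_def in_keys_iff lookup_minus_nat)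
    then have w: "w \<in> poly_ring n"
      using keys[OF lead_monom_in_keys[OF a(2)] a(1)] unfolding w_def poly_ring_def by (intro polys_single) auto
    define a' where "a' = a - w * b"
    have a': "a' \<in> poly_ring n" unfolding a'_def by (intro subring_diff[OF B] subring_mult[OF B] a b w)
    have "\<exists>q\<in>poly_ring n. a' = q * b"
    proof (cases "a' = 0")
      case True
      then show ?thesis using subring_0[OF B] by (intro bexI[of _ 0]) auto
    next
      case False
      have "lookup (w * b) (lead_monom a) = lookup a (lead_monom a)"
        using lookup_mult_lead_monom[OF w0(1) b(2)] lc by (simp add: w0 s) (simp add: w_def)
      then have "lead_monom a' \<noteq> lead_monom a"
        using lead_monom_in_keys[OF False] by (auto simp: a'_def in_keys_iff lookup_minus)
      moreover have "lead_monom a' \<le> lead_monom a"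
      proof -
        have "lead_monom a' \<in> keys a \<or> lead_monom a' \<in> keys (w * b)"
          using lead_monom_in_keys[OF False] by (auto simp: a'_def in_keys_iff lookup_minus)
        then show ?thesis using keys_le_lead_monom[of "lead_monom a'" a] keys_mult_le_lead_monom[of "lead_monom a'" w b] by (auto simp: w0 s)
      qed
      ultimately have lt: "(a', a) \<in> inv_image {(d, e). d < e \<and> keys d \<subseteq> {..<n} \<and> keys e \<subseteq> {..<n}} lead_monom"
        using keys[OF lead_monom_in_keys a(1)] keys[OF lead_monom_in_keys a'] False a by (simp add: inv_image_def)
      have "\<exists>q\<in>poly_ring n. c * a' ^ m = q * b ^ m" for m
      proof -
        obtain Q where Q: "\<And>k. Q k \<in> poly_ring n" "\<And>k. c * a ^ k = Q k * b ^ k"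
          using "1.prems"(2) by metis
        let ?q = "\<Sum>k\<le>m. of_nat (m choose k) * Q k * (- w) ^ (m - k)"
        have "c * a' ^ m = (\<Sum>k\<le>m. of_nat (m choose k) * (c * a ^ k) * (- (w * b)) ^ (m - k))"
          using binomial_ring[of a "- (w * b)" m]
          by (simp add: a'_def sum_distrib_left mult_ac)
        also have "\<dots> = (\<Sum>k\<le>m. (of_nat (m choose k) * Q k * (- w) ^ (m - k)) * b ^ m)"
        proof (rule sum.cong[OF refl])
          fix k assume "k \<in> {..m}"
          then have "b ^ m = b ^ k * b ^ (m - k)" by (simp flip: power_add)
          then show "of_nat (m choose k) * (c * a ^ k) * (- (w * b)) ^ (m - k)
              = (of_nat (m choose k) * Q k * (- w) ^ (m - k)) * b ^ m"
            unfolding Q(2) minus_mult_left power_mult_distrib by (simp add: mult_ac)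
        qed
        also have "\<dots> = ?q * b ^ m" by (simp add: sum_distrib_right)
        finally have "c * a' ^ m = ?q * b ^ m" .
        moreover have "?q \<in> poly_ring n"
          by (intro subring_sum[OF B] subring_mult[OF B] subring_power[OF B] subring_of_nat[OF B]
              subring_uminus[OF B] Q w)
        ultimately show ?thesis by blast
      qed
      then show ?thesis using "1.IH"[OF lt a'] by blast
    qed
    then obtain q where "q \<in> poly_ring n" "a' = q * b" by blast
    then have "a = (q + w) * b" "q + w \<in> poly_ring n"
      using subring_add[OF B _ w] by (auto simp: a'_def algebra_simps)
    then show ?thesis by blast
  qed
qed

section \<open>Subrings of a univariate polynomial ring\<close>

definition poly_over :: "'a::comm_ring_1 set \<Rightarrow> 'a poly \<Rightarrow> bool" where
  "poly_over A Z \<longleftrightarrow> (\<forall>i. coeff Z i \<in> A)"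

lemma poly_over_ops:
  assumes A: "is_subring A"
  shows "poly_over A Z \<Longrightarrow> poly_over A Z' \<Longrightarrow> poly_over A (Z + Z')"
    and "poly_over A Z \<Longrightarrow> poly_over A Z' \<Longrightarrow> poly_over A (Z - Z')"
    and "poly_over A Z \<Longrightarrow> poly_over A Z' \<Longrightarrow> poly_over A (Z * Z')"
    and "a \<in> A \<Longrightarrow> poly_over A Z \<Longrightarrow> poly_over A (smult a Z)"
    and "a \<in> A \<Longrightarrow> poly_over A (monom a i)"
    and "a \<in> A \<Longrightarrow> poly_over A [:a:]"
    and "poly_over A 0"
  using A by (auto simp: poly_over_def coeff_mult coeff_pCons subring_0
      intro!: subring_add subring_diff subring_mult subring_sum split: nat.split)

text \<open>
  Division with remainder over a subring, at the price of a power of the leading coefficient.  With a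
  leading coefficient that is a unit this is ordinary division, with quotient and remainder over the
  same subring.
\<close>

lemma pseudo_division:
  fixes F :: "'a::comm_ring_1 poly"
  assumes A: "is_subring A" and F: "poly_over A F"
    and Z: "poly_over A Z" "\<And>i. i \<ge> degree F + l \<Longrightarrow> coeff Z i = 0"
  shows "\<exists>Q R. poly_over A Q \<and> poly_over A R \<and> (\<forall>i\<ge>degree F. coeff R i = 0) \<and>
    smult (lead_coeff F ^ l) Z = Q * F + R"
  using Z
proof (induction l arbitrary: Z)
  case 0
  then show ?case using poly_over_ops(7)[OF A] by (intro exI[of _ 0] exI[of _ Z]) auto
next
  case (Suc l)
  note ops = poly_over_ops[OF A]
  let ?n = "degree F" and ?b = "lead_coeff F"
  have b: "?b \<in> A" using F by (simp add: poly_over_def)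
  define z where "z = coeff Z (?n + l)"
  have z: "z \<in> A" using Suc.prems(1) by (simp add: z_def poly_over_def)
  define Z' where "Z' = smult ?b Z - monom z l * F"
  have Z': "poly_over A Z'" unfolding Z'_def by (intro ops F Suc.prems(1) b z)
  have "coeff Z' i = 0" if "i \<ge> ?n + l" for i
  proof (cases "i = ?n + l")
    case True
    then show ?thesis by (simp add: Z'_def z_def coeff_monom_mult)
  next
    case False
    then have "coeff F (i - l) = 0" "coeff Z i = 0"
      using that Suc.prems(2) by (auto intro: coeff_eq_0)
    then show ?thesis by (simp add: Z'_def coeff_monom_mult)
  qed
  then obtain Q R where QR: "poly_over A Q" "poly_over A R" "\<forall>i\<ge>?n. coeff R i = 0"
    "smult (?b ^ l) Z' = Q * F + R" using Suc.IH[OF Z'] by blast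
  have "smult (?b ^ Suc l) Z = smult (?b ^ l) Z' + smult (?b ^ l) (monom z l * F)"
    by (simp add: Z'_def smult_diff_right mult.commute)
  also have "\<dots> = (Q + smult (?b ^ l) (monom z l)) * F + R"
    by (simp add: QR(4) distrib_right)
  finally show ?case
    using QR ops(1)[OF QR(1) ops(4)[OF subring_power[OF A b] ops(5)[OF z]]] by blast
qed

lemma exists_prime_factor:
  fixes u :: "'k::field poly"
  assumes "degree u > 0"
  shows "\<exists>\<pi>. prime_elem \<pi> \<and> \<pi> dvd u"
proof -
  define P where "P d \<longleftrightarrow> (\<exists>v. v dvd u \<and> degree v = d \<and> d > 0)" for d
  have "P (degree u)" using assms unfolding P_def by (intro exI[of _ u]) auto
  then have "P (LEAST d. P d)" by (rule LeastI)
  then obtain v where v: "v dvd u" "degree v = (LEAST d. P d)" "degree v > 0" unfolding P_def by auto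
  have "irreducible v"
  proof (rule irreducibleI)
    show v0: "v \<noteq> 0" using v(3) by (intro notI) simp
    show "\<not> is_unit v" using v(3) is_unit_iff_degree[OF v0] by simp
    fix a b assume ab: "v = a * b"
    then have nz: "a \<noteq> 0" "b \<noteq> 0" using v(3) by auto
    then have deg: "degree v = degree a + degree b" using ab by (simp add: degree_mult_eq)
    have small: "degree w = 0" if "w dvd v" "degree w < degree v" for w
    proof (rule ccontr)
      assume "degree w \<noteq> 0"
      then have "P (degree w)" using that v(1) unfolding P_def by (auto intro: dvd_trans)
      then show False using not_less_Least that(2) v(2) by metis
    qed
    have "degree a = 0 \<or> degree b = 0"
      using small[of a] small[of b] ab deg by (cases "degree b = 0") auto
    then show "is_unit a \<or> is_unit b" using nz by (simp add: is_unit_iff_degree)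
  qed
  then show ?thesis using v(1) field_poly_irreducible_imp_prime by blast
qed

lemma smult_left_cancel:
  fixes c :: "'a::idom"
  assumes "c \<noteq> 0" "smult c x = smult c y"
  shows "x = y"
  using assms by (metis eq_iff_diff_eq_0 smult_diff_right smult_eq_0_iff)

text \<open>
  Gauss's lemma for \<open>k[t][T]\<close>: the prime factors of \<open>u\<close> in \<open>k[t]\<close> remain prime in \<open>k[t][T]\<close>, so they
  can be removed one by one from \<open>Q\<close> or from \<open>G\<close>.
\<close>

lemma gauss_split:
  fixes u :: "'k::field poly" and P Q G :: "'k poly poly"
  assumes "u \<noteq> 0" "smult u P = Q * G"
  shows "\<exists>g F. G = smult g F \<and> F dvd P"
  using assms
proof (induction "degree u" arbitrary: u Q G rule: less_induct)
  case less
  show ?case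
  proof (cases "degree u = 0")
    case True
    then obtain c where u: "u = [:c:]" by (rule degree_eq_zeroE)
    then have c: "c \<noteq> 0" using less.prems by simp
    have "P = smult [:inverse c:] (smult u P)" using c by (simp add: u one_pCons[symmetric])
    also have "\<dots> = smult [:inverse c:] Q * G" by (simp add: less.prems)
    finally have "G dvd P" by (metis dvd_triv_right)
    then show ?thesis by (intro exI[of _ 1] exI[of _ G]) simp
  next
    case False
    then obtain \<pi> where \<pi>: "prime_elem \<pi>" "\<pi> dvd u" using exists_prime_factor by blast
    then obtain u' where u': "u = \<pi> * u'" by (elim dvdE)
    have \<pi>0: "\<pi> \<noteq> 0" "u' \<noteq> 0" using u' less.prems by auto
    have "degree \<pi> > 0" using \<pi>(1) \<pi>0 by (metis is_unit_iff_degree not_gr0 prime_elem_not_unit)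
    then have deg: "degree u' < degree u" using \<pi>0 by (simp add: u' degree_mult_eq)
    have "Q * G = [:\<pi>:] * smult u' P" using less.prems(2) by (simp add: u' mult.commute)
    then have "[:\<pi>:] dvd Q * G" by (rule dvdI)
    then consider "[:\<pi>:] dvd Q" | "[:\<pi>:] dvd G"
      using lift_prime_elem_poly[OF \<pi>(1)] prime_elem_dvd_multD by blast
    then show ?thesis
    proof cases
      case 1
      then obtain Q' where "Q = smult \<pi> Q'" by (auto elim!: dvdE)
      then have "smult \<pi> (smult u' P) = smult \<pi> (Q' * G)" using less.prems(2) by (simp add: u')
      then have "smult u' P = Q' * G" by (rule smult_left_cancel[OF \<pi>0(1)])
      then show ?thesis using less.hyps[OF deg \<pi>0(2)] by blast
    next
      case 2
      then obtain G' where G': "G = smult \<pi> G'" by (auto elim!: dvdE)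
      then have "smult \<pi> (smult u' P) = smult \<pi> (Q * G')" using less.prems(2) by (simp add: u')
      then have "smult u' P = Q * G'" by (rule smult_left_cancel[OF \<pi>0(1)])
      then obtain g F where "G' = smult g F" "F dvd P" using less.hyps[OF deg \<pi>0(2)] by blast
      then show ?thesis using G' by (intro exI[of _ "\<pi> * g"] exI[of _ F]) simp
    qed
  qed
qed

text \<open>
  \<open>h(T)\<close> as a polynomial in \<open>T\<close> over \<open>k[t]\<close>, with coefficients that are constant in \<open>t\<close>.
\<close>

definition lift :: "'k::field poly \<Rightarrow> 'k poly poly" where
  "lift h = map_poly (\<lambda>c. [:c:]) h"

lemma coeff_lift [simp]: "coeff (lift h) i = [:coeff h i:]"
  by (simp add: lift_def coeff_map_poly)

lemma poly_lift: "poly (lift h) [:0, 1:] = h"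
  by (simp add: lift_def pcompose_altdef[symmetric])

text \<open>
  Exchanges \<open>t\<close> and \<open>T\<close>, which turns the degree in \<open>t\<close> into an ordinary degree.
\<close>

definition swap :: "'k::field poly poly \<Rightarrow> 'k poly poly" where
  "swap Z = (\<Sum>i\<le>degree Z. map_poly (\<lambda>c. monom c i) (coeff Z i))"

lemma coeff_swap: "coeff (coeff (swap Z) m) i = coeff (coeff Z i) m"
proof -
  have "coeff (coeff (swap Z) m) i = (\<Sum>j\<le>degree Z. if j = i then coeff (coeff Z j) m else 0)"
    by (simp add: swap_def coeff_sum coeff_map_poly)
  also have "\<dots> = coeff (coeff Z i) m"
    by (cases "i \<le> degree Z") (auto simp: coeff_eq_0)
  finally show ?thesis .
qed

lemma swap_mult: "swap (Y * Z) = swap Y * swap Z"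
proof -
  have "coeff (coeff (Y * Z) i) m
      = (\<Sum>a\<le>i. \<Sum>b\<le>m. coeff (coeff Y a) b * coeff (coeff Z (i - a)) (m - b))" for i m
    by (simp add: coeff_mult coeff_sum)
  moreover have "coeff (coeff (swap Y * swap Z) m) i
      = (\<Sum>b\<le>m. \<Sum>a\<le>i. coeff (coeff Y a) b * coeff (coeff Z (i - a)) (m - b))" for i m
    by (simp add: coeff_mult coeff_sum coeff_swap)
  ultimately have "coeff (coeff (swap (Y * Z)) m) i = coeff (coeff (swap Y * swap Z) m) i" for i m
    by (simp add: coeff_swap sum.swap[of _ "{..i}"])
  then show ?thesis by (simp add: poly_eq_iff)
qed

text \<open>
  \<open>h(T) - h(t)\<close>, which vanishes on the diagonal \<open>T = t\<close>.
\<close>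

definition diag :: "'k::field poly \<Rightarrow> 'k poly poly" where
  "diag h = lift h - [:h:]"

lemma poly_diag: "poly (diag h) [:0, 1:] = 0"
  by (simp add: diag_def poly_lift)

lemma coeff_diag: "coeff (diag h) i = (if i = 0 then [:coeff h 0:] - h else [:coeff h i:])"
  by (simp add: diag_def coeff_pCons split: nat.split)

lemma degree_diag:
  assumes "degree h > 0"
  shows "degree (diag h) = degree h" "lead_coeff (diag h) = [:lead_coeff h:]"
proof -
  show *: "degree (diag h) = degree h"
  proof (rule antisym)
    show "degree (diag h) \<le> degree h" using assms by (intro degree_le) (auto simp: coeff_diag coeff_eq_0)
    show "degree h \<le> degree (diag h)" using assms by (intro le_degree) (auto simp: coeff_diag)
  qed
  show "lead_coeff (diag h) = [:lead_coeff h:]" using assms by (simp add: * coeff_diag)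
qed

text \<open>
  The key point of Lueroth's theorem.  Both \<open>\<theta>(T) - \<theta>(t)\<close> and its divisor \<open>F\<close> have degree
  \<open>degree \<theta>\<close> in \<open>t\<close>, so \<open>Q\<close> does not involve \<open>t\<close>; as the coefficient of the highest power of \<open>t\<close> in
  the dividend is a constant, \<open>Q\<close> does not involve \<open>T\<close> either.
\<close>

lemma diag_factor:
  assumes H: "diag \<theta> = Q * F" and d: "degree \<theta> > 0" and j: "coeff F j = \<theta>"
  shows "\<exists>c. c \<noteq> 0 \<and> diag \<theta> = smult [:c:] F"
proof -
  let ?d = "degree \<theta>"
  have H0: "diag \<theta> \<noteq> 0" using degree_diag(1)[OF d] d by auto
  then have nz: "Q \<noteq> 0" "F \<noteq> 0" using H by auto
  have sw0: "swap Z \<noteq> 0" if "Z \<noteq> 0" for Z :: "'a poly poly"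
    using that by (metis coeff_swap coeff_0 poly_eqI)
  have coeff_H: "coeff (swap (diag \<theta>)) m = [:- coeff \<theta> m:]" if "m > 0" for m
    by (rule poly_eqI) (use that in \<open>simp add: coeff_swap coeff_diag coeff_pCons split: nat.split\<close>)
  have degH: "degree (swap (diag \<theta>)) = ?d"
  proof (rule antisym)
    show "degree (swap (diag \<theta>)) \<le> ?d" using d by (intro degree_le) (auto simp: coeff_H coeff_eq_0)
    show "?d \<le> degree (swap (diag \<theta>))" using d by (intro le_degree) (auto simp: coeff_H)
  qed
  have "coeff (swap F) ?d \<noteq> 0"
  proof
    assume "coeff (swap F) ?d = 0"
    then have "coeff (coeff F j) ?d = 0" by (simp flip: coeff_swap)
    then show False using j d by auto
  qed
  then have "?d \<le> degree (swap F)" by (rule le_degree)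
  moreover have sum: "degree (swap Q) + degree (swap F) = ?d"
    using degH nz by (simp add: H swap_mult degree_mult_eq sw0)
  ultimately have "degree (swap Q) = 0" by simp
  then obtain q where q: "swap Q = [:q:]" by (rule degree_eq_zeroE)
  have "lead_coeff (swap Q) * lead_coeff (swap F) = [:- lead_coeff \<theta>:]"
    using lead_coeff_mult[of "swap Q" "swap F"] degH coeff_H[OF d] by (simp flip: swap_mult H)
  then have "q * lead_coeff (swap F) = [:- lead_coeff \<theta>:]" by (simp add: q)
  moreover have "[:- lead_coeff \<theta>:] \<noteq> 0" using d by auto
  ultimately have "degree q = 0"
    by (metis add_is_0 degree_mult_eq degree_pCons_0 mult_zero_left mult_zero_right)
  then obtain c where c: "q = [:c:]" by (rule degree_eq_zeroE)
  have "Q = [:[:c:]:]"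
  proof (rule poly_eqI, rule poly_eqI)
    fix i m
    have "coeff (coeff Q i) m = coeff (coeff (swap Q) m) i" by (simp add: coeff_swap)
    then show "coeff (coeff Q i) m = coeff (coeff [:[:c:]:] i) m"
      by (simp add: q c coeff_pCons split: nat.split)
  qed
  then show ?thesis using H nz by (intro exI[of _ c]) auto
qed

text \<open>
  A form of Lueroth's theorem for rings.  Among the relations \<open>Z(T)\<close> over \<open>A\<close> with \<open>Z(t) = 0\<close> choose
  one of least degree, \<open>G\<close>.  By Gauss's lemma it is a multiple of a monic \<open>F\<close> over \<open>k[t]\<close>, whose
  coefficients are fractions of elements of \<open>A\<close> and hence lie in \<open>A\<close>, since \<open>A\<close> is completely
  integrally closed and contains a nonconstant polynomial.  Then \<open>F\<close> divides \<open>h(T) - h(t)\<close> for all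
  \<open>h\<close> in \<open>A\<close>.  Taking for \<open>\<theta>\<close> a nonconstant coefficient of \<open>F\<close>, the polynomial \<open>F\<close> is
  \<open>\<theta>(T) - \<theta>(t)\<close> up to a constant, and dividing \<open>h(T)\<close> by it exhibits \<open>h\<close> as a polynomial in \<open>\<theta>\<close>.
\<close>

theorem subring_of_univariate_polys:
  fixes A :: "'k::field poly set"
  assumes A: "is_subring A" and const: "\<And>c. [:c:] \<in> A" and p0: "p0 \<in> A" "degree p0 > 0"
    and cic: "\<And>a b c. a \<in> A \<Longrightarrow> b \<in> A \<Longrightarrow> c \<in> A \<Longrightarrow> b \<noteq> 0 \<Longrightarrow> c \<noteq> 0 \<Longrightarrow>
      \<forall>m. \<exists>q\<in>A. c * a ^ m = q * b ^ m \<Longrightarrow> \<exists>q\<in>A. a = q * b"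
  shows "\<exists>\<theta>\<in>A. \<forall>h\<in>A. \<exists>r. h = pcompose r \<theta>"
proof -
  note ops = poly_over_ops[OF A]
  let ?t = "[:0, 1 :: 'k:]"
  have lift_over: "poly_over A (lift h)" for h by (simp add: poly_over_def const)
  have diag_over: "poly_over A (diag h)" if "h \<in> A" for h
    unfolding diag_def by (intro ops lift_over that)
  define p where "p = smult (inverse (lead_coeff p0)) p0"
  have "p0 \<noteq> 0" using p0 by auto
  then have p: "p \<in> A" "degree p > 0" "lead_coeff p = 1"
    using p0 subring_mult[OF A const[of "inverse (lead_coeff p0)"] p0(1)] by (auto simp: p_def)
  define rel where "rel Z \<longleftrightarrow> poly_over A Z \<and> Z \<noteq> 0 \<and> poly Z ?t = 0" for Z
  have "rel (diag p)"
    unfolding rel_def using diag_over[OF p(1)] poly_diag degree_diag(1)[OF p(2)] p(2) by auto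
  then obtain G where G: "rel G" and min: "\<And>Z. rel Z \<Longrightarrow> degree G \<le> degree Z"
    using ex_has_least_nat[of rel "diag p" degree] by blast
  define n b where "n = degree G" and "b = lead_coeff G"
  have b: "b \<in> A" "b \<noteq> 0" using G by (auto simp: rel_def poly_over_def b_def)
  have small_0: "Z = 0" if "poly_over A Z" "poly Z ?t = 0" "\<forall>i\<ge>n. coeff Z i = 0" for Z
  proof (rule ccontr)
    assume "Z \<noteq> 0"
    then have "n \<le> degree Z" using min that unfolding rel_def n_def by blast
    then show False using that(3) \<open>Z \<noteq> 0\<close> by (metis leading_coeff_0_iff)
  qed
  have n: "n > 0"
  proof (rule ccontr)
    assume "\<not> n > 0"
    then obtain g where "G = [:g:]" using degree_eq_zeroE[of G] n_def by auto
    then show False using G by (simp add: rel_def)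
  qed
  \<comment> \<open>Uniform denominators for \<open>k[t]\<close> over the powers \<open>1, t, \<dots>, t\<^sup>n\<^sup>-\<^sup>1\<close>.\<close>
  have reduce: "\<exists>R. poly_over A R \<and> (\<forall>i\<ge>n. coeff R i = 0) \<and> b ^ degree p * z = poly R ?t" for z
  proof -
    have "coeff (lift z) i = 0" if "i \<ge> degree (diag p) + Suc (degree z)" for i
      using that by (simp add: coeff_eq_0)
    then obtain Q R where R: "poly_over A R" "\<forall>i\<ge>degree (diag p). coeff R i = 0"
      "smult (lead_coeff (diag p) ^ Suc (degree z)) (lift z) = Q * diag p + R"
      using pseudo_division[OF A diag_over[OF p(1)] lift_over] by metis
    then have "lift z = Q * diag p + R" using degree_diag(2)[OF p(2)] p(3) by (simp flip: one_pCons)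
    then have z: "z = poly R ?t" using poly_lift[of z] by (simp add: poly_diag)
    have "coeff R i = 0" if "i \<ge> degree G + degree p" for i
      using R(2) that degree_diag(1)[OF p(2)] by simp
    then obtain Q' R' where R': "poly_over A R'" "\<forall>i\<ge>degree G. coeff R' i = 0"
      "smult (lead_coeff G ^ degree p) R = Q' * G + R'"
      using pseudo_division[OF A _ R(1)] G unfolding rel_def by metis
    have "b ^ degree p * z = poly (smult (lead_coeff G ^ degree p) R) ?t" by (simp add: z b_def)
    also have "\<dots> = poly R' ?t" using G by (simp add: R'(3) rel_def)
    finally show ?thesis using R' n_def by blast
  qed
  \<comment> \<open>Elements of \<open>k[t]\<close> that are fractions over \<open>A\<close>: the power of \<open>b\<close> above is a denominator for all powers of such an element.\<close>
  have integral: "g \<in> A" if a: "a \<in> A" and b': "b' \<in> A" "b' \<noteq> 0" and g: "a = b' * g" for a b' g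
  proof -
    have "\<exists>q\<in>A. b ^ degree p * a ^ m = q * b' ^ m" for m
    proof -
      obtain R where R: "poly_over A R" "\<forall>i\<ge>n. coeff R i = 0" "b ^ degree p * g ^ m = poly R ?t"
        using reduce by blast
      have bm: "b' ^ m \<in> A" using b' by (intro subring_power[OF A])
      have am: "b ^ degree p * a ^ m \<in> A" using a b by (intro subring_mult[OF A] subring_power[OF A])
      have "smult (b' ^ m) R - [:b ^ degree p * a ^ m:] = 0"
      proof (rule small_0)
        show "poly_over A (smult (b' ^ m) R - [:b ^ degree p * a ^ m:])" by (intro ops bm am R)
        show "poly (smult (b' ^ m) R - [:b ^ degree p * a ^ m:]) ?t = 0"
          by (simp add: R(3)[symmetric] g power_mult_distrib)
        show "\<forall>i\<ge>n. coeff (smult (b' ^ m) R - [:b ^ degree p * a ^ m:]) i = 0"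
          using R(2) n by (auto simp: coeff_pCons split: nat.split)
      qed
      then have "coeff (smult (b' ^ m) R - [:b ^ degree p * a ^ m:]) 0 = 0" by simp
      then show ?thesis using R(1) by (intro bexI[of _ "coeff R 0"]) (auto simp: poly_over_def mult.commute)
    qed
    then have "\<exists>q\<in>A. a = q * b'"
      using cic[OF a b'(1) subring_power[OF A b(1), of "degree p"] b'(2)] b(2) by simp
    then show ?thesis using b'(2) g by (auto simp: mult.commute)
  qed
  have G_dvd: "\<exists>l Q. smult (b ^ l) (diag h) = Q * G" if h: "h \<in> A" for h
  proof -
    have "coeff (diag h) i = 0" if "i \<ge> degree G + Suc (degree (diag h))" for i
      using that by (simp add: coeff_eq_0)
    then obtain Q R where R: "poly_over A R" "\<forall>i\<ge>degree G. coeff R i = 0"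
      "smult (lead_coeff G ^ Suc (degree (diag h))) (diag h) = Q * G + R"
      using pseudo_division[OF A _ diag_over[OF h]] G unfolding rel_def by metis
    have "poly (Q * G + R) ?t = 0" using poly_diag[of h] by (simp flip: R(3))
    then have "poly R ?t = 0" using G by (simp add: rel_def)
    then have "R = 0" using small_0 R n_def by blast
    then have "smult (b ^ Suc (degree (diag h))) (diag h) = Q * G" using R(3) by (simp add: b_def)
    then show ?thesis by blast
  qed
  obtain l Q where "smult (b ^ l) (diag p) = Q * G" using G_dvd p(1) by blast
  then obtain g F0 where F0: "G = smult g F0" "F0 dvd diag p"
    using gauss_split[of "b ^ l" "diag p" Q G] b(2) by auto
  obtain Q0 where Q0: "diag p = F0 * Q0" using F0(2) by (elim dvdE)
  have "lead_coeff F0 * lead_coeff Q0 = 1"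
    using degree_diag(2)[OF p(2)] p(3) by (simp add: Q0 lead_coeff_mult flip: one_pCons)
  then have "is_unit (lead_coeff F0)" by (metis dvd_triv_left)
  then obtain w where w: "lead_coeff F0 = [:w:]" "w \<noteq> 0"
    by (metis is_unit_iff_degree degree_eq_zeroE not_is_unit_0 pCons_0_0)
  \<comment> \<open>The divisor \<open>F0\<close> has a constant leading coefficient because \<open>diag p\<close> is monic.\<close>
  define F where "F = smult [:inverse w:] F0"
  have F_lc: "lead_coeff F = 1" using w by (simp add: F_def one_pCons)
  have F0F: "F0 = smult [:w:] F" using w by (simp add: F_def one_pCons[symmetric])
  then have GF: "G = smult (g * [:w:]) F" using F0 by simp
  then have "b = g * [:w:]" using F_lc by (simp add: b_def)
  then have GbF: "G = smult b F" using GF by simp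
  have deg_F: "degree F = n" using b(2) by (simp add: n_def GbF)
  have F_over: "poly_over A F"
    unfolding poly_over_def
  proof
    fix i
    have "coeff G i \<in> A" using G by (simp add: rel_def poly_over_def)
    then show "coeff F i \<in> A" using integral[of "coeff G i" b "coeff F i"] b by (simp add: GbF)
  qed
  have F_t: "poly F ?t = 0" using G b by (simp add: GbF rel_def)
  have F_dvd: "\<exists>Q. diag h = Q * F" if h: "h \<in> A" for h
  proof -
    have "coeff (diag h) i = 0" if "i \<ge> degree F + Suc (degree (diag h))" for i
      using that by (simp add: coeff_eq_0)
    then obtain Q R where R: "poly_over A R" "\<forall>i\<ge>degree F. coeff R i = 0"
      "smult (lead_coeff F ^ Suc (degree (diag h))) (diag h) = Q * F + R"
      using pseudo_division[OF A F_over diag_over[OF h]] by metis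
    then have eq: "diag h = Q * F + R" by (simp add: F_lc)
    have "poly R ?t = 0" using poly_diag[of h] F_t by (simp add: eq)
    then have "R = 0" using small_0 R deg_F by blast
    then show ?thesis using eq by auto
  qed
  \<comment> \<open>If all coefficients were constants, \<open>t\<close> would be algebraic over \<open>k\<close>.\<close>
  obtain j where j: "degree (coeff F j) > 0"
  proof (rule ccontr)
    assume "\<not> thesis"
    then have 0: "degree (coeff F i) = 0" for i using that by blast
    define \<phi> where "\<phi> = map_poly (\<lambda>c. coeff c 0) F"
    have "F = lift \<phi>"
      by (rule poly_eqI) (use 0 in \<open>simp add: \<phi>_def coeff_map_poly degree_0_id\<close>)
    then have "\<phi> = 0" using F_t poly_lift by metis
    then show False using \<open>F = lift \<phi>\<close> F_lc by (simp add: lift_def)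
  qed
  define \<theta> where "\<theta> = coeff F j"
  have \<theta>: "\<theta> \<in> A" "degree \<theta> > 0" using F_over j by (auto simp: \<theta>_def poly_over_def)
  obtain c where c: "c \<noteq> 0" "diag \<theta> = smult [:c:] F"
    using diag_factor F_dvd \<theta> \<theta>_def by metis
  have F_eq: "F = smult [:inverse c:] (diag \<theta>)" using c by (simp add: one_pCons[symmetric])
  \<comment> \<open>The ring \<open>k[\<theta>]\<close>.\<close>
  define T where "T = range (\<lambda>r. pcompose r \<theta>)"
  have T: "is_subring T"
  proof (rule is_subringI)
    have "1 = pcompose 1 \<theta>" by (simp add: one_pCons)
    then show "1 \<in> T" unfolding T_def by blast
  qed (auto simp: T_def simp flip: pcompose_add pcompose_mult pcompose_uminus)
  have T_const: "[:a:] \<in> T" for a unfolding T_def using pcompose_const[of a \<theta>] by (metis rangeI)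
  have "\<theta> = pcompose ?t \<theta>" by (simp add: pcompose_pCons)
  then have T_\<theta>: "\<theta> \<in> T" unfolding T_def by blast
  have diag_T: "poly_over T (diag \<theta>)" "poly_over T (lift h)" for h
    using T_const T_\<theta> subring_diff[OF T] by (auto simp: poly_over_def coeff_diag)
  have "\<exists>r. h = pcompose r \<theta>" if h: "h \<in> A" for h
  proof -
    define l where "l = Suc (degree h)"
    define e where "e = lead_coeff \<theta> ^ l"
    have e: "e \<noteq> 0" using \<theta>(2) by (auto simp: e_def)
    have lc: "lead_coeff (diag \<theta>) ^ l = [:e:]"
      using degree_diag(2)[OF \<theta>(2)] by (simp add: e_def poly_const_pow)
    have "coeff (lift h) i = 0" if "i \<ge> degree (diag \<theta>) + l" for i
      using that by (simp add: coeff_eq_0 l_def)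
    then obtain Q R where R: "poly_over T R" "\<forall>i\<ge>degree (diag \<theta>). coeff R i = 0"
      "smult [:e:] (lift h) = Q * diag \<theta> + R"
      using pseudo_division[OF T diag_T(1) diag_T(2)] lc by metis
    \<comment> \<open>Modulo \<open>diag \<theta>\<close>, the polynomial \<open>h(T)\<close> is congruent both to the constant \<open>h\<close> and, up to a scalar, to \<open>R\<close>; both have degree less than that of \<open>diag \<theta>\<close> in \<open>T\<close>.\<close>
    obtain Q' where "diag h = Q' * F" using F_dvd[OF h] by blast
    then have "lift h = Q' * F + [:h:]" by (simp add: diag_def algebra_simps)
    then have "smult [:e:] (lift h) = (smult [:e:] (smult [:inverse c:] Q')) * diag \<theta> + [:[:e:] * h:]"
      by (simp add: F_eq smult_add_right)
    then have "R - [:[:e:] * h:] = (smult [:e:] (smult [:inverse c:] Q') - Q) * diag \<theta>"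
      using R(3) by (simp add: algebra_simps)
    then have dvd: "diag \<theta> dvd R - [:[:e:] * h:]" by simp
    have d: "degree (diag \<theta>) > 0" using degree_diag(1)[OF \<theta>(2)] \<theta>(2) by simp
    have "R - [:[:e:] * h:] = 0"
    proof (rule ccontr)
      assume nz: "R - [:[:e:] * h:] \<noteq> 0"
      then have "degree (diag \<theta>) \<le> degree (R - [:[:e:] * h:])" using dvd by (rule dvd_imp_degree_le[rotated])
      moreover have "coeff (R - [:[:e:] * h:]) i = 0" if "i \<ge> degree (diag \<theta>)" for i
        using that R(2) d by (auto simp: coeff_pCons split: nat.split)
      ultimately show False using nz leading_coeff_0_iff by blast
    qed
    then have "coeff (R - [:[:e:] * h:]) 0 = 0" by simp
    then have "[:e:] * h \<in> T" using R(1) by (simp add: poly_over_def) (metis eq_iff_diff_eq_0)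
    then have "[:inverse e:] * ([:e:] * h) \<in> T" using subring_mult[OF T T_const] by blast
    then show ?thesis using e unfolding T_def by auto
  qed
  then show ?thesis using \<theta>(1) by blast
qed

section \<open>Localization\<close>

interpretation fract_map: ring_map "to_fract :: 'a::idom \<Rightarrow> 'a fract"
  by unfold_locales auto

lemma (in ring_map) lookup_map_hom: "lookup (Poly_Mapping.map h P) e = h (lookup P e)"
  by (simp add: map.rep_eq when_def h_0)

lemma (in ring_map) h_power: "h (a ^ m) = h a ^ m"
  by (induction m) (simp_all add: h_1 h_mult)

lemma (in ring_map) h_sum: "h (sum g I) = (\<Sum>i\<in>I. h (g i))"
  by (induction I rule: infinite_finite_induct) (simp_all add: h_0 h_add)

lemma (in ring_map) h_prod: "h (prod g I) = (\<Prod>i\<in>I. h (g i))"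
  by (induction I rule: infinite_finite_induct) (simp_all add: h_1 h_mult)

lemma (in ring_map) h_monom_val: "h (monom_val y e) = monom_val (\<lambda>i. h (y i)) e"
  by (simp add: monom_val_def h_prod h_power)

lemma (in ring_map) h_eval_mpoly: "h (eval_mpoly y P) = hom_eval (\<lambda>i. h (y i)) P"
  by (simp add: eval_mpoly_monom_val hom_eval_def h_sum h_mult h_monom_val)

lemma (in ring_map) eval_mpoly_map:
  "eval_mpoly z (Poly_Mapping.map h P) = hom_eval z P"
proof -
  have "keys (Poly_Mapping.map h P) \<subseteq> keys P"
    by (auto simp: in_keys_iff lookup_map_hom h_0)
  then show ?thesis
    by (simp add: eval_mpoly_eq id_map.hom_eval_superset[of "keys P"] lookup_map_hom hom_eval_def)
qed

lemma to_fract_in_localize: "is_subring A \<Longrightarrow> r \<in> R \<Longrightarrow> to_fract r \<in> localize R A"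
  unfolding localize_def to_fract_def using subring_1[of A]
  by (intro CollectI exI[of _ r] exI[of _ 1]) auto

lemma localize_iff:
  "z \<in> localize R A \<longleftrightarrow> (\<exists>r\<in>R. \<exists>s\<in>A - {0}. to_fract s * z = to_fract r)"
proof
  assume "z \<in> localize R A"
  then obtain r s where rs: "r \<in> R" "s \<in> A - {0}" "z = Fraction_Field.Fract r s" by (auto simp: localize_def)
  then have "to_fract s * z = to_fract r" by (simp add: to_fract_def eq_fract)
  then show "\<exists>r\<in>R. \<exists>s\<in>A - {0}. to_fract s * z = to_fract r" using rs by blast
next
  assume "\<exists>r\<in>R. \<exists>s\<in>A - {0}. to_fract s * z = to_fract r"
  then obtain r s where rs: "r \<in> R" "s \<in> A - {0}" "to_fract s * z = to_fract r" by blast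
  have "to_fract s * Fraction_Field.Fract r s = to_fract r" using rs by (simp add: to_fract_def eq_fract)
  then have "to_fract s * z = to_fract s * Fraction_Field.Fract r s" using rs by simp
  moreover have "to_fract s \<noteq> 0" using rs(2) by (metis Diff_iff insertI1 to_fract_0 to_fract_eq_iff)
  ultimately have "z = Fraction_Field.Fract r s" by simp
  then show "z \<in> localize R A" using rs by (auto simp: localize_def)
qed

lemma localize_subring:
  assumes R: "is_subring R" and A: "is_subring A" "A \<subseteq> R"
  shows "is_subring (localize R A)"
proof (rule is_subringI)
  show "1 \<in> localize R A" using to_fract_in_localize[OF A(1) subring_1[OF R]] by simp
  fix x assume "x \<in> localize R A"
  then obtain r s where x: "r \<in> R" "s \<in> A - {0}" "to_fract s * x = to_fract r" by (auto simp: localize_iff)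
  have "to_fract s * (- x) = to_fract (- r)" using x(3) by simp
  then show "- x \<in> localize R A" unfolding localize_iff using x subring_uminus[OF R] by blast
  fix y assume "y \<in> localize R A"
  then obtain r' s' where y: "r' \<in> R" "s' \<in> A - {0}" "to_fract s' * y = to_fract r'" by (auto simp: localize_iff)
  have ss: "s * s' \<in> A - {0}" "s \<in> R" "s' \<in> R" using x y A(2) subring_mult[OF A(1)] by auto
  have "to_fract (s * s') * (x + y) = to_fract s' * (to_fract s * x) + to_fract s * (to_fract s' * y)"
    by (simp add: algebra_simps)
  also have "\<dots> = to_fract (s' * r + s * r')" by (simp add: x y)
  finally show "x + y \<in> localize R A"
    unfolding localize_iff using ss x(1) y(1) by (blast intro: subring_add[OF R] subring_mult[OF R])
  have "to_fract (s * s') * (x * y) = (to_fract s * x) * (to_fract s' * y)"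
    by (simp add: algebra_simps)
  also have "\<dots> = to_fract (r * r')" by (simp add: x y)
  finally show "x * y \<in> localize R A"
    unfolding localize_iff using ss x(1) y(1) by (blast intro: subring_mult[OF R])
qed

lemma localize_inverse:
  assumes "is_subring A" "s \<in> A" "s \<noteq> 0"
  shows "inverse (to_fract s) \<in> localize A A"
proof -
  have "to_fract s \<noteq> 0" using assms(3) by (metis to_fract_0 to_fract_eq_iff)
  then have "to_fract s * inverse (to_fract s) = to_fract 1" by simp
  then show ?thesis unfolding localize_iff using assms subring_1[OF assms(1)] by blast
qed

lemma common_denominator:
  assumes "finite F" "F \<subseteq> localize R A" and R: "is_subring R" and A: "is_subring A" "A \<subseteq> R"
  shows "\<exists>s\<in>A - {0}. \<forall>z\<in>F. \<exists>r\<in>R. to_fract s * z = to_fract r"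
  using assms(1,2)
proof (induction F)
  case empty
  show ?case using subring_1[OF A(1)] by (intro bexI[of _ 1]) auto
next
  case (insert z F)
  then obtain s where s: "s \<in> A - {0}" "\<And>z. z \<in> F \<Longrightarrow> \<exists>r\<in>R. to_fract s * z = to_fract r" by auto
  obtain r t where t: "r \<in> R" "t \<in> A - {0}" "to_fract t * z = to_fract r"
    using insert.prems by (auto simp: localize_iff)
  have st: "s * t \<in> A - {0}" using s t subring_mult[OF A(1)] by auto
  have "\<exists>r\<in>R. to_fract (s * t) * w = to_fract r" if w: "w \<in> insert z F" for w
  proof (cases "w = z")
    case True
    then have "to_fract (s * t) * w = to_fract (s * r)" using t(3) by (simp add: mult.assoc)
    then show ?thesis using s t A(2) subring_mult[OF R] by blast
  next
    case False
    then obtain r' where r': "r' \<in> R" "to_fract s * w = to_fract r'" using w s(2) by blast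
    then have "to_fract (s * t) * w = to_fract (t * r')" by (simp add: mult_ac)
    then show ?thesis using r' t A(2) subring_mult[OF R] by blast
  qed
  then show ?case using st by blast
qed

text \<open>
  Generation up to denominators and independence over \<open>A\<close> become generation and independence over the
  fraction field, by clearing denominators.
\<close>

lemma is_polynomial_ring_localize:
  fixes A B :: "'a::idom set"
  assumes B: "is_subring B" and A: "is_subring A" "A \<subseteq> B" and xs: "set xs \<subseteq> B"
    and gen: "\<And>b. b \<in> B \<Longrightarrow> \<exists>c\<in>A - {0}. c * b \<in> adjoin A xs" and indep: "alg_independent A xs"
  shows "is_polynomial_ring (localize A A) (localize B A) (length xs)"
proof -
  define K where "K = localize A A"
  define ys where "ys = map to_fract xs"
  have K: "is_subring K" unfolding K_def using A by (intro localize_subring) auto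
  have nth_ys: "ys ! i = to_fract (xs ! i)" if "i < length xs" for i using that by (simp add: ys_def)
  have to_fract_eval: "to_fract (eval_mpoly ((!) xs) P) = eval_mpoly ((!) ys) (Poly_Mapping.map to_fract P)"
    and map_over: "Poly_Mapping.map to_fract P \<in> polys K (length xs)"
    if P: "P \<in> polys A (length xs)" for P
  proof -
    show *: "Poly_Mapping.map to_fract P \<in> polys K (length xs)"
    proof (rule polysI)
      fix e assume "e \<in> keys (Poly_Mapping.map to_fract P)"
      then have "e \<in> keys P" by (auto simp: in_keys_iff fract_map.lookup_map_hom)
      then show "lookup (Poly_Mapping.map to_fract P) e \<in> K \<and> keys e \<subseteq> {..<length xs}"
        using polysD[OF P] by (auto simp: fract_map.lookup_map_hom K_def intro: to_fract_in_localize A)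
    qed
    have "to_fract (eval_mpoly ((!) xs) P) = eval_mpoly (\<lambda>i. to_fract (xs ! i)) (Poly_Mapping.map to_fract P)"
      by (simp add: fract_map.h_eval_mpoly fract_map.eval_mpoly_map)
    also have "\<dots> = eval_mpoly ((!) ys) (Poly_Mapping.map to_fract P)"
      using * by (rule eval_mpoly_cong) (simp add: nth_ys)
    finally show "to_fract (eval_mpoly ((!) xs) P) = eval_mpoly ((!) ys) (Poly_Mapping.map to_fract P)" .
  qed
  have R: "is_subring (adjoin K ys)" using K by (rule adjoin_subring)
  have "localize B A = adjoin K ys"
  proof
    show "localize B A \<subseteq> adjoin K ys"
    proof
      fix z assume "z \<in> localize B A"
      then obtain b s where z: "b \<in> B" "s \<in> A - {0}" "to_fract s * z = to_fract b" by (auto simp: localize_iff)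
      obtain c where c: "c \<in> A - {0}" "c * b \<in> adjoin A xs" using gen[OF z(1)] by blast
      then obtain P where P: "P \<in> polys A (length xs)" "c * b = eval_mpoly ((!) xs) P"
        by (auto simp: adjoin_def)
      have cb: "to_fract (c * b) \<in> adjoin K ys"
        unfolding adjoin_def using map_over[OF P(1)]
        by (auto simp: P(2) to_fract_eval[OF P(1)] ys_def)
      have cs: "c * s \<in> A" "c * s \<noteq> 0" using c z subring_mult[OF A(1)] by auto
      have nz: "to_fract (c * s) \<noteq> 0" using cs(2) by (metis to_fract_0 to_fract_eq_iff)
      have "to_fract (c * s) * z = to_fract (c * b)" using z(3) by (simp add: mult.assoc)
      then have "z = inverse (to_fract (c * s)) * to_fract (c * b)"
        using nz by (metis left_inverse mult.assoc mult_1)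
      moreover have "inverse (to_fract (c * s)) \<in> adjoin K ys"
        using localize_inverse[OF A(1) cs] by (auto simp: K_def intro: adjoin_base)
      ultimately show "z \<in> adjoin K ys" using cb subring_mult[OF R] by simp
    qed
    show "adjoin K ys \<subseteq> localize B A"
    proof (rule adjoin_least)
      show "is_subring (localize B A)" using B A by (rule localize_subring)
      show "K \<subseteq> localize B A" unfolding K_def localize_def using A(2) by auto
      show "set ys \<subseteq> localize B A" using xs A(1) by (auto simp: ys_def intro: to_fract_in_localize)
    qed
  qed
  moreover have "alg_independent K ys"
    unfolding alg_independent_iff[OF K]
  proof (intro ballI impI)
    fix Q assume Q: "Q \<in> polys K (length ys)" and 0: "eval_mpoly ((!) ys) Q = 0"
    have "lookup Q ` keys Q \<subseteq> localize A A" using polysD[OF Q] by (auto simp: K_def)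
    then obtain s where s: "s \<in> A - {0}" "\<And>e. e \<in> keys Q \<Longrightarrow> \<exists>r\<in>A. to_fract s * lookup Q e = to_fract r"
      using common_denominator[of "lookup Q ` keys Q" A A] A(1) by auto
    then obtain r where r: "\<And>e. e \<in> keys Q \<Longrightarrow> r e \<in> A \<and> to_fract s * lookup Q e = to_fract (r e)"
      by metis
    define P where "P = (\<Sum>e\<in>keys Q. single e (r e))"
    have P: "P \<in> polys A (length xs)"
      unfolding P_def
      by (intro subring_sum polys_subring A polys_single) (use r polysD[OF Q] in \<open>auto simp: ys_def\<close>)
    have lookup_P: "to_fract (lookup P e) = to_fract s * lookup Q e" for e
    proof -
      have "lookup P e = (\<Sum>d\<in>keys Q. if d = e then r d else 0)"
        by (simp add: P_def lookup_sum lookup_single when_def)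
      also have "\<dots> = (if e \<in> keys Q then r e else 0)" by simp
      finally show ?thesis using r by (auto simp: in_keys_iff)
    qed
    have "Poly_Mapping.map to_fract P = single 0 (to_fract s) * Q"
    proof (rule poly_mapping_eqI)
      fix e
      have "single 0 (to_fract s) * Q = Poly_Mapping.map ((*) (to_fract s)) Q"
        by (rule mult_map_scale_conv_mult[symmetric])
      then show "lookup (Poly_Mapping.map to_fract P) e = lookup (single 0 (to_fract s) * Q) e"
        using lookup_P[of e] by (auto simp: fract_map.lookup_map_hom map.rep_eq when_def)
    qed
    then have "to_fract (eval_mpoly ((!) xs) P) = 0"
      by (simp add: to_fract_eval[OF P] eval_mpoly_mult 0)
    then have "eval_mpoly ((!) xs) P = 0" by (metis to_fract_0 to_fract_eq_iff)
    then have "P = 0" using indep P by (simp add: alg_independent_iff[OF A(1)])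
    then have "to_fract s * lookup Q e = 0" for e using lookup_P[of e] by simp
    moreover have "to_fract s \<noteq> 0" using s(1) by (metis Diff_iff insertI1 to_fract_0 to_fract_eq_iff)
    ultimately show "Q = 0" by (intro poly_mapping_eqI) simp
  qed
  ultimately show ?thesis
    unfolding is_polynomial_ring_def K_def[symmetric] by (intro exI[of _ ys]) (simp add: ys_def)
qed

section \<open>Common invariants of a full commuting family\<close>

lemma alg_independent_Nil: "is_subring A \<Longrightarrow> alg_independent A []"
proof -
  assume A: "is_subring A"
  have "p = 0" if p: "p \<in> polys A 0" "eval_mpoly ((!) []) p = 0" for p
  proof -
    have "keys p \<subseteq> {0}" using polysD[OF p(1)] by (auto simp: keys_eq_empty)
    then have "p = single 0 (lookup p 0)"
      by (intro poly_mapping_eqI) (auto simp: lookup_single when_def in_keys_iff)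
    then show ?thesis using p(2) by (metis eval_mpoly_simps(1) monom_val_0 mult.right_neutral single_zero)
  qed
  then show ?thesis by (simp add: alg_independent_iff[OF A])
qed

lemma alg_independent_vars: "alg_independent base_field (vars n :: 'k::field mpoly list)"
  unfolding alg_independent_iff[OF base_field_subring]
proof (intro ballI impI)
  fix P :: "'k mpoly mpoly"
  assume P: "P \<in> polys base_field (length (vars n :: 'k mpoly list))" and 0: "eval_mpoly ((!) (vars n)) P = 0"
  have "\<forall>e\<in>keys P. \<exists>a. lookup P e = single 0 a" using polysD[OF P] by (auto simp: base_field_def)
  then obtain a where a: "\<And>e. e \<in> keys P \<Longrightarrow> lookup P e = single 0 (a e)" by metis
  have mv: "monom_val ((!) (vars n)) e = single e (1 :: 'k)" if "e \<in> keys P" for e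
    by (rule monom_val_vars) (use polysD[OF P that] in \<open>auto simp: subset_iff\<close>)
  have "eval_mpoly ((!) (vars n)) P = (\<Sum>e\<in>keys P. single e (a e))"
    unfolding eval_mpoly_monom_val by (rule sum.cong) (simp_all add: a mv mult_single)
  then have sum0: "(\<Sum>e\<in>keys P. single e (a e)) = 0" using 0 by simp
  have "a e = 0" if "e \<in> keys P" for e
  proof -
    have "lookup (\<Sum>e\<in>keys P. single e (a e)) e = (\<Sum>d\<in>keys P. if d = e then a d else 0)"
      by (simp add: lookup_sum lookup_single when_def)
    then show ?thesis using that sum0 by simp
  qed
  then show "P = 0" using a by (intro poly_mapping_eqI) (metis in_keys_iff lookup_zero single_zero)
qed

lemma hom_eval_upoly: "coeff_map.hom_eval y (upoly r f) = pcompose r (coeff_map.hom_eval y f)"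
  by (induction r) (simp_all add: coeff_map.hom_eval_add coeff_map.hom_eval_mult pcompose_pCons)

lemma upoly_eq_0:
  assumes "degree (coeff_map.hom_eval y f) > 0" "upoly r f = 0"
  shows "r = 0"
  using pcompose_eq_0[of r "coeff_map.hom_eval y f"] assms by (simp flip: hom_eval_upoly)

text \<open>
  The number \<open>n - 1\<close> of maps is the one that leaves transcendence degree 1 for the invariants.
\<close>

locale full_commuting_family = commuting_family "poly_ring n" "n - 1" \<delta>
  for n :: nat and \<delta> :: "nat \<Rightarrow> nat \<Rightarrow> 'k::field mpoly \<Rightarrow> 'k mpoly" +
  assumes n: "n \<ge> 1" and scalars: "i < n - 1 \<Longrightarrow> base_field \<subseteq> invariants (poly_ring n) (\<delta> i)"
begin

definition A where "A = common_invariants (poly_ring n) \<delta> {..<n - 1}"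

lemma A_eq_W: "A = W 0"
  by (simp add: A_def atLeast0LessThan)

lemma A_subring: "is_subring A"
  unfolding A_def by (rule common_invariants_subring) simp

lemma A_subset: "A \<subseteq> poly_ring n"
  by (auto simp: A_def common_invariants_def)

lemma base_field_A: "base_field \<subseteq> A"
  using scalars base_field_subset by (auto simp: A_def common_invariants_def)

lemma A_divide:
  assumes "b \<in> A" "b \<noteq> 0" "q \<in> poly_ring n" "q * b \<in> A"
  shows "q \<in> A"
proof -
  have "q \<in> invariants (poly_ring n) (\<delta> i)" if i: "i < n - 1" for i
  proof -
    interpret I: exp_map "poly_ring n" "\<delta> i" using exp i by blast
    show ?thesis
      using I.fixed_divide[of b q] assms i by (auto simp: A_def common_invariants_def mult.commute)
  qed
  then show ?thesis using assms(3) by (auto simp: A_def common_invariants_def)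
qed

text \<open>
  Otherwise the scalars would be the only denominators, and the \<open>n\<close> variables would lie in a ring
  generated by \<open>n - 1\<close> elements.
\<close>

lemma A_nonconstant: "\<exists>f\<in>A. f \<notin> base_field"
proof (rule ccontr)
  assume "\<not> ?thesis"
  then have A: "A = base_field" using base_field_A by blast
  obtain xs where xs: "length xs = n - 1"
    and gen: "\<And>b. b \<in> poly_ring n \<Longrightarrow> \<exists>c\<in>A - {0}. c * b \<in> adjoin A xs"
    using polynomial_structure unfolding A_eq_W[symmetric] by metis
  have "set (vars n) \<subseteq> adjoin base_field xs"
  proof
    fix v :: "'k mpoly" assume "v \<in> set (vars n)"
    then have "v \<in> poly_ring n" using vars_subset by (rule subsetD[rotated])
    then obtain c where c: "c \<in> base_field - {0}" "c * v \<in> adjoin base_field xs"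
      using gen[of v] unfolding A by blast
    then obtain a where "c = single 0 a" unfolding base_field_def by blast
    with c(1) have a: "c = single 0 a" "a \<noteq> 0" by auto
    have "single 0 (inverse a) \<in> adjoin base_field xs" by (rule adjoin_base) (simp add: base_field_def)
    then have "single 0 (inverse a) * (c * v) \<in> adjoin base_field xs"
      using c subring_mult[OF adjoin_subring[OF base_field_subring]] by blast
    moreover have "single 0 (inverse a) * (c * v) = v"
      using a by (simp add: mult_single flip: mult.assoc)
    ultimately show "v \<in> adjoin base_field xs" by simp
  qed
  then show False
    using alg_dependent_of_more_generators[of "vars n" xs] alg_independent_vars[where ?'k = 'k, of n]
      xs n by simp
qed

text \<open>
  Together with the \<open>n - 1\<close> slices, \<open>f\<close> and \<open>a\<close> are \<open>n + 1\<close> elements of a ring with \<open>n\<close> generators, so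
  \<open>a\<close> satisfies an equation over \<open>k[f]\<close>.  For \<open>a \<noteq> 0\<close> one of least degree has a nonzero constant
  term, and that term would be killed along with \<open>a\<close>; but \<open>f\<close> stays transcendental.
\<close>

lemma A_embeds:
  assumes f: "f \<in> A" "degree (coeff_map.hom_eval y f) > 0"
    and a: "a \<in> A" "coeff_map.hom_eval y a = 0"
  shows "a = 0"
proof (rule ccontr)
  assume "a \<noteq> 0"
  note k = base_field_subring[where ?'k = 'k]
  have f_indep: "alg_independent base_field ([] @ [f])"
  proof (rule alg_independent_append[OF k k order.refl])
    fix p assume p: "\<And>i. coeff p i \<in> base_field" "poly p f = 0"
    have p_eq: "p = map_poly (single 0) (map_poly (\<lambda>c. lookup c 0) p)"
    proof (rule poly_eqI)
      fix i
      obtain c where "coeff p i = single 0 c" using p(1)[of i] by (auto simp: base_field_def)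
      then show "coeff p i = coeff (map_poly (single 0) (map_poly (\<lambda>c. lookup c 0) p)) i"
        by (simp add: coeff_map_poly)
    qed
    then have "upoly (map_poly (\<lambda>c. lookup c 0) p) f = 0" using p(2) by (simp add: upoly_def)
    then show "p = 0" using upoly_eq_0[OF f(2)] p_eq by (metis map_poly_0)
  qed (auto simp: alg_independent_Nil k)
  obtain xs where xs: "length xs = n - 1" "set xs \<subseteq> poly_ring n"
    and indep: "\<And>zs. set zs \<subseteq> A \<Longrightarrow> alg_independent base_field zs \<Longrightarrow> alg_independent base_field (zs @ xs)"
    using polynomial_structure base_field_A k unfolding A_eq_W[symmetric] by metis
  have "\<not> alg_independent base_field ([f, a] @ xs)"
  proof (rule alg_dependent_of_more_generators[of _ "vars n"])
    show "length ([f, a] @ xs) = Suc (length (vars n :: 'k mpoly list))" using xs n by simp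
    show "set ([f, a] @ xs) \<subseteq> adjoin base_field (vars n)"
      using xs f(1) a(1) A_subset by (auto simp: poly_ring_eq_adjoin_vars[symmetric])
  qed
  then have dep: "\<not> alg_independent base_field ([f] @ [a])" using indep[of "[f, a]"] f(1) a(1) by auto
  let ?W = "adjoin base_field [f]"
  define rel where "rel p \<longleftrightarrow> (\<forall>i. coeff p i \<in> ?W) \<and> poly p a = 0 \<and> p \<noteq> 0" for p
  have "\<exists>p. rel p"
  proof (rule ccontr)
    assume no: "\<nexists>p. rel p"
    have "alg_independent base_field ([f] @ [a])"
    proof (rule alg_independent_append)
      show "is_subring ?W" using k by (rule adjoin_subring)
      show "base_field \<subseteq> ?W" by (auto intro: adjoin_base)
      show "set [f] \<subseteq> ?W" using k by (rule adjoin_gens)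
    qed (use k f_indep no in \<open>auto simp: rel_def\<close>)
    then show False using dep by simp
  qed
  then obtain p where p: "rel p" and least: "\<And>q. rel q \<Longrightarrow> degree p \<le> degree q"
    using ex_has_least_nat[of rel _ degree] by blast
  obtain c q where cq: "p = pCons c q" by (cases p)
  have coeffs: "c \<in> ?W" "coeff q i \<in> ?W" for i
    using p unfolding rel_def cq by (metis coeff_pCons_0) (metis coeff_pCons_Suc cq p rel_def)
  \<comment> \<open>Otherwise the equation could be divided by \<open>a\<close>.\<close>
  have "c \<noteq> 0"
  proof
    assume "c = 0"
    then have "poly q a = 0" "q \<noteq> 0" using p \<open>a \<noteq> 0\<close> by (auto simp: rel_def cq)
    then have "rel q" using coeffs by (simp add: rel_def)
    then show False using least \<open>q \<noteq> 0\<close> cq by fastforce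
  qed
  have "c + a * poly q a = 0" using p by (simp add: rel_def cq)
  then have "coeff_map.hom_eval y (c + a * poly q a) = 0" by simp
  then have "coeff_map.hom_eval y c = 0"
    by (simp add: coeff_map.hom_eval_add coeff_map.hom_eval_mult a(2))
  moreover obtain r where r: "c = upoly r f" using coeffs(1) by (auto simp: adjoin_one)
  ultimately have "r = 0" using pcompose_eq_0[of r] f(2) by (simp add: hom_eval_upoly)
  then show False using \<open>c \<noteq> 0\<close> r by simp
qed

text \<open>
  The image of \<open>A\<close> in \<open>k[t]\<close> inherits complete integral closedness: a quotient in \<open>B\<close> of two elements
  of \<open>A\<close> is itself in \<open>A\<close> by \<open>A_divide\<close>.
\<close>

lemma A_eq_adjoin_one: "\<exists>g\<in>A. A = adjoin base_field [g]"
proof -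
  note k = base_field_subring[where ?'k = 'k]
  note A = A_subring
  obtain f where f: "f \<in> A" "f \<notin> base_field" using A_nonconstant by blast
  obtain y where y: "degree (coeff_map.hom_eval y f) > 0"
    using kronecker_nonconstant f A_subset by blast
  define \<phi> where "\<phi> = coeff_map.hom_eval y"
  have \<phi>_add: "\<phi> (a + b) = \<phi> a + \<phi> b" and \<phi>_mult: "\<phi> (a * b) = \<phi> a * \<phi> b"
    and \<phi>_diff: "\<phi> (a - b) = \<phi> a - \<phi> b" and \<phi>_power: "\<phi> (a ^ m) = \<phi> a ^ m"
    and \<phi>_1: "\<phi> 1 = 1" for a b m
    by (simp_all add: \<phi>_def coeff_map.hom_eval_add coeff_map.hom_eval_mult coeff_map.hom_eval_diff
        coeff_map.hom_eval_power)
  have inj: "a = b" if "a \<in> A" "b \<in> A" "\<phi> a = \<phi> b" for a b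
    using A_embeds[OF f(1) y, of "a - b"] that subring_diff[OF A] by (simp add: \<phi>_def coeff_map.hom_eval_diff)
  have "\<exists>\<theta>\<in>\<phi> ` A. \<forall>h\<in>\<phi> ` A. \<exists>r. h = pcompose r \<theta>"
  proof (rule subring_of_univariate_polys)
    show "is_subring (\<phi> ` A)"
      unfolding is_subring_def
    proof (intro conjI ballI)
      show "1 \<in> \<phi> ` A" using subring_1[OF A] \<phi>_1 by (metis imageI)
      fix x z assume "x \<in> \<phi> ` A" "z \<in> \<phi> ` A"
      then show "x - z \<in> \<phi> ` A" "x * z \<in> \<phi> ` A"
        using subring_diff[OF A] subring_mult[OF A] by (auto simp flip: \<phi>_diff \<phi>_mult)
    qed
    show "[:c:] \<in> \<phi> ` A" for c
    proof -
      have "single 0 c \<in> A" using base_field_A by (auto simp: base_field_def)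
      moreover have "\<phi> (single 0 c) = [:c:]" by (simp add: \<phi>_def)
      ultimately show ?thesis by (metis imageI)
    qed
    show "\<phi> f \<in> \<phi> ` A" "degree (\<phi> f) > 0" using f y by (auto simp: \<phi>_def)
    fix u v w assume uvw: "u \<in> \<phi> ` A" "v \<in> \<phi> ` A" "w \<in> \<phi> ` A" "v \<noteq> 0" "w \<noteq> 0"
      and *: "\<forall>m. \<exists>q\<in>\<phi> ` A. w * u ^ m = q * v ^ m"
    obtain a b c where abc: "a \<in> A" "b \<in> A" "c \<in> A" "u = \<phi> a" "v = \<phi> b" "w = \<phi> c" using uvw by blast
    have nz: "b \<noteq> 0" "c \<noteq> 0" using uvw abc by (auto simp: \<phi>_def)
    have "\<exists>q\<in>poly_ring n. c * a ^ m = q * b ^ m" for m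
    proof -
      obtain q where q: "q \<in> A" "\<phi> (c * a ^ m) = \<phi> (q * b ^ m)"
        using * abc by (auto simp: \<phi>_mult \<phi>_power)
      then have "c * a ^ m = q * b ^ m"
        using abc by (intro inj) (auto intro!: subring_mult[OF A] subring_power[OF A])
      then show ?thesis using q(1) A_subset by blast
    qed
    then obtain q where q: "q \<in> poly_ring n" "a = q * b"
      using poly_ring_completely_integrally_closed[of b n c a] abc nz A_subset by blast
    then have "q \<in> A" using A_divide[OF abc(2) nz(1)] abc(1) by blast
    then show "\<exists>q\<in>\<phi> ` A. u = q * v" using abc q(2) by (auto simp: \<phi>_mult)
  qed
  then obtain g where g: "g \<in> A" and *: "\<And>h. h \<in> A \<Longrightarrow> \<exists>r. \<phi> h = pcompose r (\<phi> g)" by blast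
  have "A \<subseteq> adjoin base_field [g]"
  proof
    fix h assume h: "h \<in> A"
    obtain r where "\<phi> h = \<phi> (upoly r g)" using *[OF h] by (auto simp: \<phi>_def hom_eval_upoly)
    then have "h = upoly r g" using h upoly_subring[OF A base_field_A g] by (intro inj)
    then show "h \<in> adjoin base_field [g]" by (simp add: adjoin_one)
  qed
  moreover have "adjoin base_field [g] \<subseteq> A" using A base_field_A g by (intro adjoin_least) auto
  ultimately show ?thesis using g by blast
qed

lemma A_is_polynomial_ring: "is_polynomial_ring (localize A A) (localize (poly_ring n) A) (n - 1)"
proof -
  obtain xs where xs: "length xs = n - 1" "set xs \<subseteq> poly_ring n"
    and gen: "\<And>b. b \<in> poly_ring n \<Longrightarrow> \<exists>c\<in>A - {0}. c * b \<in> adjoin A xs"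
    and indep: "\<And>C zs. is_subring C \<Longrightarrow> C \<subseteq> A \<Longrightarrow> set zs \<subseteq> A \<Longrightarrow> alg_independent C zs \<Longrightarrow>
      alg_independent C (zs @ xs)"
    using polynomial_structure unfolding A_eq_W[symmetric] by metis
  have "alg_independent A xs"
    using indep[OF A_subring order.refl, of "[]"] alg_independent_Nil[OF A_subring] by simp
  then show ?thesis
    using is_polynomial_ring_localize[OF poly_ring_subring A_subring A_subset xs(2) gen] xs(1) by simp
qed

end

theorem WAS_imp_CE:
  assumes n: "n \<ge> 1" and WAS: "WAS TYPE('k::field) n"
  shows "CE TYPE('k) n"
  unfolding CE_def
proof (intro allI impI)
  fix \<delta> :: "nat \<Rightarrow> nat \<Rightarrow> 'k mpoly \<Rightarrow> 'k mpoly"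
  assume \<delta>: "irredundant_commuting base_field (poly_ring n) (n - 1) \<delta>"
  have exp: "is_exp_map base_field (poly_ring n) (\<delta> i)" if "i < n - 1" for i
    using \<delta> that by (simp add: irredundant_commuting_def)
  interpret full_commuting_family n \<delta>
  proof (intro full_commuting_family.intro commuting_family.intro full_commuting_family_axioms.intro)
    fix i assume i: "i < n - 1"
    show D: "exp_map (poly_ring n) (\<delta> i)"
      using is_exp_map_imp_exp_map[OF poly_ring_subring exp[OF i]] .
    interpret D: exp_map "poly_ring n" "\<delta> i" by (rule D)
    show "base_field \<subseteq> invariants (poly_ring n) (\<delta> i)"
    proof
      fix c :: "'k mpoly" assume c: "c \<in> base_field"
      have one: "1 \<in> (poly_ring n :: 'k mpoly set)" using poly_ring_subring by (rule subring_1)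
      have "\<delta> i j c = 0" if "j \<ge> 1" for j
      proof -
        have "\<delta> i j (c * 1) = c * \<delta> i j 1" using exp[OF i] c one unfolding is_exp_map_def by blast
        then show ?thesis using D.D_one[OF that] by simp
      qed
      then show "c \<in> invariants (poly_ring n) (\<delta> i)" using base_field_subset c by (intro D.fixedI) auto
    qed
  qed (use \<delta> n poly_ring_subring in \<open>auto simp: irredundant_commuting_def\<close>)
  obtain g where g: "g \<in> A" "A = adjoin base_field [g]" using A_eq_adjoin_one by blast
  have "g \<in> poly_ring n" using g(1) A_subset by (rule subsetD[rotated])
  then have "is_coordinate n g"
    using WAS A_is_polynomial_ring unfolding WAS_def g(2) by blast
  then show "\<exists>f. is_coordinate n f \<and>
      common_invariants (poly_ring n) \<delta> {..<n - 1} = adjoin base_field [f]"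
    unfolding A_def[symmetric] g(2) by blast
qed

section \<open>Hasse derivatives\<close>

text \<open>
  The coefficient of \<open>T\<^sup>m\<close> after the substitution \<open>X\<^sub>i \<mapsto> X\<^sub>i + T\<close>.  On coefficients it is a shift of
  exponents, which makes the composition and commutation rules identities of binomial coefficients.
\<close>

lift_definition hasse :: "nat \<Rightarrow> nat \<Rightarrow> 'a::comm_ring_1 mpoly \<Rightarrow> 'a mpoly" is
  "\<lambda>i m p e. of_nat ((Poly_Mapping.lookup e i + m) choose m) * p (e + Poly_Mapping.single i m)"
proof -
  fix i m :: nat and p :: "(nat \<Rightarrow>\<^sub>0 nat) \<Rightarrow> 'a"
  assume fin: "finite {e. p e \<noteq> 0}"
  have "{e. of_nat ((lookup e i + m) choose m) * p (e + single i m) \<noteq> 0}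
      \<subseteq> (\<lambda>e. e + single i m) -` {e. p e \<noteq> 0}"
    by auto
  moreover have "finite ((\<lambda>e. e + single i m) -` {e. p e \<noteq> 0})"
    by (rule finite_vimageI[OF fin]) (simp add: inj_def)
  ultimately show "finite {e. of_nat ((lookup e i + m) choose m) * p (e + single i m) \<noteq> 0}"
    by (rule finite_subset)
qed

lemma lookup_hasse:
  "lookup (hasse i m p) e = of_nat ((lookup e i + m) choose m) * lookup p (e + single i m)"
  by (simp add: hasse.rep_eq)

lemma lookup_const_mult: "lookup (single 0 c * p) e = c * lookup p e"
  by (simp add: mult_map_scale_conv_mult[symmetric] map.rep_eq when_def)

lemma hasse_add: "hasse i m (p + q) = hasse i m p + hasse i m q"
  by (rule poly_mapping_eqI) (simp add: lookup_hasse lookup_add distrib_left)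

lemma hasse_const_mult: "hasse i m (single 0 c * p) = single 0 c * hasse i m p"
  by (rule poly_mapping_eqI) (simp add: lookup_hasse lookup_const_mult mult.left_commute)

lemma hasse_0: "hasse i 0 p = p"
  by (rule poly_mapping_eqI) (simp add: lookup_hasse)

lemma hasse_comp: "hasse i b (hasse i a p) = of_nat ((a + b) choose b) * hasse i (a + b) p"
proof (rule poly_mapping_eqI)
  fix e :: "nat \<Rightarrow>\<^sub>0 nat"
  let ?x = "lookup e i"
  have "((?x + a + b) choose (a + b)) * ((a + b) choose a) = ((?x + a + b) choose a) * ((?x + b) choose b)"
    using choose_mult[of a "a + b" "?x + a + b"] by simp
  moreover have "(a + b) choose a = (a + b) choose b"
    using binomial_symmetric[of a "a + b"] by simp
  ultimately have *: "((?x + b) choose b) * ((?x + b + a) choose a)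
      = ((a + b) choose b) * ((?x + (a + b)) choose (a + b))"
    by (simp add: ac_simps)
  have "lookup (hasse i b (hasse i a p)) e
      = of_nat (((?x + b) choose b) * ((?x + b + a) choose a)) * lookup p (e + single i b + single i a)"
    by (simp add: lookup_hasse lookup_add mult.assoc)
  also have "\<dots> = of_nat ((a + b) choose b) * lookup (hasse i (a + b) p) e"
    unfolding * by (simp add: lookup_hasse mult.assoc add.assoc flip: single_add) (simp add: add.commute)
  also have "\<dots> = lookup (of_nat ((a + b) choose b) * hasse i (a + b) p) e"
    using lookup_const_mult[of "of_nat ((a + b) choose b)" "hasse i (a + b) p" e] by simp
  finally show "lookup (hasse i b (hasse i a p)) e
      = lookup (of_nat ((a + b) choose b) * hasse i (a + b) p) e" .
qed

lemma hasse_commute: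
  assumes "i \<noteq> j"
  shows "hasse i a (hasse j b p) = hasse j b (hasse i a p)"
  by (rule poly_mapping_eqI)
    (use assms in \<open>simp add: lookup_hasse lookup_add lookup_single_not_eq mult_ac add_ac\<close>)

lemma hasse_single: "hasse i m (single e c) = single (e - single i m) (of_nat (lookup e i choose m) * c)"
proof (rule poly_mapping_eqI)
  fix d
  show "lookup (hasse i m (single e c)) d = lookup (single (e - single i m) (of_nat (lookup e i choose m) * c)) d"
  proof (cases "m \<le> lookup e i")
    case True
    then have "e = (e - single i m) + single i m"
      by (intro poly_mapping_eqI) (auto simp: lookup_add lookup_minus_nat lookup_single when_def)
    then have "e = d + single i m \<longleftrightarrow> e - single i m = d" by (metis add_right_cancel)
    then show ?thesis using True by (auto simp: lookup_hasse lookup_single when_def lookup_minus_nat)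
  next
    case False
    then have "e \<noteq> d + single i m" by (auto simp: lookup_add)
    then show ?thesis using False by (simp add: lookup_hasse lookup_single binomial_eq_0)
  qed
qed

lemma single_sum: "single k (sum g I) = (\<Sum>i\<in>I. single k (g i))"
  by (induction I rule: infinite_finite_induct) (simp_all add: single_add)

text \<open>
  On monomials this is Vandermonde's identity.
\<close>

lemma hasse_mult: "hasse i m (p * q) = (\<Sum>a=0..m. hasse i a p * hasse i (m - a) q)"
proof (induction p rule: mpoly_induct)
  case (single d c)
  show ?case
  proof (induction q rule: mpoly_induct)
    case (single e c')
    let ?r = "d + e - single i m"
    have "hasse i a (single d c) * hasse i (m - a) (single e c')
        = single ?r (of_nat ((lookup d i choose a) * (lookup e i choose (m - a))) * (c * c'))"
      if "a \<in> {0..m}" for a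
    proof (cases "a \<le> lookup d i \<and> m - a \<le> lookup e i")
      case True
      then have "(d - single i a) + (e - single i (m - a)) = ?r"
        using that by (intro poly_mapping_eqI) (auto simp: lookup_add lookup_minus_nat lookup_single when_def)
      then show ?thesis by (simp add: hasse_single mult_single mult_ac)
    next
      case False
      then show ?thesis by (auto simp: hasse_single mult_single binomial_eq_0 not_le)
    qed
    then have "(\<Sum>a=0..m. hasse i a (single d c) * hasse i (m - a) (single e c'))
        = (\<Sum>a=0..m. single ?r (of_nat ((lookup d i choose a) * (lookup e i choose (m - a))) * (c * c')))"
      by (rule sum.cong[OF refl])
    also have "\<dots> = single ?r (of_nat (\<Sum>a=0..m. (lookup d i choose a) * (lookup e i choose (m - a))) * (c * c'))"
      by (simp add: single_sum sum_distrib_right)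
    also have "(\<Sum>a=0..m. (lookup d i choose a) * (lookup e i choose (m - a))) = (lookup d i + lookup e i) choose m"
      by (simp add: vandermonde[symmetric] atMost_atLeast0)
    finally show ?case by (simp add: mult_single hasse_single lookup_add)
  next
    case (add q q')
    then show ?case by (simp add: distrib_left hasse_add sum.distrib)
  qed
next
  case (add p p')
  then show ?case by (simp add: distrib_right hasse_add sum.distrib)
qed

lemma hasse_polys:
  assumes K: "is_subring K" and p: "p \<in> polys K n"
  shows "hasse i m p \<in> polys K n"
proof (rule polysI)
  fix e assume "e \<in> keys (hasse i m p)"
  then have e: "e + single i m \<in> keys p" by (auto simp: in_keys_iff lookup_hasse)
  have "keys e \<subseteq> keys (e + single i m)" by (auto simp: in_keys_iff lookup_add)
  then show "lookup (hasse i m p) e \<in> K \<and> keys e \<subseteq> {..<n}"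
    using polysD[OF p e] subring_mult[OF K subring_of_nat[OF K]] by (auto simp: lookup_hasse)
qed

lemma hasse_eventually_0: "\<exists>M. \<forall>m>M. hasse i m p = 0"
proof (intro exI allI impI)
  fix m assume m: "m > (\<Sum>e\<in>keys p. lookup e i)"
  have "e + single i m \<notin> keys p" for e
  proof
    assume "e + single i m \<in> keys p"
    then have "lookup (e + single i m) i \<le> (\<Sum>e\<in>keys p. lookup e i)" by (intro member_le_sum) auto
    then show False using m by (simp add: lookup_add)
  qed
  then show "hasse i m p = 0" by (intro poly_mapping_eqI) (simp add: lookup_hasse in_keys_iff)
qed

lemma hasse_all_0_iff: "(\<forall>m\<ge>1. hasse i m p = 0) \<longleftrightarrow> (\<forall>e\<in>keys p. lookup e i = 0)"
proof (intro iffI ballI allI impI)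
  fix e assume 0: "\<forall>m\<ge>1. hasse i m p = 0" and e: "e \<in> keys p"
  show "lookup e i = 0"
  proof (rule ccontr)
    assume nz: "lookup e i \<noteq> 0"
    define d where "d = e - single i (lookup e i)"
    have d: "d + single i (lookup e i) = e" "lookup d i = 0"
      unfolding d_def by (auto intro!: poly_mapping_eqI simp: lookup_add lookup_minus_nat lookup_single when_def)
    then have "lookup (hasse i (lookup e i) p) d = lookup p e" by (simp add: lookup_hasse)
    then show False using 0 nz e by (simp add: in_keys_iff)
  qed
next
  fix m :: nat assume 0: "\<forall>e\<in>keys p. lookup e i = 0" and m: "m \<ge> 1"
  have "e + single i m \<notin> keys p" for e
  proof
    assume "e + single i m \<in> keys p"
    then have "lookup (e + single i m) i = 0" using 0 by blast
    then show False using m by (simp add: lookup_add)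
  qed
  then show "hasse i m p = 0" by (intro poly_mapping_eqI) (simp add: lookup_hasse in_keys_iff)
qed

text \<open>
  The coefficient of \<open>T\<^sup>m\<close> after \<open>X\<^sub>i \<mapsto> X\<^sub>i + c T\<close>.
\<close>

definition scaled_hasse :: "'a::comm_ring_1 \<Rightarrow> nat \<Rightarrow> nat \<Rightarrow> 'a mpoly \<Rightarrow> 'a mpoly" where
  "scaled_hasse c i m p = single 0 (c ^ m) * hasse i m p"

lemma exp_map_scaled_hasse:
  fixes K :: "'a::idom set"
  assumes K: "is_subring K" and c: "c \<in> K"
  shows "exp_map (polys K n) (scaled_hasse c i)"
proof
  note R = polys_subring[OF K, of n]
  show "is_subring (polys K n)" by (rule R)
  show "scaled_hasse c i m p \<in> polys K n" if "p \<in> polys K n" for m p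
    unfolding scaled_hasse_def
    by (intro subring_mult[OF R] polys_single subring_power[OF K] c hasse_polys[OF K] that) simp
  show "scaled_hasse c i m (p + q) = scaled_hasse c i m p + scaled_hasse c i m q" for m p q
    by (simp add: scaled_hasse_def hasse_add distrib_left)
  show "scaled_hasse c i 0 p = p" for p by (simp add: scaled_hasse_def hasse_0)
  show "\<exists>m>0. \<forall>j\<ge>m. scaled_hasse c i j p = 0" for p
  proof -
    obtain M where "\<forall>m>M. hasse i m p = 0" using hasse_eventually_0 by blast
    then show ?thesis by (intro exI[of _ "Suc M"]) (auto simp: scaled_hasse_def)
  qed
  show "scaled_hasse c i m (p * q) = (\<Sum>a = 0..m. scaled_hasse c i a p * scaled_hasse c i (m - a) q)" for m p q
    unfolding scaled_hasse_def hasse_mult sum_distrib_left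
  proof (rule sum.cong[OF refl])
    fix a assume "a \<in> {0..m}"
    then have "c ^ m = c ^ a * c ^ (m - a)" by (simp flip: power_add)
    then have "single 0 (c ^ m) = single 0 (c ^ a) * (single 0 (c ^ (m - a)) :: 'a mpoly)"
      by (simp add: mult_single)
    then show "single 0 (c ^ m) * (hasse i a p * hasse i (m - a) q)
        = single 0 (c ^ a) * hasse i a p * (single 0 (c ^ (m - a)) * hasse i (m - a) q)"
      by (simp add: mult_ac)
  qed
  show "scaled_hasse c i b (scaled_hasse c i a p) = of_nat ((a + b) choose b) * scaled_hasse c i (a + b) p" for a b p
  proof -
    have "single 0 (c ^ (a + b)) = single 0 (c ^ b) * (single 0 (c ^ a) :: 'a mpoly)"
      by (simp add: mult_single power_add mult.commute)
    moreover have "scaled_hasse c i b (scaled_hasse c i a p)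
        = single 0 (c ^ b) * (single 0 (c ^ a) * hasse i b (hasse i a p))"
      by (simp add: scaled_hasse_def hasse_const_mult)
    ultimately show ?thesis by (simp add: scaled_hasse_def hasse_comp mult_ac)
  qed
qed

section \<open>Pulling back exponential maps\<close>

text \<open>
  An exponential map is transported to \<open>B\<close> along an embedding whose image it preserves.
\<close>

locale pullback = E: exp_map R E for R :: "'b::idom set" and E +
  fixes B :: "'a::idom set" and \<psi> :: "'a \<Rightarrow> 'b"
  assumes B: "is_subring B" and \<psi>_R: "x \<in> B \<Longrightarrow> \<psi> x \<in> R" and inj: "inj_on \<psi> B" and \<psi>_1: "\<psi> 1 = 1"
    and \<psi>_add: "x \<in> B \<Longrightarrow> y \<in> B \<Longrightarrow> \<psi> (x + y) = \<psi> x + \<psi> y"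
    and \<psi>_mult: "x \<in> B \<Longrightarrow> y \<in> B \<Longrightarrow> \<psi> (x * y) = \<psi> x * \<psi> y"
    and stable: "x \<in> B \<Longrightarrow> E m (\<psi> x) \<in> \<psi> ` B"
begin

definition D :: "nat \<Rightarrow> 'a \<Rightarrow> 'a" where "D m x = the_inv_into B \<psi> (E m (\<psi> x))"

lemma \<psi>_D: "x \<in> B \<Longrightarrow> \<psi> (D m x) = E m (\<psi> x)"
  unfolding D_def using stable inj by (simp add: f_the_inv_into_f)

lemma D_B: "x \<in> B \<Longrightarrow> D m x \<in> B"
  unfolding D_def using stable inj by (meson order.refl the_inv_into_into)

lemma eqI: "x \<in> B \<Longrightarrow> y \<in> B \<Longrightarrow> \<psi> x = \<psi> y \<Longrightarrow> x = y"
  using inj by (rule inj_onD)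

lemma \<psi>_0: "\<psi> 0 = 0"
proof -
  have "\<psi> 0 = \<psi> 0 + \<psi> 0" using \<psi>_add[of 0 0] subring_0[OF B] by (simp only: add_0_left)
  then show ?thesis by (rule add_cancel_right_right[THEN iffD1])
qed

lemma \<psi>_sum: "(\<And>i. i \<in> I \<Longrightarrow> g i \<in> B) \<Longrightarrow> \<psi> (sum g I) = (\<Sum>i\<in>I. \<psi> (g i))"
  by (induction I rule: infinite_finite_induct) (auto simp: \<psi>_0 \<psi>_add subring_sum[OF B])

lemma \<psi>_of_nat: "\<psi> (of_nat k) = of_nat k"
  by (induction k) (simp_all add: \<psi>_0 \<psi>_1 \<psi>_add subring_of_nat[OF B] subring_1[OF B])

lemma is_exp_map_pullback:
  assumes K: "K \<subseteq> B" and linear: "\<And>c m z. c \<in> K \<Longrightarrow> z \<in> R \<Longrightarrow> E m (\<psi> c * z) = \<psi> c * E m z"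
  shows "is_exp_map K B D"
  unfolding is_exp_map_def
proof (intro conjI allI ballI)
  note closed = D_B subring_add[OF B] subring_mult[OF B] subring_sum[OF B] subring_of_nat[OF B]
  fix x assume x: "x \<in> B"
  show "D m x \<in> B" for m using x by (rule D_B)
  show "D 0 x = x" by (rule eqI) (simp_all add: \<psi>_D closed x E.D_0 \<psi>_R)
  show "D m (c * x) = c * D m x" if "c \<in> K" for c m
  proof (rule eqI)
    have "c \<in> B" using that K by blast
    then show "D m (c * x) \<in> B" "c * D m x \<in> B" "\<psi> (D m (c * x)) = \<psi> (c * D m x)"
      using linear[OF that \<psi>_R[OF x]] by (simp_all add: \<psi>_D closed x \<psi>_mult)
  qed
  obtain m where m: "m > 0" "\<And>i. i \<ge> m \<Longrightarrow> E i (\<psi> x) = 0" using E.D_fin[OF \<psi>_R[OF x]] by blast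
  have "D i x = 0" if "i \<ge> m" for i
    by (rule eqI) (simp_all add: \<psi>_D closed x m that \<psi>_0 subring_0[OF B])
  then show "\<exists>m>0. \<forall>i\<ge>m. D i x = 0" using m(1) by blast
  show "D j (D i x) = of_nat ((i + j) choose j) * D (i + j) x" for i j
    by (rule eqI) (simp_all add: \<psi>_D closed x \<psi>_mult \<psi>_of_nat E.D_comp \<psi>_R)
  fix y assume y: "y \<in> B"
  show "D m (x + y) = D m x + D m y" for m
    by (rule eqI) (simp_all add: \<psi>_D closed x y \<psi>_add E.D_add \<psi>_R)
  show "D m (x * y) = (\<Sum>i = 0..m. D i x * D (m - i) y)" for m
    by (rule eqI) (simp_all add: \<psi>_D closed x y \<psi>_mult \<psi>_sum E.D_mult \<psi>_R)
qed

lemma invariants_pullback: "invariants B D = {x \<in> B. \<forall>i\<ge>1. E i (\<psi> x) = 0}"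
proof -
  have "D i x = 0 \<longleftrightarrow> E i (\<psi> x) = 0" if "x \<in> B" for i x
    using eqI[of "D i x" 0] \<psi>_D[OF that, of i] D_B[OF that] subring_0[OF B] \<psi>_0 by auto
  then show ?thesis by (auto simp: invariants_def)
qed

end

section \<open>From generic polynomial structure to commuting families\<close>

text \<open>
  The hypothesis of \<open>WAS\<close>, with a chosen system \<open>ys\<close> of variables over \<open>K = k(f)\<close>.
\<close>

locale generic_polynomial_structure =
  fixes n :: nat and f :: "'k::field mpoly" and S :: "'k mpoly set"
    and K :: "'k mpoly fract set" and ys :: "'k mpoly fract list"
  assumes n: "n \<ge> 1" and f: "f \<in> poly_ring n"
    and S: "S = adjoin base_field [f]" and K: "K = localize S S"
    and len: "length ys = n - 1" and indep: "alg_independent K ys"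
    and gen: "localize (poly_ring n) S = adjoin K ys"
begin

lemma S_subring: "is_subring S"
  unfolding S by (rule adjoin_subring[OF base_field_subring])

lemma f_in_S: "f \<in> S"
  using adjoin_gens[OF base_field_subring, of "[f]"] by (simp add: S)

lemma S_subset: "S \<subseteq> poly_ring n"
  unfolding S by (intro adjoin_least poly_ring_subring base_field_subset) (use f in auto)

lemma base_field_S: "base_field \<subseteq> S"
  unfolding S by (auto intro: adjoin_base)

lemma K_subring: "is_subring K"
  unfolding K by (intro localize_subring S_subring order.refl)

lemma to_fract_K: "c \<in> S \<Longrightarrow> to_fract c \<in> K"
  unfolding K by (rule to_fract_in_localize[OF S_subring])

abbreviation R where "R \<equiv> polys K (n - 1)"

abbreviation ev where "ev \<equiv> eval_mpoly ((!) ys)"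

lemma R_subring: "is_subring R"
  using K_subring by (rule polys_subring)

lemma ev_inj: "P \<in> R \<Longrightarrow> Q \<in> R \<Longrightarrow> ev P = ev Q \<Longrightarrow> P = Q"
  using indep by (auto simp: alg_independent_def len dest: inj_onD)

lemma ev_image: "ev ` R = localize (poly_ring n) S"
  by (simp add: gen adjoin_def len)

text \<open>
  The expression of an element of \<open>B\<close> as a polynomial in \<open>ys\<close> over \<open>K\<close>.
\<close>

definition \<psi> :: "'k mpoly \<Rightarrow> 'k mpoly fract mpoly" where
  "\<psi> b = the_inv_into R ev (to_fract b)"

lemma
  assumes "b \<in> poly_ring n"
  shows \<psi>_R: "\<psi> b \<in> R" and ev_\<psi>: "ev (\<psi> b) = to_fract b"
proof -
  have "to_fract b \<in> ev ` R" unfolding ev_image using assms by (rule to_fract_in_localize[OF S_subring])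
  moreover have "inj_on ev R" using ev_inj by (auto simp: inj_on_def)
  ultimately show "\<psi> b \<in> R" "ev (\<psi> b) = to_fract b"
    unfolding \<psi>_def by (auto intro: the_inv_into_into f_the_inv_into_f simp: the_inv_into_into[where B = R])
qed

lemma \<psi>_eqI: "b \<in> poly_ring n \<Longrightarrow> P \<in> R \<Longrightarrow> ev P = to_fract b \<Longrightarrow> \<psi> b = P"
  using ev_inj ev_\<psi> \<psi>_R by metis

lemma \<psi>_add: "a \<in> poly_ring n \<Longrightarrow> b \<in> poly_ring n \<Longrightarrow> \<psi> (a + b) = \<psi> a + \<psi> b"
  by (rule \<psi>_eqI)
    (simp_all add: \<psi>_R ev_\<psi> eval_mpoly_add subring_add[OF poly_ring_subring] subring_add[OF R_subring] del: One_nat_def)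

lemma \<psi>_mult: "a \<in> poly_ring n \<Longrightarrow> b \<in> poly_ring n \<Longrightarrow> \<psi> (a * b) = \<psi> a * \<psi> b"
  by (rule \<psi>_eqI)
    (simp_all add: \<psi>_R ev_\<psi> eval_mpoly_mult subring_mult[OF poly_ring_subring] subring_mult[OF R_subring] del: One_nat_def)

lemma \<psi>_S: "c \<in> S \<Longrightarrow> \<psi> c = single 0 (to_fract c)"
  using S_subset by (intro \<psi>_eqI) (auto intro: polys_single to_fract_K)

lemma \<psi>_1: "\<psi> 1 = 1"
  using \<psi>_S[OF subring_1[OF S_subring]] by simp

lemma \<psi>_inj: "inj_on \<psi> (poly_ring n)"
  using ev_\<psi> by (metis inj_onI to_fract_eq_iff)

lemma \<psi>_uminus: "a \<in> poly_ring n \<Longrightarrow> \<psi> (- a) = - \<psi> a"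
  by (rule \<psi>_eqI)
    (simp_all add: \<psi>_R ev_\<psi> eval_mpoly_uminus subring_uminus[OF poly_ring_subring] subring_uminus[OF R_subring] del: One_nat_def)

lemma \<psi>_image_subring: "is_subring (\<psi> ` poly_ring n)"
proof (rule is_subringI)
  note B = poly_ring_subring[where ?'a = 'k, of n]
  show "1 \<in> \<psi> ` poly_ring n" using \<psi>_1 subring_1[OF B] by (metis imageI)
  show "- x \<in> \<psi> ` poly_ring n" if "x \<in> \<psi> ` poly_ring n" for x
    using that subring_uminus[OF B] by (auto simp flip: \<psi>_uminus)
  show "x + y \<in> \<psi> ` poly_ring n" "x * y \<in> \<psi> ` poly_ring n"
    if "x \<in> \<psi> ` poly_ring n" "y \<in> \<psi> ` poly_ring n" for x y
    using that subring_add[OF B] subring_mult[OF B] by (auto simp flip: \<psi>_add \<psi>_mult)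
qed

text \<open>
  Only finitely many Hasse derivatives of the finitely many variables are nonzero, so they have a
  common denominator.  The product rule then extends this to all of \<open>B\<close> in \<open>E_stable\<close>.
\<close>

lemma exists_scaling:
  "\<exists>s\<in>S - {0}. \<forall>i<n - 1. \<forall>j<n. \<forall>l\<ge>1. \<exists>r\<in>poly_ring n.
     to_fract s * ev (hasse i l (\<psi> (var j))) = to_fract r"
proof -
  have "\<exists>M. \<forall>m>M. hasse i m (\<psi> (var j)) = 0" for i j by (rule hasse_eventually_0)
  then obtain M where M: "\<And>i j m. m > M i j \<Longrightarrow> hasse i m (\<psi> (var j)) = 0" by metis
  define F where "F = (\<Union>i<n - 1. \<Union>j<n. (\<lambda>l. ev (hasse i l (\<psi> (var j)))) ` {..M i j})"
  have var: "var j \<in> poly_ring n" if "j < n" for j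
    unfolding poly_ring_def by (rule polys_var) (simp_all add: is_subring_def that)
  have "F \<subseteq> localize (poly_ring n) S"
    unfolding ev_image[symmetric] F_def using \<psi>_R[OF var] by (auto intro!: imageI hasse_polys[OF K_subring])
  moreover have "finite F" by (simp add: F_def)
  ultimately obtain s where s: "s \<in> S - {0}" "\<And>z. z \<in> F \<Longrightarrow> \<exists>r\<in>poly_ring n. to_fract s * z = to_fract r"
    using common_denominator[of F "poly_ring n" S] poly_ring_subring S_subring S_subset by metis
  have "\<exists>r\<in>poly_ring n. to_fract s * ev (hasse i l (\<psi> (var j))) = to_fract r" if "i < n - 1" "j < n" for i j l
  proof (cases "l \<le> M i j")
    case True
    then show ?thesis using that s(2) unfolding F_def by blast
  next
    case False
    then show ?thesis using M[of i j l] subring_0[OF poly_ring_subring] by (intro bexI[of _ 0]) auto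
  qed
  then show ?thesis using s(1) by blast
qed

definition s where "s = (SOME s. s \<in> S - {0} \<and> (\<forall>i<n - 1. \<forall>j<n. \<forall>l\<ge>1. \<exists>r\<in>poly_ring n.
     to_fract s * ev (hasse i l (\<psi> (var j))) = to_fract r))"

lemma s: "s \<in> S" "s \<noteq> 0"
  and s_var: "i < n - 1 \<Longrightarrow> j < n \<Longrightarrow> l \<ge> 1 \<Longrightarrow> \<exists>r\<in>poly_ring n.
     to_fract s * ev (hasse i l (\<psi> (var j))) = to_fract r"
proof -
  have "s \<in> S - {0} \<and> (\<forall>i<n - 1. \<forall>j<n. \<forall>l\<ge>1. \<exists>r\<in>poly_ring n.
     to_fract s * ev (hasse i l (\<psi> (var j))) = to_fract r)"
    unfolding s_def by (rule someI_ex) (use exists_scaling in blast)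
  then show "s \<in> S" "s \<noteq> 0" "i < n - 1 \<Longrightarrow> j < n \<Longrightarrow> l \<ge> 1 \<Longrightarrow> \<exists>r\<in>poly_ring n.
     to_fract s * ev (hasse i l (\<psi> (var j))) = to_fract r"
    by blast+
qed

abbreviation E where "E \<equiv> scaled_hasse (to_fract s)"

lemma exp_map_E: "exp_map R (E i)"
  by (rule exp_map_scaled_hasse[OF K_subring to_fract_K[OF s(1)]])

lemma E_eq_0_iff: "E i l p = 0 \<longleftrightarrow> hasse i l p = 0"
proof -
  have "to_fract s \<noteq> 0" using s(2) by (metis to_fract_0 to_fract_eq_iff)
  then have "to_fract s ^ l \<noteq> 0" by simp
  then have "single 0 (to_fract s ^ l) \<noteq> (0 :: 'k mpoly fract mpoly)"
    by (metis lookup_single_eq lookup_zero)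
  then show ?thesis by (simp add: scaled_hasse_def)
qed

lemma E_linear: "E i l (single 0 c * p) = single 0 c * E i l p"
  by (simp add: scaled_hasse_def hasse_const_mult mult.left_commute)

lemma E_commute:
  assumes "i \<noteq> j"
  shows "E i a (E j b p) = E j b (E i a p)"
proof -
  have expand: "E i a (E j b p)
      = single 0 (to_fract s ^ a) * (single 0 (to_fract s ^ b) * hasse i a (hasse j b p))" for i j a b
    by (simp only: scaled_hasse_def hasse_const_mult)
  show ?thesis unfolding expand hasse_commute[OF assms] by (rule mult.left_commute)
qed

lemma E_const:
  assumes "l \<ge> 1"
  shows "E i l (single 0 c) = 0"
proof -
  have "\<forall>e\<in>keys (single 0 c). lookup e i = 0" by (auto split: if_splits)
  then show ?thesis unfolding E_eq_0_iff using hasse_all_0_iff[of i "single 0 c"] assms by blast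
qed

text \<open>
  The elements \<open>b\<close> with this property form a subring, since the product rule distributes \<open>s\<^sup>l\<close> over the
  two factors.  It contains the scalars and, by the choice of \<open>s\<close>, the variables.
\<close>

lemma E_stable:
  assumes i: "i < n - 1" and b: "b \<in> poly_ring n"
  shows "E i l (\<psi> b) \<in> \<psi> ` poly_ring n"
proof -
  interpret E: exp_map R "E i" by (rule exp_map_E)
  note B = poly_ring_subring[where ?'a = 'k, of n]
  note I = \<psi>_image_subring
  define T where "T = {b \<in> poly_ring n. \<forall>l. E i l (\<psi> b) \<in> \<psi> ` poly_ring n}"
  have "poly_ring n \<subseteq> T"
  proof (rule poly_ring_least)
    have const: "c \<in> T" if c: "c \<in> base_field" for c
    proof -
      have cS: "c \<in> S" using base_field_S c by blast
      then have cB: "c \<in> poly_ring n" using S_subset by blast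
      have "E i l (\<psi> c) \<in> \<psi> ` poly_ring n" for l
      proof (cases "l = 0")
        case True
        then show ?thesis using E.D_0[OF \<psi>_R[OF cB]] cB by simp
      next
        case False
        then show ?thesis using subring_0[OF I] by (simp add: \<psi>_S[OF cS] E_const)
      qed
      then show ?thesis using cB by (simp add: T_def)
    qed
    then show "base_field \<subseteq> T" by blast
    show "is_subring T"
    proof (rule is_subringI)
      show "1 \<in> T" using const subring_1[OF base_field_subring] by blast
      fix x assume x: "x \<in> T"
      then have xB: "x \<in> poly_ring n" by (simp add: T_def)
      show "- x \<in> T"
        using x subring_uminus[OF I] subring_uminus[OF B]
        by (simp add: T_def \<psi>_uminus[OF xB] E.D_uminus[OF \<psi>_R[OF xB]])
      fix y assume y: "y \<in> T"
      then have yB: "y \<in> poly_ring n" by (simp add: T_def)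
      show "x + y \<in> T"
        using x y subring_add[OF I] subring_add[OF B]
        by (simp add: T_def \<psi>_add[OF xB yB] E.D_add[OF \<psi>_R[OF xB] \<psi>_R[OF yB]])
      have "E i l (\<psi> (x * y)) \<in> \<psi> ` poly_ring n" for l
        unfolding \<psi>_mult[OF xB yB] E.D_mult[OF \<psi>_R[OF xB] \<psi>_R[OF yB]]
        by (intro subring_sum[OF I] subring_mult[OF I]) (use x y in \<open>auto simp: T_def\<close>)
      then show "x * y \<in> T" using subring_mult[OF B xB yB] by (simp add: T_def)
    qed
    show "set (vars n) \<subseteq> T"
    proof
      fix v :: "'k mpoly" assume v: "v \<in> set (vars n)"
      then obtain j where j: "j < n" "v = var j" by (auto simp: vars_def)
      have vB: "v \<in> poly_ring n" using v vars_subset by blast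
      have "E i l (\<psi> v) \<in> \<psi> ` poly_ring n" for l
      proof (cases l)
        case 0
        then show ?thesis using E.D_0[OF \<psi>_R[OF vB]] vB by simp
      next
        case (Suc l')
        obtain r where r: "r \<in> poly_ring n" "to_fract s * ev (hasse i l (\<psi> v)) = to_fract r"
          using s_var[OF i j(1), of l] Suc j(2) by auto
        have sB: "s ^ l' * r \<in> poly_ring n"
          using s(1) S_subset r(1) by (intro subring_mult[OF B] subring_power[OF B]) auto
        have "ev (E i l (\<psi> v)) = to_fract s ^ l' * (to_fract s * ev (hasse i l (\<psi> v)))"
          by (simp add: scaled_hasse_def eval_mpoly_mult Suc mult_ac)
        also have "\<dots> = to_fract (s ^ l' * r)" by (simp add: r(2) fract_map.h_power)
        finally have "\<psi> (s ^ l' * r) = E i l (\<psi> v)"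
          by (intro \<psi>_eqI sB E.D_closed \<psi>_R vB)
        then show ?thesis using sB by (metis imageI)
      qed
      then show "v \<in> T" using vB by (simp add: T_def)
    qed
  qed
  then show ?thesis using b by (auto simp: T_def)
qed

definition \<delta> :: "nat \<Rightarrow> nat \<Rightarrow> 'k mpoly \<Rightarrow> 'k mpoly" where
  "\<delta> i = pullback.D (E i) (poly_ring n) \<psi>"

lemma pullback_E: "i < n - 1 \<Longrightarrow> pullback R (E i) (poly_ring n) \<psi>"
  by (intro pullback.intro pullback_axioms.intro exp_map_E poly_ring_subring \<psi>_R \<psi>_inj \<psi>_1 \<psi>_add
      \<psi>_mult E_stable)

lemma invariants_\<delta>:
  assumes "i < n - 1"
  shows "invariants (poly_ring n) (\<delta> i) = {b \<in> poly_ring n. \<forall>e\<in>keys (\<psi> b). lookup e i = 0}"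
  unfolding \<delta>_def pullback.invariants_pullback[OF pullback_E[OF assms]] E_eq_0_iff hasse_all_0_iff ..

text \<open>
  A multiple of the \<open>i\<close>-th variable by a denominator: it is moved by \<open>\<delta> i\<close> and by no other map of the
  family, which gives irredundancy.
\<close>

lemma exists_slice_element:
  assumes i: "i < n - 1"
  shows "\<exists>r\<in>poly_ring n. keys (\<psi> r) = {single i 1}"
proof -
  have "ys ! i \<in> localize (poly_ring n) S"
    unfolding gen using i len by (intro adjoin_gen K_subring) simp
  then obtain r t where r: "r \<in> poly_ring n" "t \<in> S - {0}" "to_fract t * ys ! i = to_fract r"
    by (auto simp: localize_iff)
  have "\<psi> r = single (single i 1) (to_fract t)"
    using r i by (intro \<psi>_eqI polys_single to_fract_K) auto
  moreover have "to_fract t \<noteq> 0" using r(2) by (metis Diff_iff insertI1 to_fract_0 to_fract_eq_iff)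
  ultimately show ?thesis using r(1) by (intro bexI[of _ r]) simp_all
qed

lemma irredundant_commuting_\<delta>: "irredundant_commuting base_field (poly_ring n) (n - 1) \<delta>"
  unfolding irredundant_commuting_def
proof (intro conjI allI impI)
  fix i assume i: "i < n - 1"
  interpret P: pullback R "E i" "poly_ring n" \<psi> by (rule pullback_E[OF i])
  have \<delta>i: "\<delta> i = P.D" by (simp add: \<delta>_def)
  show "is_exp_map base_field (poly_ring n) (\<delta> i)"
    unfolding \<delta>i
    by (rule P.is_exp_map_pullback[OF base_field_subset]) (use base_field_S in \<open>auto simp: \<psi>_S E_linear\<close>)
  obtain r where r: "r \<in> poly_ring n" "keys (\<psi> r) = {single i 1}" using exists_slice_element[OF i] by blast
  have not: "r \<notin> invariants (poly_ring n) (\<delta> i)" by (simp add: invariants_\<delta>[OF i] r)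
  then show "nontrivial_exp_map (poly_ring n) (\<delta> i)" using r(1) by (auto simp: nontrivial_exp_map_def)
  have "r \<in> common_invariants (poly_ring n) \<delta> ({..<n - 1} - {i})"
    using r by (auto simp: common_invariants_def invariants_\<delta> lookup_single when_def)
  then show "\<not> common_invariants (poly_ring n) \<delta> ({..<n - 1} - {i}) \<subseteq> invariants (poly_ring n) (\<delta> i)"
    using not by blast
  fix j assume j: "j < n - 1" "i \<noteq> j"
  interpret Q: pullback R "E j" "poly_ring n" \<psi> by (rule pullback_E[OF j(1)])
  have \<delta>j: "\<delta> j = Q.D" by (simp add: \<delta>_def)
  show "exp_maps_commute (poly_ring n) (\<delta> i) (\<delta> j)"
    unfolding exp_maps_commute_def
  proof (intro allI impI ballI)
    fix a b and x :: "'k mpoly" assume x: "x \<in> poly_ring n"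
    show "\<delta> i a (\<delta> j b x) = \<delta> j b (\<delta> i a x)"
    proof (rule P.eqI)
      show "\<delta> i a (\<delta> j b x) \<in> poly_ring n" "\<delta> j b (\<delta> i a x) \<in> poly_ring n"
        unfolding \<delta>i \<delta>j by (intro P.D_B Q.D_B x)+
      show "\<psi> (\<delta> i a (\<delta> j b x)) = \<psi> (\<delta> j b (\<delta> i a x))"
        unfolding \<delta>i \<delta>j
        by (simp add: P.\<psi>_D Q.\<psi>_D P.D_B Q.D_B x E_commute[OF j(2)])
    qed
  qed
qed

text \<open>
  A polynomial that is invariant under all translations has no variables.
\<close>

lemma common_invariants_\<delta>:
  assumes "b \<in> poly_ring n"
  shows "b \<in> common_invariants (poly_ring n) \<delta> {..<n - 1} \<longleftrightarrow> to_fract b \<in> K"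
proof
  assume "b \<in> common_invariants (poly_ring n) \<delta> {..<n - 1}"
  then have 0: "lookup e i = 0" if "e \<in> keys (\<psi> b)" "i < n - 1" for e i
    using that by (auto simp: common_invariants_def invariants_\<delta>)
  have "e = 0" if e: "e \<in> keys (\<psi> b)" for e
  proof (rule poly_mapping_eqI)
    fix i
    show "lookup e i = lookup 0 i"
      using 0[OF e, of i] polysD[OF \<psi>_R[OF assms] e]
      by (cases "i < n - 1") (auto simp: subset_iff in_keys_iff)
  qed
  then have "\<psi> b = single 0 (lookup (\<psi> b) 0)"
    by (intro poly_mapping_eqI) (auto simp: lookup_single when_def in_keys_iff)
  then have "to_fract b = lookup (\<psi> b) 0"
    using ev_\<psi>[OF assms] by (metis eval_mpoly_simps(1) monom_val_0 mult.right_neutral)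
  then show "to_fract b \<in> K"
    using lookup_polys[OF subring_0[OF K_subring] \<psi>_R[OF assms]] by simp
next
  assume "to_fract b \<in> K"
  then have "\<psi> b = single 0 (to_fract b)" using assms by (intro \<psi>_eqI polys_single) auto
  then show "b \<in> common_invariants (poly_ring n) \<delta> {..<n - 1}"
    using assms by (auto simp: common_invariants_def invariants_\<delta>)
qed

text \<open>
  For constant \<open>f\<close> nothing nontrivial is inverted, and \<open>B\<close> itself would be generated by \<open>n - 1\<close>
  elements over \<open>k\<close>.
\<close>

lemma f_nonconstant: "f \<notin> base_field"
proof
  assume "f \<in> base_field"
  then have "S \<subseteq> base_field" unfolding S by (intro adjoin_least base_field_subring) auto
  then have S_eq: "S = base_field" using base_field_S by blast
  have unit: "z \<in> to_fract ` C" if C: "is_subring C" "base_field \<subseteq> C" and z: "z \<in> localize C S" for z C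
  proof -
    obtain r t where r: "r \<in> C" "t \<in> S - {0}" "to_fract t * z = to_fract r" using z by (auto simp: localize_iff)
    obtain a where "t = single 0 a" using r(2) unfolding S_eq base_field_def by blast
    with r(2) have a: "t = single 0 a" "a \<noteq> 0" by auto
    have "z = to_fract (single 0 (inverse a)) * (to_fract t * z)"
      using a by (simp add: mult_single flip: mult.assoc to_fract_mult)
    then have "z = to_fract (single 0 (inverse a) * r)" by (simp add: r(3))
    moreover have "single 0 (inverse a) * r \<in> C"
      using C r(1) by (intro subring_mult[OF C(1)]) (auto simp: base_field_def)
    ultimately show ?thesis by blast
  qed
  have "set ys \<subseteq> localize (poly_ring n) S" unfolding gen using K_subring by (rule adjoin_gens)
  then have "\<forall>i<n - 1. \<exists>b\<in>poly_ring n. ys ! i = to_fract b"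
    using unit[OF poly_ring_subring base_field_subset] len by (metis imageE nth_mem subsetD)
  then obtain b where b: "\<And>i. i < n - 1 \<Longrightarrow> b i \<in> poly_ring n \<and> ys ! i = to_fract (b i)" by metis
  define bs where "bs = map b [0..<n - 1]"
  have T: "is_subring (adjoin base_field bs)" by (rule adjoin_subring[OF base_field_subring])
  have "adjoin K ys \<subseteq> to_fract ` adjoin base_field bs"
  proof (rule adjoin_least)
    show "is_subring (to_fract ` adjoin base_field bs)"
    proof (rule is_subringI)
      show "1 \<in> to_fract ` adjoin base_field bs" using subring_1[OF T] by (metis imageI to_fract_1)
    qed (auto simp flip: to_fract_add to_fract_mult to_fract_uminus
        intro!: imageI subring_add[OF T] subring_mult[OF T] subring_uminus[OF T])
    have "K \<subseteq> to_fract ` base_field" using unit[OF base_field_subring order.refl] by (auto simp: K S_eq)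
    then show "K \<subseteq> to_fract ` adjoin base_field bs" by (auto dest!: subsetD intro: adjoin_base)
    show "set ys \<subseteq> to_fract ` adjoin base_field bs"
    proof
      fix z assume "z \<in> set ys"
      then obtain i where i: "i < n - 1" "z = ys ! i" by (auto simp: in_set_conv_nth len)
      then have "bs ! i \<in> adjoin base_field bs" "z = to_fract (bs ! i)"
        using b adjoin_gen[OF base_field_subring, of i bs] by (auto simp: bs_def)
      then show "z \<in> to_fract ` adjoin base_field bs" by blast
    qed
  qed
  then have "poly_ring n \<subseteq> adjoin base_field bs"
    unfolding gen[symmetric] using to_fract_in_localize[OF S_subring, of _ "poly_ring n"]
    by (metis (no_types, lifting) imageE subsetD subsetI to_fract_eq_iff)
  then have "set (vars n) \<subseteq> adjoin base_field bs" using vars_subset by blast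
  then show False
    using alg_dependent_of_more_generators[of "vars n" bs] alg_independent_vars[where ?'k = 'k, of n] n
    by (simp add: bs_def)
qed

text \<open>
  Here \<open>f = p(g)\<close> and \<open>v'(f) g = u'(f)\<close>.  Comparing degrees after a substitution into \<open>k[t]\<close> that keeps
  \<open>f\<close> nonconstant shows that the degree of \<open>p\<close> divides 1, so \<open>f\<close> and \<open>g\<close> differ by an affine change.
\<close>

lemma coordinate_if_coordinate_generates_invariants:
  assumes g: "is_coordinate n g"
    and inv: "common_invariants (poly_ring n) \<delta> {..<n - 1} = adjoin base_field [g]"
  shows "is_coordinate n f"
proof -
  note k = base_field_subring[where ?'k = 'k]
  have gB: "g \<in> poly_ring n" using g by (simp add: is_coordinate_def)
  have "g \<in> adjoin base_field [g]" using adjoin_gens[OF k, of "[g]"] by simp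
  then have "to_fract g \<in> K" using common_invariants_\<delta>[OF gB] inv by blast
  then obtain u v where uv: "u \<in> S" "v \<in> S - {0}" "to_fract v * to_fract g = to_fract u"
    unfolding K by (auto simp: localize_iff)
  obtain u' v' where u': "u = upoly u' f" and v': "v = upoly v' f"
    using uv unfolding S adjoin_one by blast
  have vg: "v * g = u" using uv(3) by (metis to_fract_eq_iff to_fract_mult)
  have "f \<in> adjoin base_field [g]"
    using common_invariants_\<delta>[OF f] inv to_fract_K[OF f_in_S] by blast
  then obtain p where p: "f = upoly p g" unfolding adjoin_one by blast
  obtain y where y: "degree (coeff_map.hom_eval y f) > 0"
    using kronecker_nonconstant[OF f f_nonconstant] by blast
  define \<phi> where "\<phi> = coeff_map.hom_eval y"
  have \<phi>f: "\<phi> f = pcompose p (\<phi> g)" by (simp add: p \<phi>_def hom_eval_upoly)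
  have deg_f: "degree (\<phi> f) = degree p * degree (\<phi> g)" by (simp add: \<phi>f degree_pcompose)
  have pos: "degree (\<phi> f) > 0" using y by (simp add: \<phi>_def)
  have "v' \<noteq> 0" using uv(2) v' by auto
  then have nz: "pcompose v' (\<phi> f) \<noteq> 0" "\<phi> g \<noteq> 0"
    using pcompose_eq_0[of v' "\<phi> f"] pos deg_f by auto
  have "pcompose v' (\<phi> f) * \<phi> g = pcompose u' (\<phi> f)"
    using arg_cong[OF vg, of \<phi>] by (simp add: u' v' \<phi>_def coeff_map.hom_eval_mult hom_eval_upoly)
  then have "degree v' * degree (\<phi> f) + degree (\<phi> g) = degree u' * degree (\<phi> f)"
    using nz by (metis degree_mult_eq degree_pcompose)
  then have "degree (\<phi> g) * (degree v' * degree p + 1) = degree (\<phi> g) * (degree u' * degree p)"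
    by (simp add: deg_f algebra_simps)
  moreover have "degree (\<phi> g) > 0" using pos deg_f by (cases "degree (\<phi> g)") auto
  ultimately have "degree v' * degree p + 1 = degree u' * degree p" using nat_mult_eq_cancel1 by blast
  then have "degree p dvd 1" by (metis dvd_add_right_iff dvd_triv_right)
  then have "degree p = 1" by simp
  then obtain \<alpha> \<beta> where lin: "p = [:\<beta>, \<alpha>:]" "\<alpha> \<noteq> 0" by (metis degree1_coeffs)
  have f_eq: "f = single 0 \<beta> + g * single 0 \<alpha>" by (simp add: p lin)
  have g_eq: "g = single 0 (inverse \<alpha>) * (f - single 0 \<beta>)"
    unfolding f_eq using lin(2) by (simp add: mult_single mult.commute[of g] flip: mult.assoc)
  obtain gs where gs: "length (g # gs) = n" "set gs \<subseteq> poly_ring n" "poly_ring n = adjoin base_field (g # gs)"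
    using g by (auto simp: is_coordinate_def)
  have const: "single 0 c \<in> adjoin base_field zs" for c and zs :: "'k mpoly list"
    by (rule adjoin_base) (simp add: base_field_def)
  have "adjoin base_field (g # gs) = adjoin base_field (f # gs)"
  proof (rule antisym)
    have "set (f # gs) \<subseteq> adjoin base_field (f # gs)" by (rule adjoin_gens[OF k])
    moreover from this have "g \<in> adjoin base_field (f # gs)"
      by (subst g_eq) (auto intro!: subring_mult subring_diff adjoin_subring k const)
    ultimately show "adjoin base_field (g # gs) \<subseteq> adjoin base_field (f # gs)"
      by (simp add: adjoin_subset_iff[OF k])
    have "set (g # gs) \<subseteq> adjoin base_field (g # gs)" by (rule adjoin_gens[OF k])
    moreover from this have "f \<in> adjoin base_field (g # gs)"
      by (subst f_eq) (auto intro!: subring_mult subring_add adjoin_subring k const)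
    ultimately show "adjoin base_field (f # gs) \<subseteq> adjoin base_field (g # gs)"
      by (simp add: adjoin_subset_iff[OF k])
  qed
  then show ?thesis unfolding is_coordinate_def using f gs by (intro conjI exI[of _ gs]) auto
qed

end

theorem CE_imp_WAS:
  assumes n: "n \<ge> 1" and CE: "CE TYPE('k::field) n"
  shows "WAS TYPE('k) n"
  unfolding WAS_def
proof (intro allI impI)
  fix f :: "'k mpoly"
  let ?S = "adjoin base_field [f]"
  assume f: "f \<in> poly_ring n"
    and "is_polynomial_ring (localize ?S ?S) (localize (poly_ring n) ?S) (n - 1)"
  then obtain ys where ys: "length ys = n - 1" "alg_independent (localize ?S ?S) ys"
    "localize (poly_ring n) ?S = adjoin (localize ?S ?S) ys"
    by (auto simp: is_polynomial_ring_def)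
  interpret generic_polynomial_structure n f ?S "localize ?S ?S" ys
    by unfold_locales (use n f ys in auto)
  show "is_coordinate n f"
    using CE irredundant_commuting_\<delta> coordinate_if_coordinate_generates_invariants
    unfolding CE_def by blast
qed

theorem theorem6p11:
  fixes n :: nat
  assumes "n \<ge> 1"
  shows "CE TYPE('k::field) n \<longleftrightarrow> WAS TYPE('k) n"
  using CE_imp_WAS WAS_imp_CE assms by blast

end
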